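(* Let $c>0$ and let $H_n$ be the ultrametric ensemble with parameter $c$ described in the context, and let $E\in\mathbb{R}$. Then there exist $w,\mu,\kappa>0$, $C<\infty$, and a sequence of integers $m_n$ with $n-m_n\to\infty$ such that for all $n$ and every $x\in B_n$, \[\mathbb{P}\Big(\sum_{y\in B_n\setminus B_{m_n}(x)} Q_n(x,y;W)>2^{-\mu n}\Big)\le C\,2^{-\kappa n},\qquad W=\big[E-2^{-(1-w)n},\,E+2^{-(1-w)n}\big].\]
   Context: Let $B_n=\{1,\dots,2^n\}$. For $0\le r\le n$ let $\mathcal{P}_r$ be the partition of $B_n$ into the $2^{n-r}$ consecutive blocks $\{1,\dots,2^r\},\{2^r+1,\dots,2\cdot 2^r\},\dots$, and let $d(x,y)=\min\{r\ge 0: x,y \text{ lie in a common block of }\mathcal{P}_r\}$; $B_m(x)=\{y\in B_n: d(x,y)\le m\}$ denotes the block of $\mathcal{P}_m$ containing $x$. For $0\le r\le n$, $\Phi_{n,r}$ is a real symmetric random matrix on $\ell^2(B_n)$ whose entries are independent (up to symmetry) centered real Gaussians with $\mathbb{E}|\langle\delta_y,\Phi_{n,r}\delta_x\rangle|^2=2^{-r}\cdot 2$ if $x=y$, $=2^{-r}$ if $1\le d(x,y)\le r$, and $=0$ otherwise; the $\Phi_{n,r}$, $r=0,\dots,n$, are independent. The ultrametric ensemble with parameter $c$ is $H_n=Z_{n,c}^{-1}\sum_{r=0}^n 2^{-(1+c)r/2}\Phi_{n,r}$ with $Z_{n,c}>0$ chosen so that $\sum_{y}\mathbb{E}|\langle\delta_y,H_n\delta_x\rangle|^2=1$.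 With $\{\psi_\lambda\}$ an orthonormal basis of ($\ell^2$-normalized) eigenfunctions of $H_n$, the eigenfunction correlator is $Q_n(x,y;W)=\sum_{\lambda\in\sigma(H_n)\cap W}|\psi_\lambda(x)\psi_\lambda(y)|$. *)

theory Defs
  imports "HOL-Probability.Probability"
begin

definition Bn :: "nat \<Rightarrow> nat set" where
  "Bn n = {1..2^n}"

text \<open>Hierarchical distance: least r such that x and y lie in a common block of P_r
  (blocks of P_r are {k 2^r + 1, ..., (k+1) 2^r}).\<close>
definition hdist :: "nat \<Rightarrow> nat \<Rightarrow> nat" where
  "hdist x y = (LEAST r. (x - 1) div 2^r = (y - 1) div 2^r)"

definition hball :: "nat \<Rightarrow> int \<Rightarrow> nat \<Rightarrow> nat set" where
  "hball n m x = {y \<in> Bn n. int (hdist x y) \<le> m}"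

definition phivar :: "nat \<Rightarrow> nat \<Rightarrow> nat \<Rightarrow> real" where
  "phivar r x y = (if x = y then 2 * 2 powr (- real r)
                   else if 1 \<le> hdist x y \<and> hdist x y \<le> r then 2 powr (- real r) else 0)"

text \<open>Index set of the independent standard Gaussians: one for each level r \<le> n and each
  unordered pair x \<le> y in B_n.\<close>
definition gidx :: "nat \<Rightarrow> (nat \<times> nat \<times> nat) set" where
  "gidx n = {(r, x, y). r \<le> n \<and> x \<in> Bn n \<and> y \<in> Bn n \<and> x \<le> y}"

definition std_gauss :: "real measure" where
  "std_gauss = density lborel (\<lambda>t. ennreal (std_normal_density t))"

definition ens_space :: "nat \<Rightarrow> ((nat \<times> nat \<times> nat) \<Rightarrow> real) measure" where
  "ens_space n = PiM (gidx n) (\<lambda>_. std_gauss)"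

text \<open>Entries of Phi_{n,r}: centered Gaussians with the prescribed variances, independent up
  to symmetry, independent across r.\<close>
definition Phi :: "nat \<Rightarrow> ((nat \<times> nat \<times> nat) \<Rightarrow> real) \<Rightarrow> nat \<Rightarrow> nat \<Rightarrow> real" where
  "Phi r \<omega> x y = sqrt (phivar r x y) * \<omega> (r, min x y, max x y)"

text \<open>Normalisation Z_{n,c}: the positive constant with sum_y E|H_n(x,y)|^2 = 1, i.e.
  Z^2 = sum_y sum_r 2^{-(1+c) r} Var(Phi_{n,r}(x,y)) (independent of x; computed at x = 1).\<close>
definition Zn :: "nat \<Rightarrow> real \<Rightarrow> real" where
  "Zn n c = sqrt (\<Sum>y\<in>Bn n. \<Sum>r\<le>n. 2 powr (- (1 + c) * real r) * phivar r 1 y)"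

definition Hn :: "nat \<Rightarrow> real \<Rightarrow> ((nat \<times> nat \<times> nat) \<Rightarrow> real) \<Rightarrow> nat \<Rightarrow> nat \<Rightarrow> real" where
  "Hn n c \<omega> x y = (1 / Zn n c) * (\<Sum>r\<le>n. 2 powr (- (1 + c) * real r / 2) * Phi r \<omega> x y)"

definition is_eigbasis :: "nat \<Rightarrow> (nat \<Rightarrow> nat \<Rightarrow> real) \<Rightarrow> (nat \<Rightarrow> nat \<Rightarrow> real) \<Rightarrow> (nat \<Rightarrow> real) \<Rightarrow> bool" where
  "is_eigbasis n A psi lam \<longleftrightarrow>
     (\<forall>k\<in>Bn n. \<forall>l\<in>Bn n. (\<Sum>z\<in>Bn n. psi k z * psi l z) = (if k = l then 1 else 0)) \<and>
     (\<forall>k\<in>Bn n. \<forall>x\<in>Bn n. (\<Sum>y\<in>Bn n. A x y * psi k y) = lam k * psi k x)"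

definition Qcorr :: "nat \<Rightarrow> (nat \<Rightarrow> nat \<Rightarrow> real) \<Rightarrow> (nat \<Rightarrow> real) \<Rightarrow> nat \<Rightarrow> nat \<Rightarrow> real set \<Rightarrow> real" where
  "Qcorr n psi lam x y W = (\<Sum>k\<in>{k\<in>Bn n. lam k \<in> W}. \<bar>psi k x * psi k y\<bar>)"

end

theory Submission
  imports Defs
begin

text \<open>
  Take \<open>k = n - \<lfloor>\<theta> n\<rfloor>\<close> and let \<open>B\<close> be the block of level \<open>k\<close> around \<open>x\<close>, \<open>D\<close> its complement and \<open>V\<close> the
  coupling of \<open>B\<close> and \<open>D\<close>; its entries are independent of \<open>H\<^sub>B \<oplus> H\<^sub>D\<close> and have variance at most
  \<open>2 powr (-(2 + c) k)\<close>.  Expand an eigenfunction at energy \<open>\<lambda>\<close> in the eigenbasis of \<open>H\<^sub>B \<oplus> H\<^sub>D\<close> with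
  coefficients \<open>a\<^sub>b\<close>, so that \<open>(\<lambda>\<^sub>b - \<lambda>) a\<^sub>b = - \<Sum> V\<^sub>b\<^sub>d a\<^sub>d\<close>.  Since \<open>V\<close> is Gaussian, the operator
  \<open>\<bar>H\<^sub>B \<oplus> H\<^sub>D - E\<bar>\<^sup>-\<^sup>1\<^sup>/\<^sup>2 V \<bar>H\<^sub>B \<oplus> H\<^sub>D - E\<bar>\<^sup>-\<^sup>1\<^sup>/\<^sup>2\<close>, suitably regularised, has mean square Hilbert-Schmidt norm of order
  \<open>2 powr (-(2 + c) k)\<close> times the squared trace of \<open>\<bar>H\<^sub>B \<oplus> H\<^sub>D - E\<bar>\<^sup>-\<^sup>1\<close>.  That trace is about \<open>n 2^n\<close> by the
  Wegner estimate, so the norm is small although \<open>V\<close> is far larger than the level spacing in operator norm.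
  As \<open>H\<^sub>B\<close> and \<open>H\<^sub>D\<close> are independent, their spectra near \<open>E\<close> do not come closer than
  \<open>2 powr (-(1 + 3 \<theta>) n)\<close>; hence \<open>\<lambda>\<close> is resonant with at most one of the two blocks, and the eigenfunction is small
  on the other one.
\<close>

section \<open>Spectral theorem for real symmetric matrices\<close>

text \<open>All exponents are measured in units of \<open>\<theta>\<close>. The squared coupling
  norm has exponent \<open>-(2 + c) k + 2 n\<close>, which is \<open>-c n\<close> up to multiples of
  \<open>\<theta> n\<close>, so every \<open>c > 0\<close> leaves a gain once
  \<open>\<theta>\<close> is small against \<open>c\<close>. The obstacle is the resonant block,
  where the trace gives no control of the inverse distance to the eigenvalue. The weights are
  therefore required to dominate that inverse distance on nonresonant modes only, and the mass on
  resonant modes enters as a source term. Separation at resolution \<open>1 / L\<close> has a price: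
  on the whole window the weights must be raised from \<open>1 / r\<close> to \<open>L\<close>, a
  factor \<open>2^(4 \<theta> n)\<close>. Which block is resonant depends on the eigenfunction, but
  the correlator between \<open>x\<close> and \<open>D\<close> contains the product of the two
  weighted norms, and this product is small in either case. Random quantities are expressed through
  entries of functions of block matrices, and independence is used by redrawing one Gaussian
  coordinate at a time.\<close>

definition ip :: "'a set \<Rightarrow> ('a \<Rightarrow> real) \<Rightarrow> ('a \<Rightarrow> real) \<Rightarrow> real" where
  "ip S u v = (\<Sum>x\<in>S. u x * v x)"

definition mv :: "'a set \<Rightarrow> ('a \<Rightarrow> 'a \<Rightarrow> real) \<Rightarrow> ('a \<Rightarrow> real) \<Rightarrow> 'a \<Rightarrow> real" where
  "mv S A v x = (\<Sum>y\<in>S. A x y * v y)"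

definition orthonormal_on :: "'a set \<Rightarrow> 'b set \<Rightarrow> ('b \<Rightarrow> 'a \<Rightarrow> real) \<Rightarrow> bool" where
  "orthonormal_on S F \<phi> \<longleftrightarrow> (\<forall>k\<in>F. \<forall>l\<in>F. ip S (\<phi> k) (\<phi> l) = (if k = l then 1 else 0))"

definition symm_on :: "'a set \<Rightarrow> ('a \<Rightarrow> 'a \<Rightarrow> real) \<Rightarrow> bool" where
  "symm_on S A \<longleftrightarrow> (\<forall>x\<in>S. \<forall>y\<in>S. A x y = A y x)"

definition eigen_on ::
    "'a set \<Rightarrow> 'b set \<Rightarrow> ('a \<Rightarrow> 'a \<Rightarrow> real) \<Rightarrow> ('b \<Rightarrow> 'a \<Rightarrow> real) \<Rightarrow> ('b \<Rightarrow> real) \<Rightarrow> bool" where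
  "eigen_on S F A \<phi> l \<longleftrightarrow> orthonormal_on S F \<phi> \<and> (\<forall>k\<in>F. \<forall>x\<in>S. mv S A (\<phi> k) x = l k * \<phi> k x)"

lemma ip_commute: "ip S u v = ip S v u"
  by (simp add: ip_def mult.commute)

lemma ip_add_right: "ip S u (\<lambda>x. v x + w x) = ip S u v + ip S u w"
  by (simp add: ip_def distrib_left sum.distrib)

lemma ip_add_left: "ip S (\<lambda>x. v x + w x) u = ip S v u + ip S w u"
  by (simp add: ip_def distrib_right sum.distrib)

lemma ip_scale_left: "ip S (\<lambda>x. t * v x) u = t * ip S v u"
  by (simp add: ip_def sum_distrib_left mult.assoc)

lemma ip_diff_right: "ip S u (\<lambda>x. v x - w x) = ip S u v - ip S u w"
  by (simp add: ip_def right_diff_distrib sum_subtractf)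

lemma ip_scale_right: "ip S u (\<lambda>x. t * v x) = t * ip S u v"
  by (simp add: ip_def sum_distrib_left mult.left_commute)

lemma ip_cong: "(\<And>x. x \<in> S \<Longrightarrow> u x = u' x) \<Longrightarrow> (\<And>x. x \<in> S \<Longrightarrow> v x = v' x) \<Longrightarrow> ip S u v = ip S u' v'"
  by (simp add: ip_def)

lemma ip_self_nonneg: "0 \<le> ip S u u"
  by (simp add: ip_def sum_nonneg)

lemma ip_self_eq_0_iff: "finite S \<Longrightarrow> ip S u u = 0 \<longleftrightarrow> (\<forall>x\<in>S. u x = 0)"
  by (simp add: ip_def sum_nonneg_eq_0_iff)

lemma ip_mv_symm:
  assumes "symm_on S A"
  shows "ip S u (mv S A v) = ip S (mv S A u) v"
proof -
  have "ip S u (mv S A v) = (\<Sum>x\<in>S. \<Sum>y\<in>S. u x * (A x y * v y))"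
    by (simp add: ip_def mv_def sum_distrib_left)
  also have "\<dots> = (\<Sum>y\<in>S. \<Sum>x\<in>S. u x * (A x y * v y))"
    by (rule sum.swap)
  also have "\<dots> = ip S (mv S A u) v"
    unfolding ip_def mv_def sum_distrib_right
    by (intro sum.cong refl) (use assms in \<open>simp add: symm_on_def mult_ac\<close>)
  finally show ?thesis .
qed

lemma mv_add_scale: "mv S A (\<lambda>x. v x + t * w x) x = mv S A v x + t * mv S A w x"
  by (simp add: mv_def distrib_left sum.distrib sum_distrib_left mult.left_commute)

section \<open>Orthonormal families: residual and completeness\<close>

text \<open>The sum over \<open>F\<close> is the kernel of the projection onto the span of the
  \<open>\<phi> k\<close>, so the left side is the squared Hilbert-Schmidt norm of the complementary
  projection, which is its rank. With \<open>F = S\<close> it gives completeness; with fewer vectors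
  it shows that the complement is not trivial.\<close>

lemma residual_sum:
  assumes S: "finite S" and F: "finite F" and on: "orthonormal_on S F \<phi>"
  shows "(\<Sum>x\<in>S. \<Sum>y\<in>S. ((if x = y then 1 else 0) - (\<Sum>k\<in>F. \<phi> k x * \<phi> k y))\<^sup>2) = real (card S) - real (card F)"
proof -
  define p where "p x y = (\<Sum>k\<in>F. \<phi> k x * \<phi> k y)" for x y
  have pp: "(\<Sum>y\<in>S. (p x y)\<^sup>2) = p x x" for x
  proof -
    have "(\<Sum>y\<in>S. (p x y)\<^sup>2) = (\<Sum>y\<in>S. \<Sum>k\<in>F. \<Sum>l\<in>F. \<phi> k x * \<phi> l x * (\<phi> k y * \<phi> l y))"
      by (simp add: p_def power2_eq_square sum_product mult_ac)
    also have "\<dots> = (\<Sum>k\<in>F. \<Sum>l\<in>F. \<phi> k x * \<phi> l x * ip S (\<phi> k) (\<phi> l))"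
      unfolding ip_def sum_distrib_left
      by (subst sum.swap, rule sum.cong, simp, subst sum.swap, simp)
    also have "\<dots> = (\<Sum>k\<in>F. \<Sum>l\<in>F. if k = l then \<phi> k x * \<phi> l x else 0)"
      by (intro sum.cong refl) (use on in \<open>auto simp: orthonormal_on_def\<close>)
    also have "\<dots> = p x x"
      using F by (simp add: p_def)
    finally show ?thesis .
  qed
  have "(\<Sum>y\<in>S. ((if x = y then 1 else 0) - p x y)\<^sup>2) = 1 - p x x" if "x \<in> S" for x
  proof -
    have "(\<Sum>y\<in>S. ((if x = y then 1 else 0) - p x y)\<^sup>2)
        = (\<Sum>y\<in>S. (if x = y then 1 - 2 * p x y else 0) + (p x y)\<^sup>2)"
      by (intro sum.cong refl) (auto simp: power2_eq_square algebra_simps)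
    also have "\<dots> = 1 - 2 * p x x + p x x"
      using S that by (simp add: sum.distrib pp)
    finally show ?thesis by simp
  qed
  then have "(\<Sum>x\<in>S. \<Sum>y\<in>S. ((if x = y then 1 else 0) - p x y)\<^sup>2) = (\<Sum>x\<in>S. 1 - p x x)"
    by simp
  also have "\<dots> = real (card S) - (\<Sum>k\<in>F. ip S (\<phi> k) (\<phi> k))"
    unfolding p_def ip_def by (subst sum.swap) (simp add: sum_subtractf)
  also have "(\<Sum>k\<in>F. ip S (\<phi> k) (\<phi> k)) = real (card F)"
    using on by (simp add: orthonormal_on_def)
  finally show ?thesis by (simp add: p_def)
qed

lemma orthonormal_complete:
  assumes "finite S" "orthonormal_on S S \<phi>" "x \<in> S" "y \<in> S"
  shows "(\<Sum>k\<in>S. \<phi> k x * \<phi> k y) = (if x = y then 1 else 0)"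
proof -
  have "(\<Sum>x\<in>S. \<Sum>y\<in>S. ((if x = y then 1 else 0) - (\<Sum>k\<in>S. \<phi> k x * \<phi> k y))\<^sup>2) = 0"
    using residual_sum[OF assms(1) assms(1) assms(2)] by simp
  then have "((if x = y then 1 else 0) - (\<Sum>k\<in>S. \<phi> k x * \<phi> k y))\<^sup>2 = 0"
    using assms(1,3,4) by (simp add: sum_nonneg_eq_0_iff sum_nonneg)
  then show ?thesis by (auto split: if_splits)
qed

lemma orthonormal_expand:
  assumes "finite S" "orthonormal_on S S \<phi>" "x \<in> S"
  shows "u x = (\<Sum>k\<in>S. ip S (\<phi> k) u * \<phi> k x)"
proof -
  have "(\<Sum>k\<in>S. ip S (\<phi> k) u * \<phi> k x) = (\<Sum>k\<in>S. \<Sum>y\<in>S. u y * (\<phi> k x * \<phi> k y))"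
    unfolding ip_def sum_distrib_right by (intro sum.cong refl) (simp add: mult_ac)
  also have "\<dots> = (\<Sum>y\<in>S. u y * (\<Sum>k\<in>S. \<phi> k x * \<phi> k y))"
    by (subst sum.swap) (simp add: sum_distrib_left)
  also have "\<dots> = (\<Sum>y\<in>S. if x = y then u y else 0)"
    by (intro sum.cong refl) (use orthonormal_complete[OF assms(1,2,3)] in auto)
  also have "\<dots> = u x" using assms by simp
  finally show ?thesis by simp
qed

section \<open>Eigenvectors by maximising the quadratic form\<close>

text \<open>First-order stationarity at \<open>t = 0\<close>: for a small step the linear term would
  win. The step \<open>a / d\<close> with \<open>d = \<bar>c\<bar> + 1\<close> is small enough, and
  the 1 keeps \<open>d\<close> positive when \<open>c = 0\<close>.\<close>

lemma quadratic_nonpos_linear_coeff: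
  fixes a c :: real
  assumes "\<And>t. 2 * t * a + t\<^sup>2 * c \<le> 0" "0 \<le> a"
  shows "a = 0"
proof (rule ccontr)
  assume "a \<noteq> 0"
  then have a: "a > 0" using assms by simp
  define d where "d = \<bar>c\<bar> + 1"
  have d: "d > 0" "- c \<le> d" by (auto simp: d_def)
  have "2 * (a / d) * a + (a / d)\<^sup>2 * c = (a\<^sup>2 / d\<^sup>2) * (2 * d + c)"
    using d by (simp add: power2_eq_square field_simps)
  moreover have "2 * d + c > 0" using d by linarith
  ultimately have "2 * (a / d) * a + (a / d)\<^sup>2 * c > 0" using a d by simp
  with assms(1)[of "a / d"] show False by simp
qed

text \<open>Vectors are functions on the whole type, so the coordinates off \<open>S\<close> are
  pinned to 0. The set then is a closed subset of a product of compact sets, and Tychonoff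
  applies.\<close>

lemma compact_unit_sphere_constraints:
  fixes S :: "'a set"
  assumes S: "finite S"
  shows "compact {v :: 'a \<Rightarrow> real. (\<forall>x. x \<notin> S \<longrightarrow> v x = 0) \<and> ip S v v = 1 \<and> (\<forall>k\<in>F. ip S (\<phi> k) v = 0)}"
    (is "compact ?K")
proof -
  let ?P = "Pi\<^sub>E UNIV (\<lambda>x. if x \<in> S then {-1..1::real} else {0})"
  have "compactin (product_topology (\<lambda>i. euclidean) UNIV) ?P"
    by (auto simp: compactin_PiE)
  then have P: "compact ?P"
    by (simp add: euclidean_product_topology)
  have cont: "continuous_on UNIV (\<lambda>v :: 'a \<Rightarrow> real. v x)" for x
    by simp
  have "closed ({v :: 'a \<Rightarrow> real. ip S v v = 1} \<inter> (\<Inter>k\<in>F. {v. ip S (\<phi> k) v = 0}))"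
    unfolding ip_def
    by (intro closed_Int closed_INT ballI closed_Collect_eq continuous_intros cont)
  then have "compact (?P \<inter> ({v :: 'a \<Rightarrow> real. ip S v v = 1} \<inter> (\<Inter>k\<in>F. {v. ip S (\<phi> k) v = 0})))"
    by (rule compact_Int_closed[OF P])
  moreover have "?K = ?P \<inter> ({v. ip S v v = 1} \<inter> (\<Inter>k\<in>F. {v. ip S (\<phi> k) v = 0}))"
  proof -
    have "\<bar>v x\<bar> \<le> 1" if "ip S v v = 1" "x \<in> S" for v x
    proof -
      have "v x * v x \<le> ip S v v"
        unfolding ip_def by (rule member_le_sum[OF that(2)]) (use S in auto)
      then show ?thesis
        using that by (simp add: abs_square_le_1[symmetric] power2_eq_square)
    qed
    moreover have "v \<in> ?P \<longleftrightarrow> (\<forall>x\<in>S. \<bar>v x\<bar> \<le> 1) \<and> (\<forall>x. x \<notin> S \<longrightarrow> v x = 0)" for v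
      by (auto simp: PiE_iff abs_le_iff split: if_splits)
    ultimately show ?thesis
      by blast
  qed
  ultimately show ?thesis by simp
qed

text \<open>A maximiser \<open>v\<close> of the quadratic form exists on the unit sphere of the
  complement of the vectors found so far. That complement is invariant by symmetry, so the residual
  \<open>mv S A v - \<mu> v\<close> is itself an admissible direction; varying \<open>v\<close>
  along it shows that it vanishes.\<close>

lemma exists_next_eigenvector:
  fixes S :: "'a set"
  assumes S: "finite S" and F: "finite F" "card F < card S" and A: "symm_on S A"
    and eig: "eigen_on S F A \<phi> l"
  shows "\<exists>v \<mu>. ip S v v = 1 \<and> (\<forall>k\<in>F. ip S (\<phi> k) v = 0) \<and> (\<forall>x\<in>S. mv S A v x = \<mu> * v x)"
proof -
  define K where "K = {v :: 'a \<Rightarrow> real. (\<forall>x. x \<notin> S \<longrightarrow> v x = 0) \<and> ip S v v = 1 \<and> (\<forall>k\<in>F. ip S (\<phi> k) v = 0)}"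
  define q where "q v = ip S v (mv S A v)" for v
  have on: "orthonormal_on S F \<phi>" using eig by (simp add: eigen_on_def)
  have normalise: "(\<lambda>x. if x \<in> S then u x / sqrt (ip S u u) else 0) \<in> K"
    if u: "ip S u u \<noteq> 0" "\<And>k. k \<in> F \<Longrightarrow> ip S (\<phi> k) u = 0" for u
  proof -
    have s: "sqrt (ip S u u) > 0" using u(1) ip_self_nonneg[of S u] by simp
    have "ip S v (\<lambda>x. if x \<in> S then u x / sqrt (ip S u u) else 0) = ip S v u / sqrt (ip S u u)" for v
      unfolding ip_def sum_divide_distrib by (intro sum.cong refl) auto
    moreover from this have "ip S (\<lambda>x. if x \<in> S then u x / sqrt (ip S u u) else 0) u = ip S u u / sqrt (ip S u u)"
      by (subst ip_commute)
    ultimately show ?thesis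
      using u s by (auto simp: K_def real_div_sqrt ip_self_nonneg)
  qed
  have "K \<noteq> {}"
  proof -
    have "(\<Sum>x\<in>S. \<Sum>y\<in>S. ((if x = y then 1 else 0) - (\<Sum>k\<in>F. \<phi> k x * \<phi> k y))\<^sup>2) \<noteq> 0"
      using residual_sum[OF S F(1) on] F(2) by simp
    then obtain x where x: "x \<in> S"
      "(\<Sum>y\<in>S. ((if x = y then 1 else 0) - (\<Sum>k\<in>F. \<phi> k x * \<phi> k y))\<^sup>2) \<noteq> 0"
      by (meson sum.neutral)
    \<comment> \<open>The unit vector at \<open>x\<close> minus its projection onto the span of the
      \<open>\<phi> k\<close>. The site \<open>x\<close> indexes a nonzero row of the residual
      matrix, so \<open>u\<close> is not zero.\<close>
    define u where "u y = (if x = y then 1 else 0) - (\<Sum>k\<in>F. \<phi> k x * \<phi> k y)" for y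
    have "ip S (\<phi> j) u = 0" if j: "j \<in> F" for j
    proof -
      have "ip S (\<phi> j) u = (\<Sum>y\<in>S. if x = y then \<phi> j y else 0) - (\<Sum>y\<in>S. \<phi> j y * (\<Sum>k\<in>F. \<phi> k x * \<phi> k y))"
        unfolding ip_def u_def sum_subtractf[symmetric] by (intro sum.cong refl) (auto simp: algebra_simps)
      also have "(\<Sum>y\<in>S. \<phi> j y * (\<Sum>k\<in>F. \<phi> k x * \<phi> k y)) = (\<Sum>k\<in>F. \<phi> k x * ip S (\<phi> j) (\<phi> k))"
        unfolding ip_def sum_distrib_left by (subst sum.swap) (simp add: mult_ac)
      also have "\<dots> = (\<Sum>k\<in>F. if j = k then \<phi> k x else 0)"
        by (intro sum.cong refl) (use on j in \<open>auto simp: orthonormal_on_def\<close>)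
      finally show ?thesis using x S F j by simp
    qed
    moreover have "ip S u u \<noteq> 0" using x(2) by (simp add: ip_def u_def power2_eq_square)
    ultimately show ?thesis using normalise by blast
  qed
  moreover have "compact K" unfolding K_def by (rule compact_unit_sphere_constraints[OF S])
  moreover have "continuous_on K q"
    unfolding q_def ip_def mv_def
    by (intro continuous_intros continuous_on_subset[OF continuous_on_product_coordinates]) auto
  ultimately obtain v where v: "v \<in> K" and max: "\<And>u. u \<in> K \<Longrightarrow> q u \<le> q v"
    using continuous_attains_sup by metis
  define \<mu> where "\<mu> = q v"
  have bound: "q u \<le> \<mu> * ip S u u" if u: "\<And>k. k \<in> F \<Longrightarrow> ip S (\<phi> k) u = 0" for u
  proof (cases "ip S u u = 0")
    case True
    then have "\<forall>x\<in>S. u x = 0" using ip_self_eq_0_iff[OF S] by blast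
    then show ?thesis using True by (simp add: q_def ip_def)
  next
    case False
    let ?u = "\<lambda>x. if x \<in> S then u x / sqrt (ip S u u) else 0"
    have s: "ip S u u > 0" using False ip_self_nonneg[of S u] by simp
    have "mv S A ?u x = mv S A u x / sqrt (ip S u u)" for x
      unfolding mv_def sum_divide_distrib by (intro sum.cong refl) auto
    then have "q ?u = (\<Sum>x\<in>S. u x * mv S A u x / (sqrt (ip S u u) * sqrt (ip S u u)))"
      unfolding q_def ip_def by (intro sum.cong refl) auto
    also have "\<dots> = q u / ip S u u"
      using s by (simp add: q_def ip_def sum_divide_distrib[symmetric])
    finally have "q u / ip S u u \<le> \<mu>"
      using max[OF normalise[OF False u]] by (simp add: \<mu>_def)
    then show ?thesis using s by (simp add: field_simps)
  qed
  define w where "w x = mv S A v x - \<mu> * v x" for x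
  have vK: "ip S v v = 1" "\<And>k. k \<in> F \<Longrightarrow> ip S (\<phi> k) v = 0" using v by (auto simp: K_def)
  have wperp: "ip S (\<phi> k) w = 0" if k: "k \<in> F" for k
  proof -
    have "ip S (\<phi> k) w = ip S (mv S A (\<phi> k)) v - \<mu> * ip S (\<phi> k) v"
      unfolding w_def by (simp add: ip_diff_right ip_scale_right ip_mv_symm[OF A])
    also have "ip S (mv S A (\<phi> k)) v = ip S (\<lambda>x. l k * \<phi> k x) v"
      by (rule ip_cong) (use eig k in \<open>auto simp: eigen_on_def\<close>)
    also have "\<dots> = l k * ip S (\<phi> k) v"
      by (rule ip_scale_left)
    finally show ?thesis using vK k by simp
  qed
  have "2 * t * ip S w w + t\<^sup>2 * (q w - \<mu> * ip S w w) \<le> 0" for t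
  proof -
    let ?u = "\<lambda>x. v x + t * w x"
    have perp: "ip S (\<phi> k) ?u = 0" if "k \<in> F" for k
      using that vK wperp by (simp add: ip_add_right ip_scale_right)
    have "q ?u = ip S ?u (\<lambda>x. mv S A v x + t * mv S A w x)"
      unfolding q_def by (intro ip_cong) (simp_all add: mv_add_scale)
    also have "\<dots> = ip S ?u (mv S A v) + t * ip S ?u (mv S A w)"
      by (simp add: ip_add_right ip_scale_right)
    also have "ip S ?u (mv S A v) = \<mu> + t * ip S w (mv S A v)"
      by (simp add: ip_add_left ip_scale_left \<mu>_def q_def)
    also have "ip S ?u (mv S A w) = ip S w (mv S A v) + t * q w"
      by (simp add: ip_add_left ip_scale_left q_def ip_mv_symm[OF A, of v w] ip_commute[of S "mv S A v" w])
    finally have qu: "q ?u = \<mu> + 2 * t * ip S w (mv S A v) + t\<^sup>2 * q w"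
      by (simp add: algebra_simps power2_eq_square)
    have nu: "ip S ?u ?u = 1 + 2 * t * ip S w v + t\<^sup>2 * ip S w w"
      using vK(1) ip_commute[of S v w]
      by (simp add: ip_add_right ip_scale_right ip_add_left ip_scale_left algebra_simps power2_eq_square)
    \<comment> \<open>The right side is half the first variation along \<open>w\<close>, so the
      linear coefficient in \<open>t\<close> is twice the squared norm of the residual.\<close>
    have ww: "ip S w w = ip S w (mv S A v) - \<mu> * ip S w v"
    proof -
      have "ip S w w = ip S w (\<lambda>x. mv S A v x - \<mu> * v x)" by (simp add: w_def[abs_def])
      then show ?thesis by (simp add: ip_diff_right ip_scale_right)
    qed
    have "q ?u \<le> \<mu> * ip S ?u ?u" by (rule bound[OF perp])
    then show ?thesis unfolding qu nu ww by (simp add: algebra_simps)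
  qed
  then have "ip S w w = 0"
    by (rule quadratic_nonpos_linear_coeff) (rule ip_self_nonneg)
  then have "\<forall>x\<in>S. mv S A v x = \<mu> * v x"
    using ip_self_eq_0_iff[OF S, of w] by (simp add: w_def)
  with vK show ?thesis by blast
qed

theorem spectral_theorem:
  fixes S :: "'a set"
  assumes S: "finite S" and A: "symm_on S A"
  shows "\<exists>\<phi> l. eigen_on S S A \<phi> l"
proof -
  have "\<exists>\<phi> l. eigen_on S F A \<phi> l" if "finite F" "F \<subseteq> S" for F
    using that
  proof (induction F rule: finite_induct)
    case empty
    then show ?case by (simp add: eigen_on_def orthonormal_on_def)
  next
    case (insert k F)
    then obtain \<phi> l where eig: "eigen_on S F A \<phi> l" by auto
    have "card F < card S"
      using insert S by (metis card_seteq insert_subset le_less_linear)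
    from exists_next_eigenvector[OF S insert(1) this A eig] obtain v \<mu> where
      v: "ip S v v = 1" "\<forall>k\<in>F. ip S (\<phi> k) v = 0" "\<forall>x\<in>S. mv S A v x = \<mu> * v x" by blast
    have "eigen_on S (insert k F) A (\<phi>(k := v)) (l(k := \<mu>))"
      using eig v insert(2) by (auto simp: eigen_on_def orthonormal_on_def ip_commute[of S v "\<phi> _"])
    then show ?case by blast
  qed
  then show ?thesis using S by blast
qed

section \<open>Eigenfunctions of two weakly coupled blocks\<close>

lemma weighted_Cauchy_Schwarz:
  fixes f g \<rho> :: "'a \<Rightarrow> real"
  assumes "\<And>x. x \<in> A \<Longrightarrow> \<rho> x > 0"
  shows "(\<Sum>x\<in>A. f x * g x)\<^sup>2 \<le> (\<Sum>x\<in>A. (f x)\<^sup>2 / \<rho> x) * (\<Sum>x\<in>A. \<rho> x * (g x)\<^sup>2)"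
proof -
  have "(\<Sum>x\<in>A. f x * g x) = (\<Sum>x\<in>A. (f x / sqrt (\<rho> x)) * (sqrt (\<rho> x) * g x))"
    by (intro sum.cong refl) (use assms in force)
  also have "\<dots>\<^sup>2 \<le> (\<Sum>x\<in>A. (f x / sqrt (\<rho> x))\<^sup>2) * (\<Sum>x\<in>A. (sqrt (\<rho> x) * g x)\<^sup>2)"
    by (rule Cauchy_Schwarz_ineq_sum)
  also have "(\<Sum>x\<in>A. (f x / sqrt (\<rho> x))\<^sup>2) = (\<Sum>x\<in>A. (f x)\<^sup>2 / \<rho> x)"
    by (intro sum.cong refl) (use assms in \<open>simp add: power_divide less_imp_le\<close>)
  also have "(\<Sum>x\<in>A. (sqrt (\<rho> x) * g x)\<^sup>2) = (\<Sum>x\<in>A. \<rho> x * (g x)\<^sup>2)"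
    by (intro sum.cong refl) (use assms in \<open>simp add: power_mult_distrib less_imp_le\<close>)
  finally show ?thesis .
qed

text \<open>The norm \<open>a\<^sup>2 / \<rho>\<close> splits the resolvent factor evenly between
  the two sides of the coupling, which then enters through its Hilbert-Schmidt norm with a square
  root of a weight on either side. \<open>Q\<close> holds the modes for which a resolvent bound is
  available.\<close>

lemma weighted_transfer_bound:
  fixes a a' \<rho> \<rho>' :: "'a \<Rightarrow> real"
  assumes fin: "finite B" "finite D" and Q: "Q \<subseteq> D"
    and \<rho>: "\<And>b. b \<in> B \<Longrightarrow> \<rho> b > 0" "\<And>d. d \<in> D \<Longrightarrow> \<rho>' d > 0"
    and bound: "\<And>d. d \<in> Q \<Longrightarrow> \<bar>a' d\<bar> \<le> \<rho>' d * \<bar>\<Sum>b\<in>B. a b * v b d\<bar>"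
  shows "(\<Sum>d\<in>Q. (a' d)\<^sup>2 / \<rho>' d) \<le> (\<Sum>b\<in>B. \<Sum>d\<in>D. \<rho> b * \<rho>' d * (v b d)\<^sup>2) * (\<Sum>b\<in>B. (a b)\<^sup>2 / \<rho> b)"
proof -
  let ?n = "\<Sum>b\<in>B. (a b)\<^sup>2 / \<rho> b"
  have "(\<Sum>d\<in>Q. (a' d)\<^sup>2 / \<rho>' d) \<le> (\<Sum>d\<in>Q. \<rho>' d * ((\<Sum>b\<in>B. \<rho> b * (v b d)\<^sup>2) * ?n))"
  proof (rule sum_mono)
    fix d assume d: "d \<in> Q"
    with Q \<rho> have p: "\<rho>' d > 0" by auto
    have "(a' d)\<^sup>2 \<le> (\<rho>' d * \<bar>\<Sum>b\<in>B. a b * v b d\<bar>)\<^sup>2"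
      using bound[OF d] by (metis abs_ge_zero power2_abs power_mono)
    also have "\<dots> = (\<rho>' d)\<^sup>2 * (\<Sum>b\<in>B. a b * v b d)\<^sup>2"
      by (simp add: power_mult_distrib)
    also have "\<dots> \<le> (\<rho>' d)\<^sup>2 * (?n * (\<Sum>b\<in>B. \<rho> b * (v b d)\<^sup>2))"
      by (intro mult_left_mono weighted_Cauchy_Schwarz \<rho>) auto
    finally show "(a' d)\<^sup>2 / \<rho>' d \<le> \<rho>' d * ((\<Sum>b\<in>B. \<rho> b * (v b d)\<^sup>2) * ?n)"
      using p by (simp add: divide_le_eq power2_eq_square mult_ac)
  qed
  also have "\<dots> \<le> (\<Sum>d\<in>D. \<rho>' d * ((\<Sum>b\<in>B. \<rho> b * (v b d)\<^sup>2) * ?n))"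
    by (rule sum_mono2[OF fin(2) Q])
       (intro mult_nonneg_nonneg sum_nonneg divide_nonneg_pos zero_le_power2 less_imp_le[OF \<rho>(1)] less_imp_le[OF \<rho>(2)] \<rho>(1); simp)
  also have "\<dots> = (\<Sum>b\<in>B. \<Sum>d\<in>D. \<rho> b * \<rho>' d * (v b d)\<^sup>2) * ?n"
    by (subst sum.swap) (simp add: sum_distrib_left sum_distrib_right mult_ac)
  finally show ?thesis .
qed

text \<open>The eigenvalue equation is tested against \<open>\<phi> b\<close>. Symmetry moves the
  block matrix onto \<open>\<phi> b\<close>, and in the remaining coupling term the restriction of
  \<open>u\<close> to \<open>D\<close> is expanded in \<open>\<phi>'\<close>.\<close>

lemma block_coefficient_equation:
  assumes fin: "finite B" "finite D" and disj: "B \<inter> D = {}" and S: "S = B \<union> D" and h: "symm_on S h"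
    and e1: "eigen_on B B h \<phi> l" and e2: "orthonormal_on D D \<phi>'"
    and u: "\<And>x. x \<in> S \<Longrightarrow> mv S h u x = \<nu> * u x" and b: "b \<in> B"
  shows "(l b - \<nu>) * ip B (\<phi> b) u
    = - (\<Sum>d\<in>D. ip D (\<phi>' d) u * (\<Sum>y\<in>B. \<Sum>z\<in>D. \<phi> b y * h y z * \<phi>' d z))"
proof -
  have hB: "symm_on B h" using h S by (auto simp: symm_on_def)
  have "l b * ip B (\<phi> b) u = ip B (\<lambda>x. l b * \<phi> b x) u"
    by (simp add: ip_scale_left)
  also have "\<dots> = ip B (mv B h (\<phi> b)) u"
    by (rule ip_cong) (use e1 b in \<open>auto simp: eigen_on_def\<close>)
  also have "\<dots> = ip B (\<phi> b) (mv B h u)"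
    by (rule ip_mv_symm[OF hB, symmetric])
  also have "\<dots> = ip B (\<phi> b) (\<lambda>y. \<nu> * u y - mv D h u y)"
  proof (rule ip_cong)
    fix y assume "y \<in> B"
    then have "mv S h u y = \<nu> * u y" using u S by blast
    moreover have "mv S h u y = mv B h u y + mv D h u y"
      unfolding mv_def S using sum.union_disjoint[OF fin disj] by blast
    ultimately show "mv B h u y = \<nu> * u y - mv D h u y" by simp
  qed simp
  also have "\<dots> = \<nu> * ip B (\<phi> b) u - ip B (\<phi> b) (mv D h u)"
    by (simp add: ip_diff_right ip_scale_right)
  finally have "(l b - \<nu>) * ip B (\<phi> b) u = - ip B (\<phi> b) (mv D h u)"
    by (simp add: algebra_simps)
  also have "ip B (\<phi> b) (mv D h u)
      = (\<Sum>y\<in>B. \<Sum>z\<in>D. \<phi> b y * h y z * (\<Sum>d\<in>D. ip D (\<phi>' d) u * \<phi>' d z))"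
    unfolding ip_def[of B] mv_def sum_distrib_left[of "\<phi> b _"]
    by (intro sum.cong refl) (simp add: orthonormal_expand[OF fin(2) e2, symmetric])
  also have "\<dots> = (\<Sum>y\<in>B. \<Sum>z\<in>D. \<Sum>d\<in>D. ip D (\<phi>' d) u * (\<phi> b y * h y z * \<phi>' d z))"
    by (simp add: sum_distrib_left mult_ac)
  also have "\<dots> = (\<Sum>y\<in>B. \<Sum>d\<in>D. \<Sum>z\<in>D. ip D (\<phi>' d) u * (\<phi> b y * h y z * \<phi>' d z))"
    by (rule sum.cong[OF refl], rule sum.swap)
  also have "\<dots> = (\<Sum>d\<in>D. \<Sum>y\<in>B. \<Sum>z\<in>D. ip D (\<phi>' d) u * (\<phi> b y * h y z * \<phi>' d z))"
    by (rule sum.swap)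
  also have "\<dots> = (\<Sum>d\<in>D. ip D (\<phi>' d) u * (\<Sum>y\<in>B. \<Sum>z\<in>D. \<phi> b y * h y z * \<phi>' d z))"
    by (simp add: sum_distrib_left)
  finally show ?thesis .
qed

text \<open>\<open>p\<close> belongs to the possibly resonant block, \<open>q\<close> to the other,
  and \<open>s\<close> is the source from resonant modes. A round trip between the blocks has gain
  at most \<open>k\<^sup>2 \<le> 1/4\<close>, so \<open>p \<le> 2 * s\<close>; the product keeps one
  factor \<open>k\<close> from \<open>q\<close>.\<close>

lemma two_block_product_bound:
  fixes p q s k :: real
  assumes "q \<le> k * p" "p \<le> s + k * q" "0 \<le> k" "k \<le> 1/2" "0 \<le> p" "0 \<le> q"
  shows "p * q \<le> 4 * k * s\<^sup>2"
proof -
  have "q \<le> 1/2 * p"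
    using mult_right_mono[OF assms(4,5)] assms(1) by linarith
  then have "k * q \<le> (1/2) * (1/2 * p)"
    using assms by (intro mult_mono) auto
  then have p: "p \<le> 2 * s" using assms by linarith
  have "p * q \<le> p * (k * p)" using assms by (intro mult_left_mono) auto
  also have "\<dots> = k * p\<^sup>2" by (simp add: power2_eq_square)
  also have "\<dots> \<le> k * (2 * s)\<^sup>2" using assms p by (intro mult_left_mono power_mono) auto
  finally show ?thesis by simp
qed

lemma bessel_inequality:
  assumes "finite K" "orthonormal_on S K \<psi>"
  shows "(\<Sum>j\<in>K. (ip S f (\<psi> j))\<^sup>2) \<le> ip S f f"
proof -
  define g where "g x = (\<Sum>j\<in>K. ip S f (\<psi> j) * \<psi> j x)" for x
  have ipg: "ip S u g = (\<Sum>j\<in>K. ip S f (\<psi> j) * ip S u (\<psi> j))" for u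
    unfolding g_def ip_def[of S u] sum_distrib_left
    by (subst sum.swap) (simp add: sum_distrib_left mult_ac)
  have "ip S (\<psi> i) g = ip S f (\<psi> i)" if "i \<in> K" for i
  proof -
    have "ip S (\<psi> i) g = (\<Sum>j\<in>K. if i = j then ip S f (\<psi> j) else 0)"
      unfolding ipg by (intro sum.cong refl) (use assms(2) that in \<open>auto simp: orthonormal_on_def\<close>)
    then show ?thesis using assms(1) that by simp
  qed
  then have gg: "ip S g g = (\<Sum>j\<in>K. (ip S f (\<psi> j))\<^sup>2)"
    by (subst ipg) (simp add: ip_commute[of S g] power2_eq_square)
  have "0 \<le> ip S (\<lambda>x. f x - g x) (\<lambda>x. f x - g x)" by (rule ip_self_nonneg)
  also have "\<dots> = ip S f f - ip S f g - (ip S g f - ip S g g)"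
    by (subst ip_diff_right, subst (1 2) ip_commute, subst (1 2) ip_diff_right) (simp add: ip_commute)
  also have "ip S f g = (\<Sum>j\<in>K. (ip S f (\<psi> j))\<^sup>2)"
    by (simp add: ipg power2_eq_square)
  finally show ?thesis using gg by (simp add: ip_commute[of S g f] ipg power2_eq_square)
qed

section \<open>The deterministic two-block estimate\<close>

text \<open>\<open>1 / \<rho>\<close> should bound from below the distance from a block level to an
  eigenvalue \<open>\<nu>\<close> within \<open>r\<close> of \<open>E\<close>. For levels farther
  than \<open>2 * r\<close> this distance is at least \<open>\<bar>t - E\<bar> / 2\<close>, hence
  the numerator 2. Nearer levels have weight at least \<open>L\<close>, and separation by
  \<open>2 / L\<close> leaves \<open>\<nu>\<close> within \<open>1 / L\<close> of near levels of at
  most one block.\<close>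

locale two_block =
  fixes S B D :: "'a set" and h :: "'a \<Rightarrow> 'a \<Rightarrow> real"
    and \<phi>\<^sub>1 \<phi>\<^sub>2 :: "'a \<Rightarrow> 'a \<Rightarrow> real" and l\<^sub>1 l\<^sub>2 :: "'a \<Rightarrow> real"
    and \<rho> :: "real \<Rightarrow> real" and E r L :: real
  assumes fin: "finite B" "finite D" and disj: "B \<inter> D = {}" and S: "S = B \<union> D" and h: "symm_on S h"
    and e1: "eigen_on B B h \<phi>\<^sub>1 l\<^sub>1" and e2: "eigen_on D D h \<phi>\<^sub>2 l\<^sub>2"
    and L: "L > 0" and r: "r > 0" and \<rho>_pos: "\<rho> t > 0"
    and \<rho>_near: "\<bar>t - E\<bar> \<le> 2 * r \<Longrightarrow> L \<le> \<rho> t"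
    and \<rho>_far: "\<bar>t - E\<bar> > 2 * r \<Longrightarrow> 2 / \<bar>t - E\<bar> \<le> \<rho> t"
    and sep: "b \<in> B \<Longrightarrow> d \<in> D \<Longrightarrow> \<bar>l\<^sub>1 b - E\<bar> \<le> 2 * r \<Longrightarrow> \<bar>l\<^sub>2 d - E\<bar> \<le> 2 * r \<Longrightarrow> 2 / L \<le> \<bar>l\<^sub>1 b - l\<^sub>2 d\<bar>"
begin

definition v :: "'a \<Rightarrow> 'a \<Rightarrow> real" where
  "v b d = (\<Sum>y\<in>B. \<Sum>z\<in>D. \<phi>\<^sub>1 b y * h y z * \<phi>\<^sub>2 d z)"

text \<open>The squared Hilbert-Schmidt norm of the coupling with a square root of
  \<open>\<rho>\<close> of the block matrix on each side: the small parameter of the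
  estimate.\<close>

definition \<kappa> :: real where
  "\<kappa> = (\<Sum>b\<in>B. \<Sum>d\<in>D. \<rho> (l\<^sub>1 b) * \<rho> (l\<^sub>2 d) * (v b d)\<^sup>2)"

text \<open>This mass, rather than the trivial bound by the full norm, serves as the resonant source
  because it can be summed over all eigenfunctions.\<close>

definition near_weight :: "('a \<Rightarrow> real) \<Rightarrow> real" where
  "near_weight u = (\<Sum>b\<in>{b\<in>B. \<bar>l\<^sub>1 b - E\<bar> \<le> 2 * r}. (ip B (\<phi>\<^sub>1 b) u)\<^sup>2)
     + (\<Sum>d\<in>{d\<in>D. \<bar>l\<^sub>2 d - E\<bar> \<le> 2 * r}. (ip D (\<phi>\<^sub>2 d) u)\<^sup>2)"

lemma \<kappa>_nonneg: "0 \<le> \<kappa>"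
  unfolding \<kappa>_def by (intro sum_nonneg mult_nonneg_nonneg) (auto intro: less_imp_le \<rho>_pos)

lemma resolvent_weight_bound:
  assumes lam: "\<bar>\<nu> - E\<bar> \<le> r" and t: "\<bar>t - E\<bar> \<le> 2 * r \<Longrightarrow> 1 / L \<le> \<bar>t - \<nu>\<bar>" and eq: "(t - \<nu>) * a = - s"
  shows "\<bar>a\<bar> \<le> \<rho> t * \<bar>s\<bar>"
proof -
  have "1 / \<rho> t \<le> \<bar>t - \<nu>\<bar>"
  proof (cases "\<bar>t - E\<bar> \<le> 2 * r")
    case True
    have "1 / \<rho> t \<le> 1 / L" using \<rho>_near[OF True] L by (simp add: frac_le)
    with t[OF True] show ?thesis by simp
  next
    case False
    then have "2 \<le> \<rho> t * \<bar>t - E\<bar>" using \<rho>_far[of t] r by (simp add: divide_le_eq)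
    then have "1 / \<rho> t \<le> \<bar>t - E\<bar> / 2" using \<rho>_pos[of t] by (simp add: field_simps)
    also have "\<dots> \<le> \<bar>t - \<nu>\<bar>"
      using False lam abs_triangle_ineq[of "t - \<nu>" "\<nu> - E"] by simp
    finally show ?thesis .
  qed
  then have "1 \<le> \<rho> t * \<bar>t - \<nu>\<bar>" using \<rho>_pos[of t] by (simp add: field_simps)
  then have "\<bar>a\<bar> \<le> \<rho> t * \<bar>t - \<nu>\<bar> * \<bar>a\<bar>"
    using mult_right_mono[of 1 "\<rho> t * \<bar>t - \<nu>\<bar>" "\<bar>a\<bar>"] by simp
  also have "\<dots> = \<rho> t * \<bar>(t - \<nu>) * a\<bar>" by (simp add: abs_mult)
  finally show ?thesis using eq by simp
qed

text \<open>If some near level of \<open>B\<close> is within \<open>1 / L\<close> of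
  \<open>\<nu>\<close>, separation makes all of \<open>D\<close> nonresonant; otherwise all of
  \<open>B\<close> is nonresonant. The coupling controls the norm on the nonresonant block and the
  far modes of the other, whose near modes contribute at most
  \<open>near_weight u / L\<close>.\<close>

lemma weighted_norm_product:
  assumes u: "\<And>x. x \<in> S \<Longrightarrow> mv S h u x = \<nu> * u x" and lam: "\<bar>\<nu> - E\<bar> \<le> r" and \<kappa>: "\<kappa> \<le> 1/2"
  shows "(\<Sum>b\<in>B. (ip B (\<phi>\<^sub>1 b) u)\<^sup>2 / \<rho> (l\<^sub>1 b)) * (\<Sum>d\<in>D. (ip D (\<phi>\<^sub>2 d) u)\<^sup>2 / \<rho> (l\<^sub>2 d))
    \<le> 4 * \<kappa> * (near_weight u / L)\<^sup>2"
proof -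
  define a where "a b = ip B (\<phi>\<^sub>1 b) u" for b
  define a' where "a' d = ip D (\<phi>\<^sub>2 d) u" for d
  define p where "p = (\<Sum>b\<in>B. (a b)\<^sup>2 / \<rho> (l\<^sub>1 b))"
  define q where "q = (\<Sum>d\<in>D. (a' d)\<^sup>2 / \<rho> (l\<^sub>2 d))"
  define N1 where "N1 = {b\<in>B. \<bar>l\<^sub>1 b - E\<bar> \<le> 2 * r}"
  define N2 where "N2 = {d\<in>D. \<bar>l\<^sub>2 d - E\<bar> \<le> 2 * r}"
  define A where "A = near_weight u"
  have A: "A = (\<Sum>b\<in>N1. (a b)\<^sup>2) + (\<Sum>d\<in>N2. (a' d)\<^sup>2)"
    by (simp add: A_def near_weight_def N1_def N2_def a_def a'_def)
  have o1: "orthonormal_on B B \<phi>\<^sub>1" and o2: "orthonormal_on D D \<phi>\<^sub>2"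
    using e1 e2 by (auto simp: eigen_on_def)
  note \<kappa>0 = \<kappa>_nonneg
  have pq: "0 \<le> p" "0 \<le> q" unfolding p_def q_def by (auto intro!: sum_nonneg divide_nonneg_pos \<rho>_pos)
  have eq1: "(l\<^sub>1 b - \<nu>) * a b = - (\<Sum>d\<in>D. a' d * v b d)" if "b \<in> B" for b
    unfolding a_def a'_def v_def by (rule block_coefficient_equation[OF fin disj S h e1 o2 u that])
  have eq2: "(l\<^sub>2 d - \<nu>) * a' d = - (\<Sum>b\<in>B. a b * v b d)" if d: "d \<in> D" for d
  proof -
    have "(\<Sum>z\<in>D. \<Sum>y\<in>B. \<phi>\<^sub>2 d z * h z y * \<phi>\<^sub>1 b y) = v b d" for b
      unfolding v_def by (subst sum.swap, intro sum.cong refl) (use h S in \<open>simp add: symm_on_def\<close>)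
    moreover have "D \<inter> B = {}" "S = D \<union> B" using disj S by auto
    ultimately show ?thesis
      using block_coefficient_equation[OF fin(2,1) _ _ h e2 o1 u d] unfolding a_def a'_def by simp
  qed
  have nearL: "(\<Sum>b\<in>X. (f b)\<^sup>2 / \<rho> (m b)) \<le> (\<Sum>b\<in>X. (f b)\<^sup>2) / L"
    if "\<And>b. b \<in> X \<Longrightarrow> \<bar>m b - E\<bar> \<le> 2 * r" for X :: "'a set" and f m :: "'a \<Rightarrow> real"
    unfolding sum_divide_distrib
    by (intro sum_mono divide_left_mono) (use that \<rho>_near \<rho>_pos L in \<open>auto intro: mult_pos_pos\<close>)
  have s1: "(\<Sum>b\<in>N1. (a b)\<^sup>2 / \<rho> (l\<^sub>1 b)) \<le> A / L"
    by (rule order_trans[OF nearL]) (use L in \<open>auto simp: N1_def A divide_simps sum_nonneg\<close>)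
  have s2: "(\<Sum>d\<in>N2. (a' d)\<^sup>2 / \<rho> (l\<^sub>2 d)) \<le> A / L"
    by (rule order_trans[OF nearL]) (use L in \<open>auto simp: N2_def A divide_simps sum_nonneg\<close>)
  have toQ2: "(\<Sum>d\<in>Q. (a' d)\<^sup>2 / \<rho> (l\<^sub>2 d)) \<le> \<kappa> * p"
    if "Q \<subseteq> D" "\<And>d. d \<in> Q \<Longrightarrow> \<bar>l\<^sub>2 d - E\<bar> \<le> 2 * r \<Longrightarrow> 1 / L \<le> \<bar>l\<^sub>2 d - \<nu>\<bar>" for Q
    unfolding \<kappa>_def p_def
    by (rule weighted_transfer_bound[OF fin that(1) \<rho>_pos \<rho>_pos])
       (use that in \<open>auto intro!: resolvent_weight_bound[OF lam] eq2\<close>)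
  have toQ1: "(\<Sum>b\<in>Q. (a b)\<^sup>2 / \<rho> (l\<^sub>1 b)) \<le> \<kappa> * q"
    if "Q \<subseteq> B" "\<And>b. b \<in> Q \<Longrightarrow> \<bar>l\<^sub>1 b - E\<bar> \<le> 2 * r \<Longrightarrow> 1 / L \<le> \<bar>l\<^sub>1 b - \<nu>\<bar>" for Q
  proof -
    have "(\<Sum>b\<in>Q. (a b)\<^sup>2 / \<rho> (l\<^sub>1 b)) \<le> (\<Sum>d\<in>D. \<Sum>b\<in>B. \<rho> (l\<^sub>2 d) * \<rho> (l\<^sub>1 b) * (v b d)\<^sup>2) * q"
      unfolding q_def
      by (rule weighted_transfer_bound[OF fin(2,1) that(1) \<rho>_pos \<rho>_pos, where v = "\<lambda>d b. v b d"])
         (use that in \<open>auto intro!: resolvent_weight_bound[OF lam] eq1\<close>)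
    also have "(\<Sum>d\<in>D. \<Sum>b\<in>B. \<rho> (l\<^sub>2 d) * \<rho> (l\<^sub>1 b) * (v b d)\<^sup>2) = \<kappa>"
      unfolding \<kappa>_def by (subst sum.swap) (simp add: mult_ac)
    finally show ?thesis .
  qed
  have split: "(\<Sum>b\<in>X. g b) = (\<Sum>b\<in>{b\<in>X. P b}. g b) + (\<Sum>b\<in>{b\<in>X. \<not> P b}. g b)"
    if "finite X" for X :: "'a set" and P and g :: "'a \<Rightarrow> real"
    using that by (subst sum.union_disjoint[symmetric]) (auto intro: sum.cong)
  have "p * q \<le> 4 * \<kappa> * (A / L)\<^sup>2"
  proof (cases "\<exists>b\<in>B. \<bar>l\<^sub>1 b - E\<bar> \<le> 2 * r \<and> \<bar>l\<^sub>1 b - \<nu>\<bar> < 1 / L")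
    case True
    then obtain b where b: "b \<in> B" "\<bar>l\<^sub>1 b - E\<bar> \<le> 2 * r" "\<bar>l\<^sub>1 b - \<nu>\<bar> < 1 / L" by blast
    have "1 / L \<le> \<bar>l\<^sub>2 d - \<nu>\<bar>" if "d \<in> D" "\<bar>l\<^sub>2 d - E\<bar> \<le> 2 * r" for d
      using sep[OF b(1) that(1) b(2) that(2)] b(3) by linarith
    then have "q \<le> \<kappa> * p" using toQ2[of D] by (simp add: q_def)
    moreover have "(\<Sum>b\<in>{b\<in>B. \<not> \<bar>l\<^sub>1 b - E\<bar> \<le> 2 * r}. (a b)\<^sup>2 / \<rho> (l\<^sub>1 b)) \<le> \<kappa> * q"
      by (rule toQ1) auto
    then have "p \<le> A / L + \<kappa> * q"
      using s1 split[OF fin(1), of "\<lambda>b. (a b)\<^sup>2 / \<rho> (l\<^sub>1 b)" "\<lambda>b. \<bar>l\<^sub>1 b - E\<bar> \<le> 2 * r"]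
      unfolding p_def N1_def by linarith
    ultimately show ?thesis using two_block_product_bound[of q \<kappa> p] \<kappa>0 \<kappa> pq by simp
  next
    \<comment> \<open>Here the roles are exchanged: \<open>B\<close> is nonresonant, and the near
      modes of \<open>D\<close> are taken as the source whether or not they are close to
      \<open>\<nu>\<close>.\<close>
    case False
    then have "p \<le> \<kappa> * q" using toQ1[of B] unfolding p_def by (auto simp: not_less)
    moreover have "(\<Sum>d\<in>{d\<in>D. \<not> \<bar>l\<^sub>2 d - E\<bar> \<le> 2 * r}. (a' d)\<^sup>2 / \<rho> (l\<^sub>2 d)) \<le> \<kappa> * p"
      by (rule toQ2) auto
    then have "q \<le> A / L + \<kappa> * p"
      using s2 split[OF fin(2), of "\<lambda>d. (a' d)\<^sup>2 / \<rho> (l\<^sub>2 d)" "\<lambda>d. \<bar>l\<^sub>2 d - E\<bar> \<le> 2 * r"]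
      unfolding q_def N2_def by linarith
    ultimately show ?thesis using two_block_product_bound[of p \<kappa> q] \<kappa>0 \<kappa> pq by (simp add: mult.commute)
  qed
  then show ?thesis by (simp add: p_def q_def a_def a'_def A_def)
qed

lemma near_weight_nonneg: "0 \<le> near_weight u"
  by (simp add: near_weight_def sum_nonneg)

text \<open>Expanding \<open>u x\<close> in \<open>B\<close> and \<open>u y\<close> in
  \<open>D\<close>, weighted Cauchy-Schwarz splits each value into a weighted norm and a diagonal
  entry of \<open>\<rho>\<close> of the block matrix. Summed over \<open>y\<close>, the diagonal
  entries give a trace; the two norms meet only in the product bounded above.\<close>

lemma eigenvector_offblock_bound:
  assumes u: "\<And>x. x \<in> S \<Longrightarrow> mv S h u x = \<nu> * u x" and lam: "\<bar>\<nu> - E\<bar> \<le> r" and \<kappa>: "\<kappa> \<le> 1/2"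
    and x: "x \<in> B"
  shows "(\<Sum>y\<in>D. \<bar>u x * u y\<bar>) \<le> 2 * sqrt \<kappa> * (near_weight u / L)
    * sqrt (\<Sum>b\<in>B. \<rho> (l\<^sub>1 b) * (\<phi>\<^sub>1 b x)\<^sup>2) * sqrt (card D * (\<Sum>d\<in>D. \<rho> (l\<^sub>2 d)))"
proof -
  define p where "p = (\<Sum>b\<in>B. (ip B (\<phi>\<^sub>1 b) u)\<^sup>2 / \<rho> (l\<^sub>1 b))"
  define q where "q = (\<Sum>d\<in>D. (ip D (\<phi>\<^sub>2 d) u)\<^sup>2 / \<rho> (l\<^sub>2 d))"
  define Tx where "Tx = (\<Sum>b\<in>B. \<rho> (l\<^sub>1 b) * (\<phi>\<^sub>1 b x)\<^sup>2)"
  define Ty where "Ty y = (\<Sum>d\<in>D. \<rho> (l\<^sub>2 d) * (\<phi>\<^sub>2 d y)\<^sup>2)" for y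
  have o1: "orthonormal_on B B \<phi>\<^sub>1" and o2: "orthonormal_on D D \<phi>\<^sub>2"
    using e1 e2 by (auto simp: eigen_on_def)
  have Ty0: "0 \<le> Ty y" for y
    unfolding Ty_def by (intro sum_nonneg mult_nonneg_nonneg) (auto intro: less_imp_le \<rho>_pos)
  have q0: "0 \<le> q" unfolding q_def by (auto intro!: sum_nonneg divide_nonneg_pos \<rho>_pos)
  have "(u x)\<^sup>2 \<le> p * Tx"
    unfolding p_def Tx_def by (subst orthonormal_expand[OF fin(1) o1 x]) (rule weighted_Cauchy_Schwarz[OF \<rho>_pos])
  then have ux: "\<bar>u x\<bar> \<le> sqrt p * sqrt Tx"
    using real_sqrt_le_mono by (fastforce simp: real_sqrt_mult[symmetric])
  have "(u y)\<^sup>2 \<le> q * Ty y" if "y \<in> D" for y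
    unfolding q_def Ty_def by (subst orthonormal_expand[OF fin(2) o2 that]) (rule weighted_Cauchy_Schwarz[OF \<rho>_pos])
  then have uy: "\<bar>u y\<bar> \<le> sqrt q * sqrt (Ty y)" if "y \<in> D" for y
    using real_sqrt_le_mono that by (fastforce simp: real_sqrt_mult[symmetric])
  have "(\<Sum>y\<in>D. 1 * sqrt (Ty y))\<^sup>2 \<le> (\<Sum>y\<in>D. 1\<^sup>2) * (\<Sum>y\<in>D. (sqrt (Ty y))\<^sup>2)"
    by (rule Cauchy_Schwarz_ineq_sum)
  also have "\<dots> = card D * (\<Sum>y\<in>D. Ty y)"
    using Ty0 by simp
  also have "(\<Sum>y\<in>D. Ty y) = (\<Sum>d\<in>D. \<rho> (l\<^sub>2 d) * ip D (\<phi>\<^sub>2 d) (\<phi>\<^sub>2 d))"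
    unfolding Ty_def ip_def by (subst sum.swap) (simp add: sum_distrib_left power2_eq_square)
  also have "\<dots> = (\<Sum>d\<in>D. \<rho> (l\<^sub>2 d))"
    using o2 by (intro sum.cong refl) (simp add: orthonormal_on_def)
  finally have "(\<Sum>y\<in>D. sqrt (Ty y)) \<le> sqrt (card D * (\<Sum>d\<in>D. \<rho> (l\<^sub>2 d)))"
    using real_le_rsqrt by simp
  then have sy: "(\<Sum>y\<in>D. \<bar>u y\<bar>) \<le> sqrt q * sqrt (card D * (\<Sum>d\<in>D. \<rho> (l\<^sub>2 d)))"
    using sum_mono[of D "\<lambda>y. \<bar>u y\<bar>" "\<lambda>y. sqrt q * sqrt (Ty y)"] uy q0
    by (simp add: sum_distrib_left[symmetric]) (smt (verit) mult_left_mono real_sqrt_ge_zero)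
  have "(\<Sum>y\<in>D. \<bar>u x * u y\<bar>) = \<bar>u x\<bar> * (\<Sum>y\<in>D. \<bar>u y\<bar>)"
    by (simp add: abs_mult sum_distrib_left)
  also have "\<dots> \<le> (sqrt p * sqrt Tx) * (sqrt q * sqrt (card D * (\<Sum>d\<in>D. \<rho> (l\<^sub>2 d))))"
    by (intro mult_mono ux sy sum_nonneg) (auto intro: order_trans[OF _ ux])
  also have "\<dots> = sqrt (p * q) * (sqrt Tx * sqrt (card D * (\<Sum>d\<in>D. \<rho> (l\<^sub>2 d))))"
    by (simp add: real_sqrt_mult)
  also have "\<dots> \<le> sqrt (4 * \<kappa> * (near_weight u / L)\<^sup>2) * (sqrt Tx * sqrt (card D * (\<Sum>d\<in>D. \<rho> (l\<^sub>2 d))))"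
    using weighted_norm_product[OF u lam \<kappa>] unfolding p_def q_def Tx_def
    by (intro mult_right_mono real_sqrt_le_mono mult_nonneg_nonneg real_sqrt_ge_zero sum_nonneg)
       (auto intro: less_imp_le \<rho>_pos)
  also have "sqrt (4 * \<kappa> * (near_weight u / L)\<^sup>2) = 2 * sqrt \<kappa> * (near_weight u / L)"
    using L near_weight_nonneg[of u] by (simp add: real_sqrt_mult)
  finally show ?thesis by (simp add: Tx_def mult_ac)
qed

text \<open>By Bessel each near block level collects total mass at most 1 from all the
  \<open>\<psi> j\<close>, and \<open>\<rho> / L\<close> dominates the indicator of the near
  levels.\<close>

lemma sum_near_weight:
  assumes K: "finite K" "orthonormal_on S K \<psi>"
  shows "(\<Sum>j\<in>K. near_weight (\<psi> j)) \<le> ((\<Sum>b\<in>B. \<rho> (l\<^sub>1 b)) + (\<Sum>d\<in>D. \<rho> (l\<^sub>2 d))) / L"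
proof -
  have bessel: "(\<Sum>j\<in>K. (ip X f (\<psi> j))\<^sup>2) \<le> ip X f f" if X: "X \<subseteq> S" for X f
  proof -
    \<comment> \<open>Extension by zero turns a block vector into a vector on \<open>S\<close>,
      where the \<open>\<psi> j\<close> are orthonormal.\<close>
    have ext: "ip S (\<lambda>x. if x \<in> X then f x else 0) g = ip X f g" for g
    proof -
      have "ip S (\<lambda>x. if x \<in> X then f x else 0) g = (\<Sum>x\<in>S. if x \<in> X then f x * g x else 0)"
        unfolding ip_def by (intro sum.cong) auto
      then show ?thesis using X fin S
        by (simp add: ip_def sum.inter_restrict[symmetric] Int_absorb1)
    qed
    have "ip X f (\<lambda>x. if x \<in> X then f x else 0) = ip X f f"
      by (rule ip_cong) auto
    with bessel_inequality[OF K, of "\<lambda>x. if x \<in> X then f x else 0"] show ?thesis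
      by (simp add: ext)
  qed
  have part: "(\<Sum>j\<in>K. \<Sum>b\<in>{b\<in>X. \<bar>m b - E\<bar> \<le> 2 * r}. (ip X (\<phi> b) (\<psi> j))\<^sup>2) \<le> (\<Sum>b\<in>X. \<rho> (m b)) / L"
    if X: "X \<subseteq> S" "finite X" and on: "orthonormal_on X X \<phi>" for X \<phi> m
  proof -
    have "(\<Sum>j\<in>K. \<Sum>b\<in>{b\<in>X. \<bar>m b - E\<bar> \<le> 2 * r}. (ip X (\<phi> b) (\<psi> j))\<^sup>2)
        = (\<Sum>b\<in>{b\<in>X. \<bar>m b - E\<bar> \<le> 2 * r}. \<Sum>j\<in>K. (ip X (\<phi> b) (\<psi> j))\<^sup>2)"
      by (rule sum.swap)
    also have "\<dots> \<le> (\<Sum>b\<in>{b\<in>X. \<bar>m b - E\<bar> \<le> 2 * r}. \<rho> (m b) / L)"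
    proof (rule sum_mono)
      fix b assume b: "b \<in> {b\<in>X. \<bar>m b - E\<bar> \<le> 2 * r}"
      have "(\<Sum>j\<in>K. (ip X (\<phi> b) (\<psi> j))\<^sup>2) \<le> ip X (\<phi> b) (\<phi> b)" by (rule bessel[OF X(1)])
      also have "\<dots> = 1" using b on by (simp add: orthonormal_on_def)
      also have "\<dots> \<le> \<rho> (m b) / L" using b \<rho>_near L by simp
      finally show "(\<Sum>j\<in>K. (ip X (\<phi> b) (\<psi> j))\<^sup>2) \<le> \<rho> (m b) / L" .
    qed
    also have "\<dots> \<le> (\<Sum>b\<in>X. \<rho> (m b) / L)"
      by (rule sum_mono2[OF X(2)]) (use \<rho>_pos L in \<open>auto intro: less_imp_le\<close>)
    finally show ?thesis by (simp add: sum_divide_distrib)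
  qed
  have "(\<Sum>j\<in>K. near_weight (\<psi> j)) \<le> (\<Sum>b\<in>B. \<rho> (l\<^sub>1 b)) / L + (\<Sum>d\<in>D. \<rho> (l\<^sub>2 d)) / L"
    unfolding near_weight_def sum.distrib
    by (intro add_mono part) (use S fin e1 e2 in \<open>auto simp: eigen_on_def\<close>)
  then show ?thesis by (simp add: add_divide_distrib)
qed

text \<open>One factor \<open>1 / L\<close> comes from the resonant source; the sum over
  eigenfunctions costs \<open>T / L\<close>, the bound for the number of near block levels.\<close>

theorem correlator_offblock_bound:
  fixes T :: real
  assumes K: "finite K" and \<psi>: "eigen_on S K h \<psi> lam" and \<kappa>: "\<kappa> \<le> 1/2" and x: "x \<in> B"
    and T: "(\<Sum>b\<in>B. \<rho> (l\<^sub>1 b)) + (\<Sum>d\<in>D. \<rho> (l\<^sub>2 d)) \<le> T"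
    and Tx: "(\<Sum>b\<in>B. \<rho> (l\<^sub>1 b) * (\<phi>\<^sub>1 b x)\<^sup>2) \<le> Tx"
  shows "(\<Sum>y\<in>D. \<Sum>j\<in>{j\<in>K. lam j \<in> {E - r .. E + r}}. \<bar>\<psi> j x * \<psi> j y\<bar>)
    \<le> 2 * sqrt \<kappa> * (T / L\<^sup>2) * sqrt Tx * sqrt (real (card D) * T)"
proof -
  let ?K = "{j\<in>K. lam j \<in> {E - r .. E + r}}"
  have "(\<Sum>d\<in>D. \<rho> (l\<^sub>2 d)) \<le> T"
    using T sum_nonneg[of B "\<lambda>b. \<rho> (l\<^sub>1 b)"] \<rho>_pos by (smt (verit))
  then have mono: "sqrt (card D * (\<Sum>d\<in>D. \<rho> (l\<^sub>2 d))) \<le> sqrt (real (card D) * T)"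
    by (intro real_sqrt_le_mono mult_left_mono) auto
  have "0 \<le> T" using T sum_nonneg[of B "\<lambda>b. \<rho> (l\<^sub>1 b)"] sum_nonneg[of D "\<lambda>b. \<rho> (l\<^sub>2 b)"] \<rho>_pos by (smt (verit))
  note \<kappa>0 = \<kappa>_nonneg
  have Tx0: "0 \<le> Tx"
    by (rule order_trans[OF _ Tx]) (intro sum_nonneg mult_nonneg_nonneg, auto intro: less_imp_le \<rho>_pos)
  have "(\<Sum>y\<in>D. \<Sum>j\<in>?K. \<bar>\<psi> j x * \<psi> j y\<bar>) = (\<Sum>j\<in>?K. \<Sum>y\<in>D. \<bar>\<psi> j x * \<psi> j y\<bar>)"
    by (rule sum.swap)
  also have "\<dots> \<le> (\<Sum>j\<in>?K. near_weight (\<psi> j) * (2 * sqrt \<kappa> / L * sqrt Tx * sqrt (real (card D) * T)))"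
  proof (rule sum_mono)
    fix j assume j: "j \<in> ?K"
    have "(\<Sum>y\<in>D. \<bar>\<psi> j x * \<psi> j y\<bar>) \<le> 2 * sqrt \<kappa> * (near_weight (\<psi> j) / L)
        * sqrt (\<Sum>b\<in>B. \<rho> (l\<^sub>1 b) * (\<phi>\<^sub>1 b x)\<^sup>2) * sqrt (card D * (\<Sum>d\<in>D. \<rho> (l\<^sub>2 d)))"
      by (rule eigenvector_offblock_bound[OF _ _ \<kappa> x, where \<nu> = "lam j"])
         (use j \<psi> in \<open>auto simp: eigen_on_def abs_le_iff\<close>)
    also have "\<dots> \<le> 2 * sqrt \<kappa> * (near_weight (\<psi> j) / L) * sqrt Tx * sqrt (real (card D) * T)"
      by (intro mult_mono mono order_refl mult_nonneg_nonneg real_sqrt_le_mono Tx)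
         (use L near_weight_nonneg[of "\<psi> j"] \<kappa>0 Tx0 \<rho>_pos in \<open>auto intro!: sum_nonneg mult_nonneg_nonneg intro: less_imp_le\<close>)
    finally show "(\<Sum>y\<in>D. \<bar>\<psi> j x * \<psi> j y\<bar>) \<le> near_weight (\<psi> j) * (2 * sqrt \<kappa> / L * sqrt Tx * sqrt (real (card D) * T))"
      by (simp add: mult_ac)
  qed
  also have "\<dots> \<le> (T / L) * (2 * sqrt \<kappa> / L * sqrt Tx * sqrt (real (card D) * T))"
    unfolding sum_distrib_right[symmetric]
  proof (rule mult_right_mono)
    have "(\<Sum>j\<in>?K. near_weight (\<psi> j)) \<le> ((\<Sum>b\<in>B. \<rho> (l\<^sub>1 b)) + (\<Sum>d\<in>D. \<rho> (l\<^sub>2 d))) / L"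
      by (rule sum_near_weight) (use K \<psi> in \<open>auto simp: eigen_on_def orthonormal_on_def\<close>)
    also have "\<dots> \<le> T / L" using T L by (simp add: divide_right_mono)
    finally show "(\<Sum>j\<in>?K. near_weight (\<psi> j)) \<le> T / L" .
  qed (use \<kappa>0 L Tx0 \<open>0 \<le> T\<close> in auto)
  also have "\<dots> = 2 * sqrt \<kappa> * (T / L\<^sup>2) * sqrt Tx * sqrt (real (card D) * T)"
    by (simp add: power2_eq_square)
  finally show ?thesis .
qed

end

section \<open>Functional calculus and spectral averaging\<close>

text \<open>The chosen predicate sees \<open>h\<close> only on \<open>S\<close>, so matrices that
  agree there receive the same basis. This lets a block ignore all Gaussians that do not enter
  it.\<close>

definition eigbas :: "'a set \<Rightarrow> ('a \<Rightarrow> 'a \<Rightarrow> real) \<Rightarrow> ('a \<Rightarrow> 'a \<Rightarrow> real) \<times> ('a \<Rightarrow> real)" where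
  "eigbas S h = (SOME p. eigen_on S S h (fst p) (snd p))"

definition fcalc :: "'a set \<Rightarrow> ('a \<Rightarrow> 'a \<Rightarrow> real) \<Rightarrow> (real \<Rightarrow> real) \<Rightarrow> 'a \<Rightarrow> 'a \<Rightarrow> real" where
  "fcalc S h f x y = (\<Sum>k\<in>S. f (snd (eigbas S h) k) * (fst (eigbas S h) k x * fst (eigbas S h) k y))"

lemma eigbas_eigen_on:
  "finite S \<Longrightarrow> symm_on S h \<Longrightarrow> eigen_on S S h (fst (eigbas S h)) (snd (eigbas S h))"
  unfolding eigbas_def by (rule someI_ex) (use spectral_theorem[of S h] in auto)

lemma eigen_on_cong:
  assumes "\<And>x y. x \<in> S \<Longrightarrow> y \<in> S \<Longrightarrow> h x y = h' x y"
  shows "eigen_on S F h \<phi> l \<longleftrightarrow> eigen_on S F h' \<phi> l"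
proof -
  have "mv S h v x = mv S h' v x" if "x \<in> S" for v x
    unfolding mv_def by (rule sum.cong) (use assms that in auto)
  then show ?thesis by (simp add: eigen_on_def)
qed

lemma fcalc_cong:
  assumes "\<And>x y. x \<in> S \<Longrightarrow> y \<in> S \<Longrightarrow> h x y = h' x y"
  shows "fcalc S h = fcalc S h'"
proof -
  have "eigbas S h = eigbas S h'"
    unfolding eigbas_def by (simp add: eigen_on_cong[of S h h', OF assms])
  then show ?thesis by (intro ext) (simp add: fcalc_def)
qed

lemma fcalc_sum: "fcalc S h (\<lambda>u. \<Sum>i\<in>I. f i u) x y = (\<Sum>i\<in>I. fcalc S h (f i) x y)"
  unfolding fcalc_def sum_distrib_right by (rule sum.swap)

lemma fcalc_add: "fcalc S h (\<lambda>u. f u + g u) x y = fcalc S h f x y + fcalc S h g x y"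
  by (simp add: fcalc_def distrib_right sum.distrib)

lemma fcalc_cmult: "fcalc S h (\<lambda>u. c * f u) x y = c * fcalc S h f x y"
  by (simp add: fcalc_def sum_distrib_left mult.assoc)

lemma fcalc_const:
  assumes "finite S" "symm_on S h" "x \<in> S" "y \<in> S"
  shows "fcalc S h (\<lambda>u. c) x y = (if x = y then c else 0)"
  using orthonormal_complete[of S "fst (eigbas S h)" x y] eigbas_eigen_on[OF assms(1,2)] assms
  by (simp add: fcalc_def eigen_on_def sum_distrib_left[symmetric])

lemma fcalc_commute: "fcalc S h f x y = fcalc S h f y x"
  by (simp add: fcalc_def mult.commute)

lemma fcalc_diag_nonneg: "(\<And>u. 0 \<le> f u) \<Longrightarrow> 0 \<le> fcalc S h f x x"
  by (simp add: fcalc_def sum_nonneg)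

lemma fcalc_trace:
  assumes "finite S" "symm_on S h"
  shows "(\<Sum>x\<in>S. fcalc S h f x x) = (\<Sum>k\<in>S. f (snd (eigbas S h) k))"
proof -
  have "(\<Sum>x\<in>S. fcalc S h f x x) = (\<Sum>k\<in>S. f (snd (eigbas S h) k) * ip S (fst (eigbas S h) k) (fst (eigbas S h) k))"
    unfolding fcalc_def ip_def sum_distrib_left by (rule sum.swap)
  also have "\<dots> = (\<Sum>k\<in>S. f (snd (eigbas S h) k))"
    by (intro sum.cong refl) (use eigbas_eigen_on[OF assms] in \<open>simp add: eigen_on_def orthonormal_on_def\<close>)
  finally show ?thesis .
qed

fun mpow :: "'a set \<Rightarrow> ('a \<Rightarrow> 'a \<Rightarrow> real) \<Rightarrow> nat \<Rightarrow> 'a \<Rightarrow> 'a \<Rightarrow> real" where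
  "mpow S h 0 x y = (if x = y then 1 else 0)"
| "mpow S h (Suc i) x y = (\<Sum>z\<in>S. h x z * mpow S h i z y)"

text \<open>Links the chosen eigenbasis to explicit polynomials in the entries, whose measurability
  is evident.\<close>

lemma fcalc_power:
  assumes S: "finite S" "symm_on S h" and xy: "x \<in> S" "y \<in> S"
  shows "fcalc S h (\<lambda>u. u ^ i) x y = mpow S h i x y"
  using xy(1)
proof (induction i arbitrary: x)
  case 0
  then show ?case using fcalc_const[OF S _ xy(2), of x 1] by simp
next
  case (Suc i)
  define \<phi> where "\<phi> = fst (eigbas S h)"
  define l where "l = snd (eigbas S h)"
  have e: "eigen_on S S h \<phi> l" unfolding \<phi>_def l_def by (rule eigbas_eigen_on[OF S])
  have "fcalc S h (\<lambda>u. u ^ Suc i) x y = (\<Sum>k\<in>S. l k ^ i * (mv S h (\<phi> k) x * \<phi> k y))"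
    unfolding fcalc_def \<phi>_def[symmetric] l_def[symmetric]
    by (intro sum.cong refl) (use e Suc(2) in \<open>simp add: eigen_on_def mult_ac\<close>)
  also have "\<dots> = (\<Sum>k\<in>S. \<Sum>z\<in>S. h x z * (l k ^ i * (\<phi> k z * \<phi> k y)))"
    by (simp add: mv_def sum_distrib_left sum_distrib_right mult_ac)
  also have "\<dots> = (\<Sum>z\<in>S. h x z * (\<Sum>k\<in>S. l k ^ i * (\<phi> k z * \<phi> k y)))"
    by (subst sum.swap) (simp add: sum_distrib_left)
  also have "\<dots> = (\<Sum>z\<in>S. h x z * mpow S h i z y)"
    by (intro sum.cong refl) (simp add: Suc(1)[symmetric] fcalc_def \<phi>_def l_def)
  finally show ?case by simp
qed

lemma borel_measurable_mpow:
  assumes "\<And>x y. x \<in> S \<Longrightarrow> y \<in> S \<Longrightarrow> (\<lambda>\<omega>. h \<omega> x y) \<in> borel_measurable M" "x \<in> S" "y \<in> S"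
  shows "(\<lambda>\<omega>. mpow S (h \<omega>) i x y) \<in> borel_measurable M"
  using assms(2)
proof (induction i arbitrary: x)
  case (Suc i)
  then show ?case
    by (auto intro!: borel_measurable_sum borel_measurable_times assms(1) Suc.IH)
qed simp

text \<open>Weierstrass approximation turns the functional calculus into a pointwise limit of
  polynomials in the matrix entries, so no measurable choice of eigenvectors is needed.\<close>

lemma borel_measurable_fcalc:
  assumes S: "finite S" and sym: "\<And>\<omega>. \<omega> \<in> space M \<Longrightarrow> symm_on S (h \<omega>)"
    and meas: "\<And>x y. x \<in> S \<Longrightarrow> y \<in> S \<Longrightarrow> (\<lambda>\<omega>. h \<omega> x y) \<in> borel_measurable M"
    and f: "continuous_on UNIV f" and xy: "x \<in> S" "y \<in> S"
  shows "(\<lambda>\<omega>. fcalc S (h \<omega>) f x y) \<in> borel_measurable M"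
proof -
  \<comment> \<open>The intervals grow with \<open>m\<close> because the spectrum has no bound
    uniform in \<open>\<omega>\<close>; any fixed eigenvalue lies in all but finitely many of
    them.\<close>
  have "\<exists>a n. \<forall>u. \<bar>u\<bar> \<le> real m \<longrightarrow> \<bar>f u - (\<Sum>i\<le>n. a i * u ^ i)\<bar> < inverse (real (Suc m))" for m :: nat
  proof -
    obtain g where g: "real_polynomial_function g"
      "\<And>u. u \<in> {- real m..real m} \<Longrightarrow> \<bar>f u - g u\<bar> < inverse (real (Suc m))"
      by (rule Stone_Weierstrass_real_polynomial_function[of "{- real m..real m}" f "inverse (real (Suc m))"])
         (auto intro: continuous_on_subset[OF f])
    then obtain a n where "g = (\<lambda>u. \<Sum>i\<le>n. a i * u ^ i)"
      by (auto simp: real_polynomial_function_iff_sum)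
    then have "\<forall>u. \<bar>u\<bar> \<le> real m \<longrightarrow> \<bar>f u - (\<Sum>i\<le>n. a i * u ^ i)\<bar> < inverse (real (Suc m))"
      using g(2) by (auto simp: abs_le_iff)
    then show ?thesis by blast
  qed
  then obtain a n where p: "\<And>m u. \<bar>u\<bar> \<le> real m \<Longrightarrow> \<bar>f u - (\<Sum>i\<le>n m. a m i * u ^ i)\<bar> < inverse (real (Suc m))"
    by metis
  have lim: "(\<lambda>m. \<Sum>i\<le>n m. a m i * u ^ i) \<longlonglongrightarrow> f u" for u
  proof -
    obtain m0 :: nat where m0: "\<bar>u\<bar> \<le> real m0" using real_arch_simple by blast
    have "(\<lambda>m. (\<Sum>i\<le>n m. a m i * u ^ i) - f u) \<longlonglongrightarrow> 0"
    proof (rule Lim_null_comparison[OF _ LIMSEQ_inverse_real_of_nat])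
      have "norm ((\<Sum>i\<le>n m. a m i * u ^ i) - f u) \<le> inverse (real (Suc m))" if "m \<ge> m0" for m
        using p[of u m] m0 that by (simp add: abs_minus_commute)
      then show "\<forall>\<^sub>F m in sequentially. norm ((\<Sum>i\<le>n m. a m i * u ^ i) - f u) \<le> inverse (real (Suc m))"
        by (auto simp: eventually_sequentially)
    qed
    then show ?thesis by (simp add: LIM_zero_iff)
  qed
  show ?thesis
  proof (rule borel_measurable_LIMSEQ_real)
    fix \<omega> assume "\<omega> \<in> space M"
    show "(\<lambda>m. fcalc S (h \<omega>) (\<lambda>u. \<Sum>i\<le>n m. a m i * u ^ i) x y) \<longlonglongrightarrow> fcalc S (h \<omega>) f x y"
      unfolding fcalc_def by (intro tendsto_intros lim)
  next
    fix m
    have "(\<lambda>\<omega>. \<Sum>i\<le>n m. a m i * mpow S (h \<omega>) i x y) \<in> borel_measurable M"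
      by (intro borel_measurable_sum borel_measurable_times borel_measurable_const borel_measurable_mpow meas xy)
    then show "(\<lambda>\<omega>. fcalc S (h \<omega>) (\<lambda>u. \<Sum>i\<le>n m. a m i * u ^ i) x y) \<in> borel_measurable M"
      by (rule measurable_cong[THEN iffD1, rotated])
         (simp add: fcalc_sum fcalc_cmult fcalc_power[OF S sym xy])
  qed
qed

section \<open>Lorentzians and rank-one spectral averaging\<close>

text \<open>This is \<open>\<epsilon>\<close> times the imaginary part of
  \<open>1 / (u - E - \<i> \<epsilon>)\<close>, scaled to height 1 so that twice it dominates the
  indicator of an interval of radius \<open>\<epsilon>\<close>.\<close>

definition lorentz :: "real \<Rightarrow> real \<Rightarrow> real \<Rightarrow> real" where
  "lorentz \<epsilon> E u = \<epsilon>\<^sup>2 / ((u - E)\<^sup>2 + \<epsilon>\<^sup>2)"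

lemma lorentz_nonneg: "0 \<le> lorentz \<epsilon> E u"
  by (simp add: lorentz_def)

lemma continuous_on_lorentz: "\<epsilon> > 0 \<Longrightarrow> continuous_on UNIV (lorentz \<epsilon> E)"
  unfolding lorentz_def[abs_def]
  by (intro continuous_intros) (auto simp: add_nonneg_eq_0_iff)

lemma lorentz_ge_half: "\<epsilon> > 0 \<Longrightarrow> \<bar>u - E\<bar> \<le> \<epsilon> \<Longrightarrow> 1/2 \<le> lorentz \<epsilon> E u"
  using abs_le_square_iff[of "u - E" \<epsilon>]
  by (simp add: lorentz_def field_simps add_pos_nonneg)

text \<open>With \<open>g\<^sub>t\<close> the diagonal resolvent entry at the perturbed site, the resolvent identity reads
  \<open>g\<^sub>0 - g\<^sub>t = t g\<^sub>0 g\<^sub>t\<close>, that is \<open>1 / g\<^sub>t = 1 / g\<^sub>0 + t\<close>; here \<open>p - \<i> q = 1 / g\<^sub>0\<close>.\<close>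

lemma rank_one_lorentz:
  fixes h :: "'a \<Rightarrow> 'a \<Rightarrow> real"
  assumes S: "finite S" and h: "symm_on S h" and x: "x \<in> S" and \<epsilon>: "\<epsilon> > 0"
  shows "\<exists>p q. q > 0 \<and> (\<forall>t. fcalc S (\<lambda>y z. h y z + (if y = x \<and> z = x then t else 0)) (lorentz \<epsilon> E) x x
      = \<epsilon> * (q / ((t + p)\<^sup>2 + q\<^sup>2)))"
proof -
  define z where "z = Complex E \<epsilon>"
  define g where "g h = (\<Sum>k\<in>S. complex_of_real ((fst (eigbas S h) k x)\<^sup>2) / (complex_of_real (snd (eigbas S h) k) - z))" for h
  define ht where "ht t y z = h y z + (if y = x \<and> z = x then t else 0)" for t y z
  have Iminv: "Im (complex_of_real a / (complex_of_real l - z)) = a * \<epsilon> / ((l - E)\<^sup>2 + \<epsilon>\<^sup>2)" for a l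
    by (simp add: z_def Im_divide)
  have Im_g: "\<epsilon> * Im (g h) = fcalc S h (lorentz \<epsilon> E) x x" for h
    unfolding g_def Im_sum Iminv fcalc_def sum_distrib_left
    by (intro sum.cong refl) (simp add: lorentz_def power2_eq_square)
  have sym: "symm_on S (ht t)" for t
    using h by (auto simp: symm_on_def ht_def)
  have Im_pos: "Im (g h) > 0" if "symm_on S h" for h
  proof -
    have o: "orthonormal_on S S (fst (eigbas S h))" using eigbas_eigen_on[OF S that] by (simp add: eigen_on_def)
    have "(\<Sum>k\<in>S. (fst (eigbas S h) k x)\<^sup>2) = 1"
      using orthonormal_complete[OF S o x x] by (simp add: power2_eq_square)
    then have "\<exists>k\<in>S. (fst (eigbas S h) k x)\<^sup>2 \<noteq> 0"
      by (intro ccontr[of "\<exists>k\<in>S. _ k"]) simp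
    then obtain k where k: "k \<in> S" "(fst (eigbas S h) k x)\<^sup>2 \<noteq> 0" by blast
    have lp: "0 < lorentz \<epsilon> E u" for u using \<epsilon> by (simp add: lorentz_def add_nonneg_pos)
    then have "0 < fcalc S h (lorentz \<epsilon> E) x x"
      unfolding fcalc_def power2_eq_square[symmetric]
      by (intro sum_pos2[OF S k(1)] mult_pos_pos mult_nonneg_nonneg lp less_imp_le[OF lp]) (use k(2) in simp_all)
    then show ?thesis using Im_g[of h] \<epsilon> by (metis zero_less_mult_pos)
  qed
  have resolvent: "g h - g (ht t) = complex_of_real t * g h * g (ht t)" for t
  proof -
    define \<phi> where "\<phi> = fst (eigbas S h)"
    define l where "l = snd (eigbas S h)"
    define \<phi>' where "\<phi>' = fst (eigbas S (ht t))"
    define l' where "l' = snd (eigbas S (ht t))"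
    have e: "eigen_on S S h \<phi> l" and e': "eigen_on S S (ht t) \<phi>' l'"
      unfolding \<phi>_def l_def \<phi>'_def l'_def by (intro eigbas_eigen_on[OF S] h sym)+
    then have o: "orthonormal_on S S \<phi>" and o': "orthonormal_on S S \<phi>'" by (auto simp: eigen_on_def)
    \<comment> \<open>Overlaps of the two eigenbases. They write both resolvent entries as double
      sums with the same numerators \<open>W j k\<close>; \<open>comm\<close>, the matrix element of
      the perturbation, then gives the resolvent identity term by term.\<close>
    define U where "U j k = ip S (\<phi>' j) (\<phi> k)" for j k
    have comm: "(l' j - l k) * U j k = t * \<phi>' j x * \<phi> k x" if jk: "j \<in> S" "k \<in> S" for j k
    proof -
      have "l' j * U j k = ip S (mv S (ht t) (\<phi>' j)) (\<phi> k)"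
        unfolding U_def ip_scale_left[symmetric] by (rule ip_cong) (use e' jk in \<open>auto simp: eigen_on_def\<close>)
      also have "\<dots> = ip S (\<phi>' j) (mv S (ht t) (\<phi> k))"
        by (rule ip_mv_symm[OF sym, symmetric])
      also have "\<dots> = ip S (\<phi>' j) (\<lambda>y. l k * \<phi> k y + (if y = x then t * \<phi> k x else 0))"
      proof (rule ip_cong)
        fix y assume y: "y \<in> S"
        have "mv S (ht t) (\<phi> k) y = (\<Sum>z\<in>S. h y z * \<phi> k z + (if z = x then (if y = x then t * \<phi> k x else 0) else 0))"
          unfolding mv_def ht_def by (intro sum.cong refl) (auto simp: algebra_simps)
        also have "\<dots> = mv S h (\<phi> k) y + (if y = x then t * \<phi> k x else 0)"
          using S x by (simp add: sum.distrib mv_def)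
        finally show "mv S (ht t) (\<phi> k) y = l k * \<phi> k y + (if y = x then t * \<phi> k x else 0)"
          using e jk y by (simp add: eigen_on_def)
      qed simp
      also have "\<dots> = l k * U j k + ip S (\<phi>' j) (\<lambda>y. if y = x then t * \<phi> k x else 0)"
        by (simp add: ip_add_right ip_scale_right U_def)
      also have "ip S (\<phi>' j) (\<lambda>y. if y = x then t * \<phi> k x else 0) = t * \<phi>' j x * \<phi> k x"
      proof -
        have "ip S (\<phi>' j) (\<lambda>y. if y = x then t * \<phi> k x else 0) = (\<Sum>y\<in>S. if y = x then \<phi>' j y * (t * \<phi> k x) else 0)"
          unfolding ip_def by (intro sum.cong) auto
        then show ?thesis using S x by simp
      qed
      finally show ?thesis by (simp add: algebra_simps)
    qed
    have ex: "\<phi> k x = (\<Sum>j\<in>S. U j k * \<phi>' j x)" for k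
      unfolding U_def by (rule orthonormal_expand[OF S o' x])
    have ex': "\<phi>' j x = (\<Sum>k\<in>S. U j k * \<phi> k x)" for j
      unfolding U_def ip_commute[of S "\<phi>' j"] by (rule orthonormal_expand[OF S o x])
    define W where "W j k = complex_of_real (U j k * \<phi>' j x * \<phi> k x)" for j k
    have nz: "complex_of_real l - z \<noteq> 0" for l
      using \<epsilon> by (auto simp: z_def complex_eq_iff)
    have g0: "g h = (\<Sum>j\<in>S. \<Sum>k\<in>S. W j k / (complex_of_real (l k) - z))"
    proof -
      have "complex_of_real ((\<phi> k x)\<^sup>2) = (\<Sum>j\<in>S. W j k)" for k
      proof -
        have "(\<phi> k x)\<^sup>2 = (\<Sum>j\<in>S. U j k * \<phi>' j x) * \<phi> k x"
          using ex[of k] by (simp add: power2_eq_square)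
        then show ?thesis by (simp add: W_def sum_distrib_right)
      qed
      then show ?thesis
        unfolding g_def \<phi>_def[symmetric] l_def[symmetric]
        by (subst sum.swap) (simp add: sum_divide_distrib)
    qed
    have gt: "g (ht t) = (\<Sum>j\<in>S. \<Sum>k\<in>S. W j k / (complex_of_real (l' j) - z))"
    proof -
      have "complex_of_real ((\<phi>' j x)\<^sup>2) = (\<Sum>k\<in>S. W j k)" for j
      proof -
        have "(\<phi>' j x)\<^sup>2 = \<phi>' j x * (\<Sum>k\<in>S. U j k * \<phi> k x)"
          using ex'[of j] by (simp add: power2_eq_square)
        then show ?thesis by (simp add: W_def sum_distrib_left mult_ac)
      qed
      then show ?thesis
        unfolding g_def \<phi>'_def[symmetric] l'_def[symmetric]
        by (simp add: sum_divide_distrib)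
    qed
    have "g h - g (ht t) = (\<Sum>j\<in>S. \<Sum>k\<in>S. complex_of_real t *
        (complex_of_real ((\<phi> k x)\<^sup>2) / (complex_of_real (l k) - z)) *
        (complex_of_real ((\<phi>' j x)\<^sup>2) / (complex_of_real (l' j) - z)))"
      unfolding g0 gt sum_subtractf[symmetric]
    proof (intro sum.cong refl)
      fix j k assume jk: "j \<in> S" "k \<in> S"
      have "W j k * complex_of_real (l' j - l k) = complex_of_real (((l' j - l k) * U j k) * \<phi>' j x * \<phi> k x)"
        by (simp add: W_def)
      also have "\<dots> = complex_of_real (t * (\<phi> k x)\<^sup>2 * (\<phi>' j x)\<^sup>2)"
        unfolding comm[OF jk] by (simp add: power2_eq_square)
      finally have *: "W j k * (complex_of_real (l' j) - complex_of_real (l k))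
          = complex_of_real t * complex_of_real ((\<phi> k x)\<^sup>2) * complex_of_real ((\<phi>' j x)\<^sup>2)"
        by simp
      have "W j k / (complex_of_real (l k) - z) - W j k / (complex_of_real (l' j) - z)
          = W j k * (complex_of_real (l' j) - complex_of_real (l k)) /
            ((complex_of_real (l k) - z) * (complex_of_real (l' j) - z))"
        using nz[of "l k"] nz[of "l' j"] by (simp add: field_simps)
      then show "W j k / (complex_of_real (l k) - z) - W j k / (complex_of_real (l' j) - z)
          = complex_of_real t * (complex_of_real ((\<phi> k x)\<^sup>2) / (complex_of_real (l k) - z)) *
            (complex_of_real ((\<phi>' j x)\<^sup>2) / (complex_of_real (l' j) - z))"
        unfolding * by simp
    qed
    also have "\<dots> = complex_of_real t * g h * g (ht t)"
      unfolding g_def \<phi>_def[symmetric] l_def[symmetric] \<phi>'_def[symmetric] l'_def[symmetric]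
      by (subst sum.swap) (simp add: sum_distrib_left sum_distrib_right sum_divide_distrib mult_ac)
    finally show ?thesis .
  qed
  define p where "p = Re (1 / g h)"
  define q where "q = - Im (1 / g h)"
  have gnz: "g h \<noteq> 0" if "symm_on S h" for h using Im_pos[OF that] by auto
  have "q > 0"
    using Im_pos[OF h] gnz[OF h] by (simp add: q_def Im_divide complex_neq_0)
  moreover have "fcalc S (ht t) (lorentz \<epsilon> E) x x = \<epsilon> * (q / ((t + p)\<^sup>2 + q\<^sup>2))" for t
  proof -
    have "1 / g (ht t) = 1 / g h + complex_of_real t"
      using resolvent[of t] gnz[OF h] gnz[OF sym[of t]] by (simp add: field_simps)
    also have "\<dots> = Complex (t + p) (- q)"
      by (simp add: p_def q_def complex_eq_iff)
    finally have "g (ht t) = 1 / Complex (t + p) (- q)"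
      by (metis div_by_1 divide_divide_eq_right mult_1)
    then have "Im (g (ht t)) = q / ((t + p)\<^sup>2 + q\<^sup>2)"
      by (simp add: Im_divide)
    then show ?thesis using Im_g[of "ht t"] by simp
  qed
  ultimately show ?thesis unfolding ht_def by blast
qed

lemma nn_integral_cauchy_density:
  assumes q: "q > (0::real)"
  shows "(\<integral>\<^sup>+t. ennreal (q / ((t + p)\<^sup>2 + q\<^sup>2)) \<partial>lborel) = ennreal pi"
proof -
  let ?f = "\<lambda>t. q / ((t + p)\<^sup>2 + q\<^sup>2)" and ?F = "\<lambda>t. arctan ((t + p) / q)"
  have pos: "(t + p)\<^sup>2 + q\<^sup>2 > 0" for t using q by (simp add: add_nonneg_pos)
  have deriv: "(?F has_real_derivative ?f t) (at t)" for t
    using q pos[of t]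
    by (auto intro!: derivative_eq_intros simp: field_simps power2_eq_square)
  have tp: "filterlim (\<lambda>t. (t + p) / q) at_top at_top"
    using q by real_asymp
  have tm: "filterlim (\<lambda>t. (t + p) / q) at_bot at_bot"
    using q by real_asymp
  have top: "((?F \<circ> real_of_ereal) \<longlongrightarrow> pi / 2) (at_left \<infinity>)"
    by (simp add: ereal_tendsto_simps1 filterlim_compose[OF tendsto_arctan_at_top tp])
  have bot: "((?F \<circ> real_of_ereal) \<longlongrightarrow> - (pi / 2)) (at_right (-\<infinity>))"
    by (simp add: ereal_tendsto_simps1 filterlim_compose[OF tendsto_arctan_at_bot tm])
  have cont: "isCont ?f t" for t
    using pos[of t] q by (intro continuous_intros) simp
  have I: "set_integrable lborel (einterval (-\<infinity>) \<infinity>) ?f" "(LBINT t=-\<infinity>..\<infinity>. ?f t) = pi / 2 - - (pi / 2)"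
    using interval_integral_FTC_nonneg[of "-\<infinity>" "\<infinity>" ?F ?f, OF _ deriv cont _ bot top] q pos
    by (auto simp: less_imp_le)
  then have "integrable lborel ?f"
    by (simp add: set_integrable_def einterval_eq_UNIV)
  moreover have "(\<integral>t. ?f t \<partial>lborel) = pi"
    using I(2) by (simp add: interval_lebesgue_integral_def set_lebesgue_integral_def einterval_eq_UNIV)
  ultimately show ?thesis
    using q pos by (subst nn_integral_eq_integral) (auto simp: less_imp_le)
qed

lemma std_normal_density_le_1: "std_normal_density t \<le> 1"
proof -
  have "1 / sqrt (2 * pi) \<le> 1" using pi_ge_two by simp
  then show ?thesis
    unfolding std_normal_density_def by (intro mult_le_one) auto
qed

text \<open>In the variable \<open>t\<close> the entry is a Cauchy profile of Lebesgue integral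
  \<open>pi * \<epsilon> / s\<close> whatever \<open>h\<close> and \<open>E\<close> are, and the
  Gaussian density is at most 1.\<close>

lemma wegner_estimate:
  assumes S: "finite S" and h: "symm_on S h" and x: "x \<in> S" and \<epsilon>: "\<epsilon> > 0" and s: "s > 0"
  shows "(\<integral>\<^sup>+t. ennreal (fcalc S (\<lambda>y z. h y z + (if y = x \<and> z = x then s * t else 0)) (lorentz \<epsilon> E) x x) \<partial>std_gauss)
    \<le> ennreal (pi * \<epsilon> / s)"
proof -
  obtain p q where q: "q > 0" and eq: "\<And>t. fcalc S (\<lambda>y z. h y z + (if y = x \<and> z = x then t else 0)) (lorentz \<epsilon> E) x x
      = \<epsilon> * (q / ((t + p)\<^sup>2 + q\<^sup>2))"
    using rank_one_lorentz[OF S h x \<epsilon>] by metis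
  have scale: "\<epsilon> * (q / ((s * t + p)\<^sup>2 + q\<^sup>2)) = (\<epsilon> / s) * ((q / s) / ((t + p / s)\<^sup>2 + (q / s)\<^sup>2))" for t
  proof -
    have "(s * t + p)\<^sup>2 + q\<^sup>2 = s\<^sup>2 * ((t + p / s)\<^sup>2 + (q / s)\<^sup>2)"
      using s by (simp add: power2_eq_square field_simps)
    then show ?thesis using s by (simp add: power2_eq_square)
  qed
  have "(\<integral>\<^sup>+t. ennreal (fcalc S (\<lambda>y z. h y z + (if y = x \<and> z = x then s * t else 0)) (lorentz \<epsilon> E) x x) \<partial>std_gauss)
      = (\<integral>\<^sup>+t. ennreal (std_normal_density t) * ennreal ((\<epsilon> / s) * ((q / s) / ((t + p / s)\<^sup>2 + (q / s)\<^sup>2))) \<partial>lborel)"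
    unfolding std_gauss_def eq scale by (rule nn_integral_density) auto
  also have "\<dots> \<le> (\<integral>\<^sup>+t. ennreal (\<epsilon> / s) * ennreal ((q / s) / ((t + p / s)\<^sup>2 + (q / s)\<^sup>2)) \<partial>lborel)"
  proof (rule nn_integral_mono)
    fix t
    have "ennreal (std_normal_density t) * ennreal ((\<epsilon> / s) * ((q / s) / ((t + p / s)\<^sup>2 + (q / s)\<^sup>2)))
        \<le> 1 * ennreal ((\<epsilon> / s) * ((q / s) / ((t + p / s)\<^sup>2 + (q / s)\<^sup>2)))"
      by (intro mult_right_mono) (use std_normal_density_le_1 in \<open>auto simp: ennreal_le_1\<close>)
    then show "ennreal (std_normal_density t) * ennreal ((\<epsilon> / s) * ((q / s) / ((t + p / s)\<^sup>2 + (q / s)\<^sup>2)))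
        \<le> ennreal (\<epsilon> / s) * ennreal ((q / s) / ((t + p / s)\<^sup>2 + (q / s)\<^sup>2))"
      using \<epsilon> s q by (simp add: ennreal_mult[symmetric])
  qed
  also have "\<dots> = ennreal (\<epsilon> / s) * ennreal pi"
    using nn_integral_cauchy_density[of "q / s" "p / s"] q s by (subst nn_integral_cmult) auto
  also have "\<dots> = ennreal (pi * \<epsilon> / s)"
    using \<epsilon> s by (simp add: ennreal_mult[symmetric] mult.commute)
  finally show ?thesis .
qed

section \<open>Gaussian integration\<close>

lemma space_std_gauss [simp]: "space std_gauss = UNIV"
  by (simp add: std_gauss_def)

lemma sets_std_gauss [simp, measurable_cong]: "sets std_gauss = sets borel"
  by (simp add: std_gauss_def)

lemma prob_space_std_gauss: "prob_space std_gauss"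
  unfolding std_gauss_def by (rule prob_space_normal_density) simp

lemma product_sigma_finite_std_gauss: "product_sigma_finite (\<lambda>_. std_gauss)"
  by (intro product_sigma_finite.intro prob_space_imp_sigma_finite prob_space_std_gauss)

lemma nn_integral_std_gauss_quadratic:
  assumes nonneg: "\<And>t. 0 \<le> A + B * t + C * t\<^sup>2"
  shows "(\<integral>\<^sup>+t. ennreal (A + B * t + C * t\<^sup>2) \<partial>std_gauss) = ennreal (A + C)"
proof -
  have "has_bochner_integral lborel
      (\<lambda>t. A * (std_normal_density t * t ^ (2 * 0)) + B * (std_normal_density t * t ^ (2 * 0 + 1))
         + C * (std_normal_density t * t ^ (2 * 1)))
      (A * (fact (2 * 0) / (2^0 * fact 0)) + B * 0 + C * (fact (2 * 1) / (2^1 * fact 1)))"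
    by (intro has_bochner_integral_add has_bochner_integral_mult_right std_normal_moment_even std_normal_moment_odd)
  then have I: "has_bochner_integral lborel (\<lambda>t. std_normal_density t * (A + B * t + C * t\<^sup>2)) (A + C)"
    by (simp add: fact_numeral algebra_simps power2_eq_square)
  have "(\<integral>\<^sup>+t. ennreal (A + B * t + C * t\<^sup>2) \<partial>std_gauss)
      = (\<integral>\<^sup>+t. ennreal (std_normal_density t) * ennreal (A + B * t + C * t\<^sup>2) \<partial>lborel)"
    unfolding std_gauss_def by (rule nn_integral_density) auto
  also have "\<dots> = (\<integral>\<^sup>+t. ennreal (std_normal_density t * (A + B * t + C * t\<^sup>2)) \<partial>lborel)"
    using nonneg by (simp add: ennreal_mult')
  also have "\<dots> = ennreal (A + C)"
    using I nonneg by (subst nn_integral_eq_integral) (auto simp: has_bochner_integral_iff)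
  finally show ?thesis .
qed

section \<open>Redrawing Gaussian coordinates\<close>

lemma measurable_resample:
  assumes i: "i \<in> I"
  shows "(\<lambda>p. (fst p)(i := snd p)) \<in> measurable (PiM I (\<lambda>_. std_gauss) \<Otimes>\<^sub>M std_gauss) (PiM I (\<lambda>_. std_gauss))"
  using i by (auto intro!: measurable_fun_upd[where J = I] simp: case_prod_beta')

text \<open>Redraws coordinate \<open>i\<close> while the index set stays fixed, so single Gaussians
  can be integrated out without splitting the product space in later statements.\<close>

lemma nn_integral_resample:
  assumes I: "finite I" "i \<in> I" and F: "F \<in> borel_measurable (PiM I (\<lambda>_. std_gauss))"
  shows "(\<integral>\<^sup>+\<omega>. F \<omega> \<partial>PiM I (\<lambda>_. std_gauss))
    = (\<integral>\<^sup>+\<omega>. (\<integral>\<^sup>+t. F (\<omega> (i := t)) \<partial>std_gauss) \<partial>PiM I (\<lambda>_. std_gauss))"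
proof -
  interpret g: prob_space std_gauss by (rule prob_space_std_gauss)
  interpret product_sigma_finite "\<lambda>_. std_gauss" by (rule product_sigma_finite_std_gauss)
  define J where "J = I - {i}"
  have J: "I = insert i J" "finite J" "i \<notin> J" using I by (auto simp: J_def)
  have "(\<lambda>p. F ((fst p)(i := snd p))) \<in> borel_measurable (PiM I (\<lambda>_. std_gauss) \<Otimes>\<^sub>M std_gauss)"
    using measurable_compose[OF measurable_resample[OF I(2)] F] by (simp add: case_prod_beta')
  then have G: "(\<lambda>\<omega>. \<integral>\<^sup>+t. F (\<omega> (i := t)) \<partial>std_gauss) \<in> borel_measurable (PiM I (\<lambda>_. std_gauss))"
    using g.borel_measurable_nn_integral_fst[of "\<lambda>p. F ((fst p)(i := snd p))"] by simp
  have "(\<integral>\<^sup>+\<omega>. (\<integral>\<^sup>+t. F (\<omega> (i := t)) \<partial>std_gauss) \<partial>PiM I (\<lambda>_. std_gauss))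
      = (\<integral>\<^sup>+\<omega>. (\<integral>\<^sup>+y. (\<integral>\<^sup>+t. F ((\<omega> (i := y))(i := t)) \<partial>std_gauss) \<partial>std_gauss) \<partial>PiM J (\<lambda>_. std_gauss))"
    using product_nn_integral_insert[OF J(2,3) G[unfolded J(1)]] by (simp add: J(1))
  \<comment> \<open>The redrawn integrand ignores the old value \<open>y\<close>, whose law has
    total mass 1.\<close>
  also have "\<dots> = (\<integral>\<^sup>+\<omega>. (\<integral>\<^sup>+t. F (\<omega> (i := t)) \<partial>std_gauss) \<partial>PiM J (\<lambda>_. std_gauss))"
    using g.emeasure_space_1 by simp
  also have "\<dots> = (\<integral>\<^sup>+\<omega>. F \<omega> \<partial>PiM I (\<lambda>_. std_gauss))"
    using product_nn_integral_insert[OF J(2,3) F[unfolded J(1)]] by (simp add: J(1))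
  finally show ?thesis by simp
qed

lemma nn_integral_resample_le:
  assumes "finite I" "i \<in> I" "F \<in> borel_measurable (PiM I (\<lambda>_. std_gauss))"
    and "\<And>\<omega>. \<omega> \<in> space (PiM I (\<lambda>_. std_gauss)) \<Longrightarrow> (\<integral>\<^sup>+t. F (\<omega> (i := t)) \<partial>std_gauss) \<le> G \<omega>"
  shows "(\<integral>\<^sup>+\<omega>. F \<omega> \<partial>PiM I (\<lambda>_. std_gauss)) \<le> (\<integral>\<^sup>+\<omega>. G \<omega> \<partial>PiM I (\<lambda>_. std_gauss))"
  unfolding nn_integral_resample[OF assms(1-3)] by (rule nn_integral_mono) (rule assms(4))

text \<open>The kernel is frozen under changes of the coordinates in the form, so off-diagonal terms
  average to zero. The induction redraws one coordinate per step. Positivity is asked for every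
  subset because partial forms occur and \<open>ennreal\<close> truncates negative values.\<close>

lemma gaussian_quadratic_form:
  fixes \<iota> :: "'f \<Rightarrow> 'i" and s :: "'f \<Rightarrow> real" and \<gamma> :: "('i \<Rightarrow> real) \<Rightarrow> 'f \<Rightarrow> 'f \<Rightarrow> real"
  defines "M I \<equiv> PiM I (\<lambda>_ :: 'i. std_gauss)"
  defines "Q F \<omega> \<equiv> (\<Sum>f\<in>F. \<Sum>g\<in>F. s f * \<omega> (\<iota> f) * (s g * \<omega> (\<iota> g)) * \<gamma> \<omega> f g)"
  assumes I: "finite I" and F: "finite F" "inj_on \<iota> F" "\<iota> ` F \<subseteq> I"
    and meas: "\<And>f g. f \<in> F \<Longrightarrow> g \<in> F \<Longrightarrow> (\<lambda>\<omega>. \<gamma> \<omega> f g) \<in> borel_measurable (M I)"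
    and sym: "\<And>\<omega> f g. \<gamma> \<omega> f g = \<gamma> \<omega> g f"
    and psd: "\<And>\<omega> G \<xi>. G \<subseteq> F \<Longrightarrow> 0 \<le> (\<Sum>f\<in>G. \<Sum>g\<in>G. \<xi> f * \<xi> g * \<gamma> \<omega> f g)"
    and indep: "\<And>\<omega> e t f g. e \<in> F \<Longrightarrow> f \<in> F \<Longrightarrow> g \<in> F \<Longrightarrow> \<gamma> (\<omega> (\<iota> e := t)) f g = \<gamma> \<omega> f g"
  shows "(\<integral>\<^sup>+\<omega>. ennreal (Q F \<omega>) \<partial>M I) = (\<integral>\<^sup>+\<omega>. ennreal (\<Sum>f\<in>F. (s f)\<^sup>2 * \<gamma> \<omega> f f) \<partial>M I)"
proof -
  have diag: "0 \<le> \<gamma> \<omega> f f" if "f \<in> F" for f \<omega>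
    using psd[of "{f}" "\<lambda>_. 1" \<omega>] that by simp
  have coord: "(\<lambda>\<omega>. \<omega> (\<iota> f)) \<in> borel_measurable (M I)" if "f \<in> F" for f
    unfolding M_def using F(3) that by (intro measurable_compose[OF measurable_component_singleton]) auto
  have Qmeas: "(\<lambda>\<omega>. ennreal (Q G \<omega>)) \<in> borel_measurable (M I)" if "G \<subseteq> F" for G
    unfolding Q_def
    by (intro measurable_compose[OF _ measurable_ennreal] borel_measurable_sum borel_measurable_times
        borel_measurable_const coord meas) (use that in auto)
  have Q0: "0 \<le> Q G \<omega>" if "G \<subseteq> F" for G \<omega>
    unfolding Q_def by (rule psd[OF that])
  have "(\<integral>\<^sup>+\<omega>. ennreal (Q G \<omega>) \<partial>M I) = (\<integral>\<^sup>+\<omega>. ennreal (\<Sum>f\<in>G. (s f)\<^sup>2 * \<gamma> \<omega> f f) \<partial>M I)"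
    if "finite G" "G \<subseteq> F" for G
    using that
  proof (induction G rule: finite_induct)
    case empty
    then show ?case by (simp add: Q_def)
  next
    case (insert e G)
    then have e: "e \<in> F" and G: "G \<subseteq> F" by auto
    have eI: "\<iota> e \<in> I" using F(3) e by auto
    have ne: "\<iota> f \<noteq> \<iota> e" if "f \<in> G" for f
      using that insert(2) e G F(2) by (auto simp: inj_on_def)
    have eG: "f \<in> F" if "f \<in> insert e G" for f
      using that e G by auto
    have step: "Q (insert e G) (\<omega> (\<iota> e := t)) = Q G \<omega>
        + (2 * s e * (\<Sum>g\<in>G. s g * \<omega> (\<iota> g) * \<gamma> \<omega> e g)) * t + ((s e)\<^sup>2 * \<gamma> \<omega> e e) * t\<^sup>2" for \<omega> t
    proof -
      let ?\<xi> = "\<lambda>g. s g * (\<omega> (\<iota> e := t)) (\<iota> g)"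
      define X where "X = Q (insert e G) (\<omega> (\<iota> e := t))"
      have "X = (\<Sum>f\<in>insert e G. \<Sum>g\<in>insert e G. ?\<xi> f * ?\<xi> g * \<gamma> \<omega> f g)"
        unfolding X_def Q_def by (intro sum.cong refl) (simp add: indep[OF e eG eG])
      also have "\<dots> = ?\<xi> e * ?\<xi> e * \<gamma> \<omega> e e + (\<Sum>g\<in>G. ?\<xi> e * ?\<xi> g * \<gamma> \<omega> e g)
          + ((\<Sum>f\<in>G. ?\<xi> f * ?\<xi> e * \<gamma> \<omega> f e) + (\<Sum>f\<in>G. \<Sum>g\<in>G. ?\<xi> f * ?\<xi> g * \<gamma> \<omega> f g))"
        using insert(1,2) by (simp add: sum.distrib)
      also have "(\<Sum>f\<in>G. \<Sum>g\<in>G. ?\<xi> f * ?\<xi> g * \<gamma> \<omega> f g) = Q G \<omega>"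
        unfolding Q_def by (intro sum.cong refl) (simp add: ne)
      also have "(\<Sum>g\<in>G. ?\<xi> e * ?\<xi> g * \<gamma> \<omega> e g) = s e * t * (\<Sum>g\<in>G. s g * \<omega> (\<iota> g) * \<gamma> \<omega> e g)"
        unfolding sum_distrib_left by (intro sum.cong refl) (simp add: ne)
      also have "(\<Sum>f\<in>G. ?\<xi> f * ?\<xi> e * \<gamma> \<omega> f e) = s e * t * (\<Sum>g\<in>G. s g * \<omega> (\<iota> g) * \<gamma> \<omega> e g)"
        unfolding sum_distrib_left by (intro sum.cong refl) (simp add: ne sym[of _ _ e])
      finally have "X = Q G \<omega> + (2 * s e * (\<Sum>g\<in>G. s g * \<omega> (\<iota> g) * \<gamma> \<omega> e g)) * t + ((s e)\<^sup>2 * \<gamma> \<omega> e e) * t\<^sup>2"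
        by (simp add: algebra_simps power2_eq_square)
      then show ?thesis by (simp only: X_def)
    qed
    have "(\<integral>\<^sup>+\<omega>. ennreal (Q (insert e G) \<omega>) \<partial>M I)
        = (\<integral>\<^sup>+\<omega>. (\<integral>\<^sup>+t. ennreal (Q (insert e G) (\<omega> (\<iota> e := t))) \<partial>std_gauss) \<partial>M I)"
      unfolding M_def by (rule nn_integral_resample[OF I eI Qmeas[OF insert(4), unfolded M_def]])
    also have "\<dots> = (\<integral>\<^sup>+\<omega>. ennreal (Q G \<omega> + (s e)\<^sup>2 * \<gamma> \<omega> e e) \<partial>M I)"
      unfolding step
      by (rule nn_integral_cong, rule nn_integral_std_gauss_quadratic, unfold step[symmetric], rule Q0[OF insert(4)])
    also have "\<dots> = (\<integral>\<^sup>+\<omega>. ennreal (Q G \<omega>) + ennreal ((s e)\<^sup>2 * \<gamma> \<omega> e e) \<partial>M I)"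
      by (intro nn_integral_cong ennreal_plus Q0[OF G] mult_nonneg_nonneg diag[OF e]) simp
    also have "\<dots> = (\<integral>\<^sup>+\<omega>. ennreal (Q G \<omega>) \<partial>M I) + (\<integral>\<^sup>+\<omega>. ennreal ((s e)\<^sup>2 * \<gamma> \<omega> e e) \<partial>M I)"
      by (intro nn_integral_add Qmeas[OF G] measurable_compose[OF _ measurable_ennreal]
          borel_measurable_times borel_measurable_const meas e)
    also have "\<dots> = (\<integral>\<^sup>+\<omega>. ennreal (\<Sum>f\<in>G. (s f)\<^sup>2 * \<gamma> \<omega> f f) \<partial>M I) + (\<integral>\<^sup>+\<omega>. ennreal ((s e)\<^sup>2 * \<gamma> \<omega> e e) \<partial>M I)"
      using insert.IH[OF G] by simp
    also have "\<dots> = (\<integral>\<^sup>+\<omega>. ennreal (\<Sum>f\<in>G. (s f)\<^sup>2 * \<gamma> \<omega> f f) + ennreal ((s e)\<^sup>2 * \<gamma> \<omega> e e) \<partial>M I)"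
      by (intro nn_integral_add[symmetric] measurable_compose[OF _ measurable_ennreal]
          borel_measurable_sum borel_measurable_times borel_measurable_const meas) (use e G in auto)
    also have "\<dots> = (\<integral>\<^sup>+\<omega>. ennreal (\<Sum>f\<in>insert e G. (s f)\<^sup>2 * \<gamma> \<omega> f f) \<partial>M I)"
    proof (rule nn_integral_cong)
      fix \<omega>
      have "0 \<le> (\<Sum>f\<in>G. (s f)\<^sup>2 * \<gamma> \<omega> f f)" "0 \<le> (s e)\<^sup>2 * \<gamma> \<omega> e e"
        using G e by (auto intro!: sum_nonneg mult_nonneg_nonneg diag)
      then show "ennreal (\<Sum>f\<in>G. (s f)\<^sup>2 * \<gamma> \<omega> f f) + ennreal ((s e)\<^sup>2 * \<gamma> \<omega> e e)
          = ennreal (\<Sum>f\<in>insert e G. (s f)\<^sup>2 * \<gamma> \<omega> f f)"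
        using insert(1,2) by (simp add: add.commute ennreal_plus[symmetric] del: ennreal_plus)
    qed
    finally show ?case .
  qed
  from this[OF F(1) order_refl] show ?thesis .
qed

lemma (in prob_space) markov_bound:
  assumes f: "f \<in> borel_measurable M" and K: "(\<integral>\<^sup>+\<omega>. ennreal (f \<omega>) \<partial>M) \<le> ennreal K" "0 \<le> K" and a: "a > 0"
  shows "measure M {\<omega>\<in>space M. a \<le> f \<omega>} \<le> K / a"
proof -
  have "{\<omega>\<in>space M. a \<le> f \<omega>} = {\<omega>\<in>space M. 1 \<le> ennreal (1 / a) * ennreal (f \<omega>)} \<inter> space M"
  proof -
    have "a \<le> f \<omega> \<longleftrightarrow> 1 \<le> ennreal (1 / a) * ennreal (f \<omega>)" for \<omega>
      using a by (cases "0 \<le> f \<omega>") (auto simp: ennreal_mult'[symmetric] ennreal_neg field_simps)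
    then show ?thesis by auto
  qed
  then have "emeasure M {\<omega>\<in>space M. a \<le> f \<omega>} \<le> ennreal (1 / a) * (\<integral>\<^sup>+\<omega>. ennreal (f \<omega>) * indicator (space M) \<omega> \<partial>M)"
    using nn_integral_Markov_inequality[of "\<lambda>\<omega>. ennreal (f \<omega>)" "space M" M "ennreal (1 / a)"] f
    by (simp add: Int_commute)
  also have "(\<integral>\<^sup>+\<omega>. ennreal (f \<omega>) * indicator (space M) \<omega> \<partial>M) = (\<integral>\<^sup>+\<omega>. ennreal (f \<omega>) \<partial>M)"
    by (rule nn_integral_cong) simp
  also have "ennreal (1 / a) * (\<integral>\<^sup>+\<omega>. ennreal (f \<omega>) \<partial>M) \<le> ennreal (1 / a) * ennreal K"
    by (rule mult_left_mono[OF K(1)]) simp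
  also have "\<dots> = ennreal (K / a)"
    using a K(2) by (simp add: ennreal_mult[symmetric])
  finally show ?thesis
    using a K(2) by (simp add: emeasure_eq_measure)
qed

section \<open>The ultrametric ensemble\<close>

text \<open>Blocks are nested, so a common block at one level persists at all higher ones; level
  \<open>x + y\<close> shows that the minimum is taken over a nonempty set.\<close>

lemma hdist_le_iff: "hdist x y \<le> r \<longleftrightarrow> (x - 1) div 2 ^ r = (y - 1) div 2 ^ r"
proof -
  let ?P = "\<lambda>r. (x - 1) div 2 ^ r = (y - 1) div 2 ^ r"
  have mono: "?P s" if "?P r" "r \<le> s" for r s
  proof -
    have "a div 2 ^ s = (a div 2 ^ r) div 2 ^ (s - r)" for a :: nat
      using that(2) by (simp add: div_mult2_eq[symmetric] power_add[symmetric])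
    then show ?thesis using that(1) by simp
  qed
  have "x < 2 ^ x" "y < 2 ^ y" by (rule less_exp)+
  moreover have "(2::nat) ^ x \<le> 2 ^ (x + y)" "(2::nat) ^ y \<le> 2 ^ (x + y)" by (auto intro: power_increasing)
  ultimately have "x - 1 < 2 ^ (x + y)" "y - 1 < 2 ^ (x + y)" by linarith+
  then have "?P (x + y)" by simp
  then have "?P (hdist x y)" unfolding hdist_def by (rule LeastI)
  then show ?thesis using mono Least_le[of ?P r] unfolding hdist_def by blast
qed

lemma hdist_commute: "hdist x y = hdist y x"
  unfolding hdist_def by (rule arg_cong[where f = Least]) auto

lemma hdist_self [simp]: "hdist x x = 0"
  using hdist_le_iff[of x x 0] by simp

lemma hdist_across_block:
  assumes "y \<in> hball n (int k) x" "z \<in> Bn n - hball n (int k) x"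
  shows "k < hdist y z"
  using assms hdist_le_iff[of x y k] hdist_le_iff[of x z k] hdist_le_iff[of y z k]
  by (auto simp: hball_def)

lemma phivar_commute: "phivar r x y = phivar r y x"
  by (simp add: phivar_def hdist_commute eq_commute)

lemma phivar_nonneg: "0 \<le> phivar r x y"
  by (simp add: phivar_def)

lemma finite_Bn [simp]: "finite (Bn n)"
  by (simp add: Bn_def)

lemma card_Bn: "card (Bn n) = 2 ^ n"
  by (simp add: Bn_def)

lemma real_card_le: "X \<subseteq> Bn n \<Longrightarrow> real (card X) \<le> 2 ^ n"
proof -
  assume "X \<subseteq> Bn n"
  then have "real (card X) \<le> real (2 ^ n)"
    using card_mono[OF finite_Bn, of X n] by (simp only: card_Bn of_nat_le_iff)
  then show ?thesis by simp
qed

lemma sum_geometric_half: "(\<Sum>r\<le>n. (1/2::real) ^ r) \<le> 2"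
  by (subst sum_gp0) (simp add: field_simps)

lemma sum_geometric_half_tail:
  "(\<Sum>r\<le>n. if k < r then (1/2::real) ^ r else 0) = (1/2) ^ k - (1/2) ^ max n k"
proof (induction n)
  case (Suc n)
  show ?case
  proof (cases "k < Suc n")
    case True
    then have "max n k = n" "max (Suc n) k = Suc n" by auto
    then show ?thesis using True Suc by simp
  next
    case False
    then have "max n k = k" "max (Suc n) k = k" by auto
    then show ?thesis using False Suc by simp
  qed
qed simp

text \<open>The term \<open>r = 0\<close>, \<open>y = 1\<close> alone is 2. For the upper bound,
  level \<open>r\<close> has at most \<open>2^r\<close> sites of variance at most
  \<open>2 * 2^-r\<close>, so its row sum is at most 2; the decay in \<open>r\<close> brings the
  total to at most 4.\<close>

lemma Zn_bounds:
  assumes c: "c > 0"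
  shows "1 \<le> Zn n c" "Zn n c \<le> 2"
proof -
  let ?s = "\<Sum>y\<in>Bn n. \<Sum>r\<le>n. 2 powr (- (1 + c) * real r) * phivar r 1 y"
  have "(1::real) \<le> 2 powr (- (1 + c) * real 0) * phivar 0 1 1"
    by (simp add: phivar_def)
  also have "\<dots> \<le> (\<Sum>r\<le>n. 2 powr (- (1 + c) * real r) * phivar r 1 1)"
    by (rule member_le_sum[of 0]) (auto simp: phivar_nonneg)
  also have "\<dots> \<le> ?s"
    by (rule member_le_sum[of 1]) (auto simp: phivar_nonneg Bn_def intro!: sum_nonneg mult_nonneg_nonneg)
  finally show "1 \<le> Zn n c" by (simp add: Zn_def)
  have row: "(\<Sum>y\<in>Bn n. phivar r 1 y) \<le> 2" for r
  proof -
    have "(\<Sum>y\<in>Bn n. phivar r 1 y) \<le> (\<Sum>y\<in>Bn n. if hdist 1 y \<le> r then 2 * 2 powr (- real r) else 0)"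
      by (rule sum_mono) (auto simp: phivar_def)
    also have "\<dots> = real (card {y\<in>Bn n. hdist 1 y \<le> r}) * (2 * 2 powr (- real r))"
      by (simp add: sum.inter_filter[symmetric])
    also have "\<dots> \<le> 2 ^ r * (2 * 2 powr (- real r))"
    proof (rule mult_right_mono)
      have "{y\<in>Bn n. hdist 1 y \<le> r} \<subseteq> {1..2 ^ r}"
      proof
        fix y assume y: "y \<in> {y\<in>Bn n. hdist 1 y \<le> r}"
        then have "(y - 1) div 2 ^ r = 0" "1 \<le> y" using hdist_le_iff[of 1 y r] by (auto simp: Bn_def)
        then have "y - 1 < 2 ^ r" by (simp add: div_eq_0_iff)
        then show "y \<in> {1..2 ^ r}" using \<open>1 \<le> y\<close> by auto
      qed
      then have "card {y\<in>Bn n. hdist 1 y \<le> r} \<le> 2 ^ r"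
        using card_mono[of "{1..2 ^ r}" "{y\<in>Bn n. hdist 1 y \<le> r}"] by simp
      then have "real (card {y\<in>Bn n. hdist 1 y \<le> r}) \<le> real (2 ^ r)"
        by (simp only: of_nat_le_iff)
      then show "real (card {y\<in>Bn n. hdist 1 y \<le> r}) \<le> 2 ^ r" by simp
    qed simp
    also have "\<dots> = 2" by (simp add: powr_minus powr_realpow)
    finally show ?thesis .
  qed
  have "?s = (\<Sum>r\<le>n. 2 powr (- (1 + c) * real r) * (\<Sum>y\<in>Bn n. phivar r 1 y))"
    by (subst sum.swap) (simp add: sum_distrib_left)
  also have "\<dots> \<le> (\<Sum>r\<le>n. (1/2) ^ r * 2)"
  proof (intro sum_mono mult_mono row)
    fix r
    have "2 powr (- (1 + c) * real r) \<le> 2 powr (- real r)"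
      using c by (intro powr_mono) (auto simp: algebra_simps)
    also have "\<dots> = (1/2) ^ r" by (simp add: powr_minus powr_realpow power_one_over inverse_eq_divide)
    finally show "2 powr (- (1 + c) * real r) \<le> (1/2) ^ r" .
  qed (auto intro: sum_nonneg simp: phivar_nonneg)
  also have "\<dots> \<le> 4"
    using sum_geometric_half[of n] by (simp add: sum_distrib_right[symmetric])
  finally have "sqrt ?s \<le> sqrt 4" by (rule real_sqrt_le_mono)
  then show "Zn n c \<le> 2" by (simp add: Zn_def)
qed

section \<open>Matrix entries as linear forms in the Gaussians\<close>

definition hcoef :: "nat \<Rightarrow> real \<Rightarrow> nat \<Rightarrow> nat \<Rightarrow> nat \<Rightarrow> real" where
  "hcoef n c r x y = 1 / Zn n c * (2 powr (- (1 + c) * real r / 2) * sqrt (phivar r x y))"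

lemma Hn_eq: "Hn n c \<omega> x y = (\<Sum>r\<le>n. hcoef n c r x y * \<omega> (r, min x y, max x y))"
  by (simp add: Hn_def Phi_def hcoef_def sum_distrib_left mult.assoc)

text \<open>Level 0 supplies every site with its own diagonal Gaussian of order one; this randomness
  drives all the averaging bounds.\<close>

lemma hcoef_diag_ge: "c > 0 \<Longrightarrow> 1/2 \<le> hcoef n c 0 y y"
proof -
  assume "c > 0"
  then have "1 \<le> sqrt (2::real)" "1 \<le> Zn n c" "Zn n c \<le> 2 * 1" using Zn_bounds by auto
  moreover from this have "Zn n c \<le> 2 * sqrt 2" by linarith
  ultimately show ?thesis by (simp add: hcoef_def phivar_def field_simps)
qed

text \<open>Only levels \<open>r > k\<close> join the two blocks. Of the factors
  \<open>2^(-(1 + c) r)\<close> and \<open>2^-r\<close> the first is replaced by its value at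
  \<open>k\<close> and the second is summed as a geometric tail, at most
  \<open>2^-k\<close>.\<close>

lemma sum_hcoef_square_across_block:
  assumes c: "c > 0" and y: "y \<in> hball n (int k) x" and z: "z \<in> Bn n - hball n (int k) x"
  shows "(\<Sum>r\<le>n. (hcoef n c r y z)\<^sup>2) \<le> 2 powr (- (2 + c) * real k)"
proof -
  have kd: "k < hdist y z" by (rule hdist_across_block[OF y z])
  then have yz: "y \<noteq> z" by auto
  have "(\<Sum>r\<le>n. (hcoef n c r y z)\<^sup>2) \<le> (\<Sum>r\<le>n. 2 powr (- (1 + c) * real k) * (if k < r then (1/2) ^ r else 0))"
  proof (rule sum_mono)
    fix r
    have "(hcoef n c r y z)\<^sup>2 = (1 / (Zn n c)\<^sup>2) * ((2 powr (- (1 + c) * real r / 2))\<^sup>2 * phivar r y z)"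
      using phivar_nonneg[of r y z] by (simp add: hcoef_def power_mult_distrib power_divide)
    also have "\<dots> \<le> 1 * ((2 powr (- (1 + c) * real r / 2))\<^sup>2 * phivar r y z)"
      by (rule mult_right_mono) (use Zn_bounds(1)[OF c, of n] in \<open>auto simp: phivar_nonneg\<close>)
    also have "(2 powr (- (1 + c) * real r / 2))\<^sup>2 = 2 powr (- (1 + c) * real r / 2 + - (1 + c) * real r / 2)"
      by (simp only: power2_eq_square powr_add)
    also have "\<dots> = 2 powr (- (1 + c) * real r)"
      by (simp only: field_sum_of_halves)
    also have "1 * (2 powr (- (1 + c) * real r) * phivar r y z)
        \<le> 2 powr (- (1 + c) * real k) * (if k < r then (1/2) ^ r else 0)"
    proof (cases "k < r")
      case True
      have "2 powr (- (1 + c) * real r) \<le> 2 powr (- (1 + c) * real k)"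
        using c True by (intro powr_mono) (auto simp: mult_left_mono)
      moreover have "phivar r y z \<le> (1/2) ^ r"
        using yz by (simp add: phivar_def powr_minus powr_realpow power_one_over inverse_eq_divide)
      ultimately show ?thesis using True by (simp add: mult_mono phivar_nonneg)
    next
      case False
      then show ?thesis using kd yz by (simp add: phivar_def)
    qed
    finally show "(hcoef n c r y z)\<^sup>2 \<le> 2 powr (- (1 + c) * real k) * (if k < r then (1/2) ^ r else 0)" .
  qed
  also have "\<dots> \<le> 2 powr (- (1 + c) * real k) * (1/2) ^ k"
    unfolding sum_distrib_left[symmetric] sum_geometric_half_tail by (intro mult_left_mono) auto
  also have "\<dots> = 2 powr (- (1 + c) * real k) * 2 powr (- real k)"
    by (simp add: powr_minus powr_realpow power_one_over inverse_eq_divide)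
  also have "\<dots> = 2 powr (- (1 + c) * real k + - real k)"
    by (simp only: powr_add)
  also have "- (1 + c) * real k + - real k = - (2 + c) * real k"
    by (simp add: algebra_simps)
  finally show ?thesis .
qed

lemma finite_gidx: "finite (gidx n)"
  by (rule finite_subset[of _ "{..n} \<times> Bn n \<times> Bn n"]) (auto simp: gidx_def)

lemma gidx_pair: "r \<le> n \<Longrightarrow> x \<in> Bn n \<Longrightarrow> y \<in> Bn n \<Longrightarrow> (r, min x y, max x y) \<in> gidx n"
  by (auto simp: gidx_def min_def max_def)

lemma prob_space_ens_space: "prob_space (ens_space n)"
  unfolding ens_space_def by (intro prob_space_PiM prob_space_std_gauss)

lemma borel_measurable_Hn:
  assumes "x \<in> Bn n" "y \<in> Bn n"
  shows "(\<lambda>\<omega>. Hn n c \<omega> x y) \<in> borel_measurable (ens_space n)"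
  unfolding Hn_eq
proof (intro borel_measurable_sum borel_measurable_times borel_measurable_const)
  fix r assume "r \<in> {..n}"
  then have "(\<lambda>\<omega>. \<omega> (r, min x y, max x y)) \<in> measurable (ens_space n) std_gauss"
    unfolding ens_space_def by (intro measurable_component_singleton gidx_pair assms) auto
  then show "(\<lambda>\<omega>. \<omega> (r, min x y, max x y)) \<in> borel_measurable (ens_space n)"
    by (simp cong: measurable_cong_sets)
qed

lemma Hn_commute: "Hn n c \<omega> x y = Hn n c \<omega> y x"
  by (simp add: Hn_eq hcoef_def phivar_commute[of _ x y] min.commute[of x y] max.commute[of x y])

lemma symm_on_Hn: "symm_on S (Hn n c \<omega>)"
  by (simp add: symm_on_def Hn_commute)

text \<open>Puts a redrawn level-0 variable into the rank-one form of the Wegner estimate; the base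
  value 0 makes the perturbation linear in \<open>t\<close>.\<close>

lemma Hn_update_diag:
  "Hn n c (\<omega> ((0, y, y) := t)) u v
    = Hn n c (\<omega> ((0, y, y) := 0)) u v + (if u = y \<and> v = y then hcoef n c 0 y y * t else 0)"
proof -
  have "Hn n c (\<omega> ((0, y, y) := t)) u v = (\<Sum>r\<le>n. hcoef n c r u v * (\<omega> ((0, y, y) := 0)) (r, min u v, max u v)
      + (if r = 0 then (if u = y \<and> v = y then hcoef n c 0 y y * t else 0) else 0))"
    unfolding Hn_eq by (intro sum.cong refl) (auto simp: min_def max_def)
  then show ?thesis by (simp add: sum.distrib Hn_eq)
qed

lemma Hn_update_outside:
  assumes "\<not> (a \<in> X \<and> b \<in> X)" "u \<in> X" "v \<in> X"
  shows "Hn n c (\<omega> ((r, a, b) := t)) u v = Hn n c \<omega> u v"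
  unfolding Hn_eq by (intro sum.cong refl) (use assms in \<open>auto simp: min_def max_def\<close>)

text \<open>Independence of the blocks from each other and from the coupling is used in this form: a
  Gaussian with an endpoint outside \<open>X\<close> can be redrawn without effect on
  \<open>X\<close>.\<close>

lemma fcalc_update_outside:
  assumes "\<not> (a \<in> X \<and> b \<in> X)"
  shows "fcalc X (Hn n c (\<omega> ((r, a, b) := t))) = fcalc X (Hn n c \<omega>)"
  by (rule fcalc_cong) (rule Hn_update_outside[OF assms])

lemma borel_measurable_fcalc_Hn:
  assumes "X \<subseteq> Bn n" "continuous_on UNIV f" "x \<in> X" "y \<in> X"
  shows "(\<lambda>\<omega>. fcalc X (Hn n c \<omega>) f x y) \<in> borel_measurable (ens_space n)"
  by (rule borel_measurable_fcalc)
     (use assms in \<open>auto intro!: symm_on_Hn borel_measurable_Hn intro: finite_subset\<close>)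

lemma borel_measurable_fcalc_resampled:
  assumes "X \<subseteq> Bn n" "continuous_on UNIV f" "y \<in> X" "u \<in> X" "v \<in> X"
  shows "(\<lambda>t. fcalc X (Hn n c (\<omega> ((0, y, y) := t))) f u v) \<in> borel_measurable std_gauss"
proof (rule borel_measurable_fcalc)
  fix a b
  show "(\<lambda>t. Hn n c (\<omega> ((0, y, y) := t)) a b) \<in> borel_measurable std_gauss"
    by (subst Hn_update_diag) (auto cong: measurable_cong_sets)
qed (use assms in \<open>auto intro!: symm_on_Hn intro: finite_subset\<close>)

text \<open>Uniformity in the remaining coordinates is what lets the bounds at sites of two disjoint
  blocks be multiplied.\<close>

definition averaged :: "nat \<Rightarrow> real \<Rightarrow> (real \<Rightarrow> real) \<Rightarrow> real \<Rightarrow> bool" where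
  "averaged n c f K \<longleftrightarrow> continuous_on UNIV f \<and> (\<forall>u. 0 \<le> f u) \<and> 0 \<le> K \<and>
    (\<forall>X y \<omega>. X \<subseteq> Bn n \<longrightarrow> y \<in> X \<longrightarrow>
      (\<integral>\<^sup>+t. ennreal (fcalc X (Hn n c (\<omega> ((0, y, y) := t))) f y y) \<partial>std_gauss) \<le> ennreal K)"

lemma averaged_lorentz:
  assumes c: "c > 0" and \<epsilon>: "\<epsilon> > 0"
  shows "averaged n c (lorentz \<epsilon> E) (2 * pi * \<epsilon>)"
  unfolding averaged_def
proof (intro conjI allI impI)
  fix X y \<omega> assume X: "X \<subseteq> Bn n" "y \<in> X"
  let ?s = "hcoef n c 0 y y"
  have s: "1/2 \<le> ?s" by (rule hcoef_diag_ge[OF c])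
  have "(\<integral>\<^sup>+t. ennreal (fcalc X (Hn n c (\<omega> ((0, y, y) := t))) (lorentz \<epsilon> E) y y) \<partial>std_gauss)
      = (\<integral>\<^sup>+t. ennreal (fcalc X (\<lambda>u v. Hn n c (\<omega> ((0, y, y) := 0)) u v + (if u = y \<and> v = y then ?s * t else 0)) (lorentz \<epsilon> E) y y) \<partial>std_gauss)"
    by (intro nn_integral_cong arg_cong[where f = "\<lambda>F. ennreal (F (lorentz \<epsilon> E) y y)"] fcalc_cong Hn_update_diag)
  also have "\<dots> \<le> ennreal (pi * \<epsilon> / ?s)"
    by (rule wegner_estimate) (use X s \<epsilon> symm_on_Hn finite_subset[OF X(1)] in auto)
  also have "\<dots> \<le> ennreal (2 * pi * \<epsilon>)"
  proof (rule ennreal_leI)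
    have "pi * \<epsilon> / ?s \<le> pi * \<epsilon> / (1/2)"
      using s \<epsilon> by (intro divide_left_mono) auto
    then show "pi * \<epsilon> / ?s \<le> 2 * pi * \<epsilon>" by simp
  qed
  finally show "(\<integral>\<^sup>+t. ennreal (fcalc X (Hn n c (\<omega> ((0, y, y) := t))) (lorentz \<epsilon> E) y y) \<partial>std_gauss) \<le> ennreal (2 * pi * \<epsilon>)" .
qed (use \<epsilon> in \<open>auto simp: lorentz_nonneg continuous_on_lorentz\<close>)

lemma averaged_const: "0 \<le> K \<Longrightarrow> averaged n c (\<lambda>_. K) K"
  unfolding averaged_def
proof (intro conjI allI impI)
  fix X y and \<omega> :: "nat \<times> nat \<times> nat \<Rightarrow> real" assume X: "X \<subseteq> Bn n" "y \<in> X"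
  then have "fcalc X (Hn n c (\<omega> ((0, y, y) := t))) (\<lambda>_. K) y y = K" for t
    using fcalc_const[OF finite_subset[OF X(1) finite_Bn] symm_on_Hn X(2,2)] by simp
  then show "(\<integral>\<^sup>+t. ennreal (fcalc X (Hn n c (\<omega> ((0, y, y) := t))) (\<lambda>_. K) y y) \<partial>std_gauss) \<le> ennreal K"
    using prob_space.emeasure_space_1[OF prob_space_std_gauss] by simp
qed auto

lemma averaged_add:
  assumes f: "averaged n c f K" and g: "averaged n c g L"
  shows "averaged n c (\<lambda>u. f u + g u) (K + L)"
  unfolding averaged_def
proof (intro conjI allI impI)
  fix X y \<omega> assume X: "X \<subseteq> Bn n" "y \<in> X"
  have "(\<integral>\<^sup>+t. ennreal (fcalc X (Hn n c (\<omega> ((0, y, y) := t))) (\<lambda>u. f u + g u) y y) \<partial>std_gauss)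
      = (\<integral>\<^sup>+t. ennreal (fcalc X (Hn n c (\<omega> ((0, y, y) := t))) f y y) + ennreal (fcalc X (Hn n c (\<omega> ((0, y, y) := t))) g y y) \<partial>std_gauss)"
    unfolding fcalc_add by (intro nn_integral_cong ennreal_plus fcalc_diag_nonneg) (use f g in \<open>auto simp: averaged_def\<close>)
  also have "\<dots> = (\<integral>\<^sup>+t. ennreal (fcalc X (Hn n c (\<omega> ((0, y, y) := t))) f y y) \<partial>std_gauss)
      + (\<integral>\<^sup>+t. ennreal (fcalc X (Hn n c (\<omega> ((0, y, y) := t))) g y y) \<partial>std_gauss)"
    by (intro nn_integral_add measurable_compose[OF _ measurable_ennreal] borel_measurable_fcalc_resampled)
       (use X f g in \<open>auto simp: averaged_def\<close>)
  also have "\<dots> \<le> ennreal K + ennreal L"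
    by (intro add_mono) (use X f g in \<open>auto simp: averaged_def\<close>)
  finally show "(\<integral>\<^sup>+t. ennreal (fcalc X (Hn n c (\<omega> ((0, y, y) := t))) (\<lambda>u. f u + g u) y y) \<partial>std_gauss) \<le> ennreal (K + L)"
    using f g by (simp add: averaged_def)
qed (use f g in \<open>auto simp: averaged_def intro: continuous_intros\<close>)

lemma averaged_cmult:
  assumes f: "averaged n c f K" and a: "0 \<le> a"
  shows "averaged n c (\<lambda>u. a * f u) (a * K)"
  unfolding averaged_def
proof (intro conjI allI impI)
  fix X y \<omega> assume X: "X \<subseteq> Bn n" "y \<in> X"
  have "(\<integral>\<^sup>+t. ennreal (fcalc X (Hn n c (\<omega> ((0, y, y) := t))) (\<lambda>u. a * f u) y y) \<partial>std_gauss)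
      = (\<integral>\<^sup>+t. ennreal a * ennreal (fcalc X (Hn n c (\<omega> ((0, y, y) := t))) f y y) \<partial>std_gauss)"
    unfolding fcalc_cmult using a by (simp add: ennreal_mult')
  also have "\<dots> = ennreal a * (\<integral>\<^sup>+t. ennreal (fcalc X (Hn n c (\<omega> ((0, y, y) := t))) f y y) \<partial>std_gauss)"
    by (intro nn_integral_cmult measurable_compose[OF _ measurable_ennreal] borel_measurable_fcalc_resampled)
       (use X f in \<open>auto simp: averaged_def\<close>)
  also have "\<dots> \<le> ennreal a * ennreal K"
    by (intro mult_left_mono) (use X f in \<open>auto simp: averaged_def\<close>)
  finally show "(\<integral>\<^sup>+t. ennreal (fcalc X (Hn n c (\<omega> ((0, y, y) := t))) (\<lambda>u. a * f u) y y) \<partial>std_gauss) \<le> ennreal (a * K)"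
    using a f by (simp add: averaged_def ennreal_mult')
qed (use f a in \<open>auto simp: averaged_def intro: continuous_intros\<close>)

lemma averaged_sum:
  "finite J \<Longrightarrow> (\<And>j. j \<in> J \<Longrightarrow> averaged n c (f j) (K j)) \<Longrightarrow> averaged n c (\<lambda>u. \<Sum>j\<in>J. f j u) (\<Sum>j\<in>J. K j)"
  by (induction J rule: finite_induct) (auto intro: averaged_const[of 0, simplified] averaged_add)

lemma nn_integral_averaged:
  assumes f: "averaged n c f K" and X: "X \<subseteq> Bn n" "y \<in> X"
  shows "(\<integral>\<^sup>+\<omega>. ennreal (fcalc X (Hn n c \<omega>) f y y) \<partial>ens_space n) \<le> ennreal K"
proof -
  have i: "(0, y, y) \<in> gidx n" using gidx_pair[of 0 n y y] X by auto
  have "(\<integral>\<^sup>+\<omega>. ennreal (fcalc X (Hn n c \<omega>) f y y) \<partial>ens_space n) \<le> (\<integral>\<^sup>+\<omega>. ennreal K \<partial>ens_space n)"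
    unfolding ens_space_def
    by (rule nn_integral_resample_le[OF finite_gidx i])
       (use f X borel_measurable_fcalc_Hn[OF X(1), of f y y c] in \<open>auto simp: averaged_def ens_space_def\<close>)
  then show ?thesis
    using prob_space.emeasure_space_1[OF prob_space_ens_space] by simp
qed

text \<open>Redrawing the diagonal variable at \<open>y\<close> leaves the \<open>Y\<close> factor
  fixed, and the inner integral is at most \<open>K\<close> for every value of the other
  coordinates; the \<open>Y\<close> factor is averaged afterwards.\<close>

lemma nn_integral_averaged_pair:
  assumes f: "averaged n c f K" and g: "averaged n c g L"
    and X: "X \<subseteq> Bn n" "y \<in> X" and Y: "Y \<subseteq> Bn n" "z \<in> Y" and disj: "X \<inter> Y = {}"
  shows "(\<integral>\<^sup>+\<omega>. ennreal (fcalc X (Hn n c \<omega>) f y y * fcalc Y (Hn n c \<omega>) g z z) \<partial>ens_space n) \<le> ennreal (K * L)"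
proof -
  have i: "(0, y, y) \<in> gidx n" using gidx_pair[of 0 n y y] X by auto
  have y: "\<not> (y \<in> Y \<and> y \<in> Y)" using X disj by auto
  have cf: "continuous_on UNIV f" "continuous_on UNIV g" and nn: "\<And>u. 0 \<le> f u" "\<And>u. 0 \<le> g u" and KL: "0 \<le> K" "0 \<le> L"
    using f g by (auto simp: averaged_def)
  have mf: "(\<lambda>\<omega>. fcalc X (Hn n c \<omega>) f y y) \<in> borel_measurable (ens_space n)"
    by (rule borel_measurable_fcalc_Hn[OF X(1) cf(1) X(2,2)])
  have mg: "(\<lambda>\<omega>. fcalc Y (Hn n c \<omega>) g z z) \<in> borel_measurable (ens_space n)"
    by (rule borel_measurable_fcalc_Hn[OF Y(1) cf(2) Y(2,2)])
  have "(\<integral>\<^sup>+\<omega>. ennreal (fcalc X (Hn n c \<omega>) f y y * fcalc Y (Hn n c \<omega>) g z z) \<partial>ens_space n)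
      \<le> (\<integral>\<^sup>+\<omega>. ennreal K * ennreal (fcalc Y (Hn n c \<omega>) g z z) \<partial>ens_space n)"
    unfolding ens_space_def
  proof (rule nn_integral_resample_le[OF finite_gidx i])
    show "(\<lambda>\<omega>. ennreal (fcalc X (Hn n c \<omega>) f y y * fcalc Y (Hn n c \<omega>) g z z)) \<in> borel_measurable (PiM (gidx n) (\<lambda>_. std_gauss))"
      using mf mg unfolding ens_space_def by measurable
  next
    fix \<omega>
    have "(\<integral>\<^sup>+t. ennreal (fcalc X (Hn n c (\<omega> ((0, y, y) := t))) f y y * fcalc Y (Hn n c (\<omega> ((0, y, y) := t))) g z z) \<partial>std_gauss)
        = (\<integral>\<^sup>+t. ennreal (fcalc X (Hn n c (\<omega> ((0, y, y) := t))) f y y) * ennreal (fcalc Y (Hn n c \<omega>) g z z) \<partial>std_gauss)"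
      unfolding fcalc_update_outside[OF y]
      by (intro nn_integral_cong ennreal_mult fcalc_diag_nonneg nn)
    also have "\<dots> = (\<integral>\<^sup>+t. ennreal (fcalc X (Hn n c (\<omega> ((0, y, y) := t))) f y y) \<partial>std_gauss) * ennreal (fcalc Y (Hn n c \<omega>) g z z)"
      by (intro nn_integral_multc measurable_compose[OF _ measurable_ennreal] borel_measurable_fcalc_resampled X cf)
    also have "\<dots> \<le> ennreal K * ennreal (fcalc Y (Hn n c \<omega>) g z z)"
      by (intro mult_right_mono) (use X f in \<open>auto simp: averaged_def\<close>)
    finally show "(\<integral>\<^sup>+t. ennreal (fcalc X (Hn n c (\<omega> ((0, y, y) := t))) f y y * fcalc Y (Hn n c (\<omega> ((0, y, y) := t))) g z z) \<partial>std_gauss)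
        \<le> ennreal K * ennreal (fcalc Y (Hn n c \<omega>) g z z)" .
  qed
  also have "\<dots> = ennreal K * (\<integral>\<^sup>+\<omega>. ennreal (fcalc Y (Hn n c \<omega>) g z z) \<partial>ens_space n)"
    by (intro nn_integral_cmult measurable_compose[OF mg measurable_ennreal])
  also have "\<dots> \<le> ennreal K * ennreal L"
    by (intro mult_left_mono nn_integral_averaged[OF g Y]) simp
  finally show ?thesis using KL by (simp add: ennreal_mult')
qed

section \<open>The weighted coupling as a Gaussian quadratic form\<close>

text \<open>The product kernel is the tensor product of two functions of matrices, diagonal in
  products of eigenvectors. The identity serves twice: it shows positivity of the kernel and turns
  the weighted coupling into a Gaussian form.\<close>

lemma fcalc_tensor_square:
  fixes \<xi> :: "'c \<Rightarrow> real" and X :: "'a set" and Y :: "'b set" and row :: "'c \<Rightarrow> 'a" and col :: "'c \<Rightarrow> 'b"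
  shows
  "(\<Sum>f\<in>F. \<Sum>g\<in>F. \<xi> f * \<xi> g * (fcalc X h p (row f) (row g) * fcalc Y h' q (col f) (col g)))
    = (\<Sum>b\<in>X. \<Sum>d\<in>Y. p (snd (eigbas X h) b) * q (snd (eigbas Y h') d) *
        (\<Sum>f\<in>F. \<xi> f * fst (eigbas X h) b (row f) * fst (eigbas Y h') d (col f))\<^sup>2)"
proof -
  define \<phi> where "\<phi> = fst (eigbas X h)"
  define \<phi>' where "\<phi>' = fst (eigbas Y h')"
  define P where "P b = p (snd (eigbas X h) b)" for b
  define Q where "Q d = q (snd (eigbas Y h') d)" for d
  define A where "A f b d = \<xi> f * \<phi> b (row f) * \<phi>' d (col f)" for f b d
  have cart: "(\<Sum>f\<in>F. \<Sum>g\<in>F. G f g) = (\<Sum>r\<in>F \<times> F. G (fst r) (snd r))" for G :: "'c \<Rightarrow> 'c \<Rightarrow> real"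
    by (simp add: sum.cartesian_product case_prod_beta')
  have cart': "(\<Sum>b\<in>X. \<Sum>d\<in>Y. G b d) = (\<Sum>r\<in>X \<times> Y. G (fst r) (snd r))" for G :: "'a \<Rightarrow> 'b \<Rightarrow> real"
    by (simp add: sum.cartesian_product case_prod_beta')
  have "(\<Sum>f\<in>F. \<Sum>g\<in>F. \<xi> f * \<xi> g * (fcalc X h p (row f) (row g) * fcalc Y h' q (col f) (col g)))
      = (\<Sum>f\<in>F. \<Sum>g\<in>F. \<Sum>b\<in>X. \<Sum>d\<in>Y. P b * Q d * (A f b d * A g b d))"
  proof (rule sum.cong[OF refl], rule sum.cong[OF refl])
    fix f g
    have "fcalc X h p (row f) (row g) * fcalc Y h' q (col f) (col g)
        = (\<Sum>b\<in>X. \<Sum>d\<in>Y. (P b * (\<phi> b (row f) * \<phi> b (row g))) * (Q d * (\<phi>' d (col f) * \<phi>' d (col g))))"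
      unfolding fcalc_def \<phi>_def[symmetric] \<phi>'_def[symmetric] P_def[symmetric] Q_def[symmetric] by (rule sum_product)
    then show "\<xi> f * \<xi> g * (fcalc X h p (row f) (row g) * fcalc Y h' q (col f) (col g))
        = (\<Sum>b\<in>X. \<Sum>d\<in>Y. P b * Q d * (A f b d * A g b d))"
      by (simp add: A_def sum_distrib_left mult_ac)
  qed
  also have "\<dots> = (\<Sum>b\<in>X. \<Sum>d\<in>Y. \<Sum>f\<in>F. \<Sum>g\<in>F. P b * Q d * (A f b d * A g b d))"
    unfolding cart cart' by (rule sum.swap)
  also have "\<dots> = (\<Sum>b\<in>X. \<Sum>d\<in>Y. P b * Q d * (\<Sum>f\<in>F. A f b d)\<^sup>2)"
    unfolding power2_eq_square[of "sum _ _"] sum_product by (simp add: sum_distrib_left)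
  finally show ?thesis by (simp add: A_def P_def Q_def \<phi>_def \<phi>'_def)
qed

text \<open>The quantity \<open>\<kappa>\<close> of the two-block estimate, with weight
  \<open>p\<close> and the chosen block eigenbases.\<close>

definition cross_weight :: "nat \<Rightarrow> real \<Rightarrow> (real \<Rightarrow> real) \<Rightarrow> nat set \<Rightarrow> nat set \<Rightarrow> (nat \<times> nat \<times> nat \<Rightarrow> real) \<Rightarrow> real" where
  "cross_weight n c p B D \<omega> = (let e = eigbas B (Hn n c \<omega>); e' = eigbas D (Hn n c \<omega>) in
    \<Sum>b\<in>B. \<Sum>d\<in>D. p (snd e b) * p (snd e' d) * (\<Sum>y\<in>B. \<Sum>z\<in>D. fst e b y * Hn n c \<omega> y z * fst e' d z)\<^sup>2)"

text \<open>Eigenvectors now occur only through entries of \<open>fcalc\<close>, which makes the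
  quantity measurable and its kernel independent of the coupling variables.\<close>

lemma cross_weight_gaussian_form:
  defines "\<iota> \<equiv> \<lambda>(r, y, z). (r :: nat, min y z, max y z :: nat)"
  shows "cross_weight n c p B D \<omega> = (\<Sum>f\<in>{..n} \<times> B \<times> D. \<Sum>g\<in>{..n} \<times> B \<times> D.
      (case f of (r, y, z) \<Rightarrow> hcoef n c r y z) * \<omega> (\<iota> f) * ((case g of (r, y, z) \<Rightarrow> hcoef n c r y z) * \<omega> (\<iota> g)) *
      (fcalc B (Hn n c \<omega>) p (fst (snd f)) (fst (snd g)) * fcalc D (Hn n c \<omega>) p (snd (snd f)) (snd (snd g))))"
proof -
  let ?\<xi> = "\<lambda>f. (case f of (r, y, z) \<Rightarrow> hcoef n c r y z) * \<omega> (\<iota> f)"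
  have "(\<Sum>f\<in>{..n} \<times> B \<times> D. ?\<xi> f * \<phi> (fst (snd f)) * \<phi>' (snd (snd f)))
      = (\<Sum>y\<in>B. \<Sum>z\<in>D. \<phi> y * Hn n c \<omega> y z * \<phi>' z)" for \<phi> \<phi>' :: "nat \<Rightarrow> real"
  proof -
    have "(\<Sum>f\<in>{..n} \<times> B \<times> D. ?\<xi> f * \<phi> (fst (snd f)) * \<phi>' (snd (snd f)))
        = (\<Sum>r\<le>n. \<Sum>q\<in>B \<times> D. hcoef n c r (fst q) (snd q) * \<omega> (r, min (fst q) (snd q), max (fst q) (snd q)) * \<phi> (fst q) * \<phi>' (snd q))"
      unfolding sum.cartesian_product by (intro sum.cong refl) (simp add: \<iota>_def case_prod_beta')
    also have "\<dots> = (\<Sum>(y, z)\<in>B \<times> D. \<Sum>r\<le>n. hcoef n c r y z * \<omega> (r, min y z, max y z) * \<phi> y * \<phi>' z)"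
      by (subst sum.swap) (simp add: case_prod_beta')
    also have "\<dots> = (\<Sum>y\<in>B. \<Sum>z\<in>D. \<phi> y * Hn n c \<omega> y z * \<phi>' z)"
      by (simp add: sum.cartesian_product[symmetric] Hn_eq sum_distrib_left sum_distrib_right mult_ac)
    finally show ?thesis .
  qed
  then show ?thesis
    unfolding cross_weight_def Let_def
    unfolding fcalc_tensor_square[where \<xi> = ?\<xi> and row = "\<lambda>f. fst (snd f)" and col = "\<lambda>f. snd (snd f)"] by simp
qed

lemma borel_measurable_cross_weight:
  assumes B: "B \<subseteq> Bn n" and D: "D \<subseteq> Bn n" and p: "continuous_on UNIV p"
  shows "cross_weight n c p B D \<in> borel_measurable (ens_space n)"
  unfolding cross_weight_gaussian_form[abs_def]
proof (intro borel_measurable_sum borel_measurable_times borel_measurable_const borel_measurable_fcalc_Hn p)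
  fix f assume f: "f \<in> {..n} \<times> B \<times> D"
  show "(\<lambda>\<omega>. \<omega> ((\<lambda>(r, y, z). (r, min y z, max y z)) f)) \<in> borel_measurable (ens_space n)"
  proof -
    have "(\<lambda>(r, y, z). (r, min y z, max y z)) f \<in> gidx n" using f B D by (auto intro!: gidx_pair)
    then have "(\<lambda>\<omega>. \<omega> ((\<lambda>(r, y, z). (r, min y z, max y z)) f)) \<in> measurable (ens_space n) std_gauss"
      unfolding ens_space_def by (rule measurable_component_singleton)
    then show ?thesis by (simp cong: measurable_cong_sets)
  qed
  then show "(\<lambda>\<omega>. \<omega> ((\<lambda>(r, y, z). (r, min y z, max y z)) f)) \<in> borel_measurable (ens_space n)" .
qed (use B D in auto)

text \<open>Gaussian integration leaves, for each pair of sites, the variance of the entry times two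
  diagonal entries in disjoint blocks, whose product averages to at most \<open>K * K\<close>. There
  are at most \<open>2^n * 2^n\<close> pairs.\<close>

lemma nn_integral_cross_weight:
  fixes c K :: real and n k x :: nat and p :: "real \<Rightarrow> real"
  assumes c: "c > 0" and p: "averaged n c p K"
  defines "B \<equiv> hball n (int k) x" and "D \<equiv> Bn n - hball n (int k) x"
  shows "(\<integral>\<^sup>+\<omega>. ennreal (cross_weight n c p B D \<omega>) \<partial>ens_space n)
    \<le> ennreal (2 powr (- (2 + c) * real k) * (2 ^ n * K)\<^sup>2)"
proof -
  define F where "F = {..n} \<times> B \<times> D"
  define \<iota> where "\<iota> = (\<lambda>(r :: nat, y, z :: nat). (r, min y z, max y z))"
  define s where "s = (\<lambda>(r, y, z). hcoef n c r y z)"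
  define \<gamma> where "\<gamma> \<omega> f g = fcalc B (Hn n c \<omega>) p (fst (snd f)) (fst (snd g)) * fcalc D (Hn n c \<omega>) p (snd (snd f)) (snd (snd g))"
    for \<omega> and f g :: "nat \<times> nat \<times> nat"
  have BD: "B \<subseteq> Bn n" "D \<subseteq> Bn n" "B \<inter> D = {}" by (auto simp: B_def D_def hball_def)
  then have fin: "finite B" "finite D" by (auto intro: finite_subset)
  have pc: "continuous_on UNIV p" and p0: "\<And>u. 0 \<le> p u" and K: "0 \<le> K" using p by (auto simp: averaged_def)
  have "(\<integral>\<^sup>+\<omega>. ennreal (cross_weight n c p B D \<omega>) \<partial>ens_space n)
      = (\<integral>\<^sup>+\<omega>. ennreal (\<Sum>f\<in>F. \<Sum>g\<in>F. s f * \<omega> (\<iota> f) * (s g * \<omega> (\<iota> g)) * \<gamma> \<omega> f g) \<partial>ens_space n)"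
    unfolding cross_weight_gaussian_form F_def s_def \<iota>_def \<gamma>_def ..
  also have "\<dots> = (\<integral>\<^sup>+\<omega>. ennreal (\<Sum>f\<in>F. (s f)\<^sup>2 * \<gamma> \<omega> f f) \<partial>ens_space n)"
    unfolding ens_space_def
  proof (rule gaussian_quadratic_form[OF finite_gidx])
    show "finite F" using fin by (simp add: F_def)
    show "\<iota> ` F \<subseteq> gidx n" using BD by (auto simp: \<iota>_def F_def intro!: gidx_pair)
    show "inj_on \<iota> F"
    proof (rule inj_onI)
      fix f g assume fg: "f \<in> F" "g \<in> F" "\<iota> f = \<iota> g"
      obtain r y z r' y' z' where eq: "f = (r, y, z)" "g = (r', y', z')" by (metis prod.exhaust)
      \<comment> \<open>First sites lie in \<open>B\<close> and second ones in \<open>D\<close>, so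
        an unordered pair determines its order.\<close>
      have "y \<noteq> z'" "y' \<noteq> z" using fg eq BD(3) by (auto simp: F_def)
      then show "f = g" using fg(3) by (auto simp: eq \<iota>_def min_def max_def split: if_splits)
    qed
    show "0 \<le> (\<Sum>f\<in>G. \<Sum>g\<in>G. \<xi> f * \<xi> g * \<gamma> \<omega> f g)" for \<omega> G \<xi>
      unfolding \<gamma>_def fcalc_tensor_square[where \<xi> = \<xi> and row = "\<lambda>f. fst (snd f)" and col = "\<lambda>f. snd (snd f)"]
      by (intro sum_nonneg mult_nonneg_nonneg p0 zero_le_power2)
    show "\<gamma> \<omega> f g = \<gamma> \<omega> g f" for \<omega> f g
      unfolding \<gamma>_def by (intro arg_cong2[where f = "(*)"] fcalc_commute)
    show "(\<lambda>\<omega>. \<gamma> \<omega> f g) \<in> borel_measurable (PiM (gidx n) (\<lambda>_. std_gauss))" if "f \<in> F" "g \<in> F" for f g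
      unfolding \<gamma>_def ens_space_def[symmetric]
      by (intro borel_measurable_times borel_measurable_fcalc_Hn pc BD) (use that in \<open>auto simp: F_def\<close>)
    show "\<gamma> (\<omega> (\<iota> e := t)) f g = \<gamma> \<omega> f g" if e: "e \<in> F" for \<omega> e t f g
    proof -
      obtain r y z where eq: "e = (r, y, z)" by (metis prod.exhaust)
      have "\<not> (min y z \<in> B \<and> max y z \<in> B)" "\<not> (min y z \<in> D \<and> max y z \<in> D)"
        using e eq BD(3) by (auto simp: F_def min_def max_def split: if_splits)
      then show ?thesis
        unfolding \<gamma>_def \<iota>_def eq prod.case
        using fcalc_update_outside[of "min y z" B "max y z"] fcalc_update_outside[of "min y z" D "max y z"] by presburger
    qed
  qed
  also have "\<dots> = (\<Sum>f\<in>F. \<integral>\<^sup>+\<omega>. ennreal ((s f)\<^sup>2) * ennreal (\<gamma> \<omega> f f) \<partial>ens_space n)"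
  proof -
    have g0: "0 \<le> \<gamma> \<omega> f f" for \<omega> f
      unfolding \<gamma>_def by (intro mult_nonneg_nonneg fcalc_diag_nonneg p0)
    have "(\<integral>\<^sup>+\<omega>. ennreal (\<Sum>f\<in>F. (s f)\<^sup>2 * \<gamma> \<omega> f f) \<partial>ens_space n)
        = (\<integral>\<^sup>+\<omega>. (\<Sum>f\<in>F. ennreal ((s f)\<^sup>2) * ennreal (\<gamma> \<omega> f f)) \<partial>ens_space n)"
      using g0 by (intro nn_integral_cong) (simp add: ennreal_mult'[symmetric])
    also have "\<dots> = (\<Sum>f\<in>F. \<integral>\<^sup>+\<omega>. ennreal ((s f)\<^sup>2) * ennreal (\<gamma> \<omega> f f) \<partial>ens_space n)"
      unfolding \<gamma>_def
      by (intro nn_integral_sum borel_measurable_times_ennreal borel_measurable_const measurable_compose[OF _ measurable_ennreal]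
          borel_measurable_times borel_measurable_fcalc_Hn pc BD) (auto simp: F_def)
    finally show ?thesis .
  qed
  also have "\<dots> \<le> (\<Sum>f\<in>F. ennreal ((s f)\<^sup>2) * ennreal (K * K))"
  proof (rule sum_mono)
    fix f assume f: "f \<in> F"
    then have m: "fst (snd f) \<in> B" "snd (snd f) \<in> D" by (auto simp: F_def)
    have "(\<integral>\<^sup>+\<omega>. ennreal ((s f)\<^sup>2) * ennreal (\<gamma> \<omega> f f) \<partial>ens_space n) = ennreal ((s f)\<^sup>2) * (\<integral>\<^sup>+\<omega>. ennreal (\<gamma> \<omega> f f) \<partial>ens_space n)"
      unfolding \<gamma>_def
      by (intro nn_integral_cmult measurable_compose[OF _ measurable_ennreal] borel_measurable_times
          borel_measurable_fcalc_Hn pc BD m)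
    also have "\<dots> \<le> ennreal ((s f)\<^sup>2) * ennreal (K * K)"
      unfolding \<gamma>_def
      by (intro mult_left_mono nn_integral_averaged_pair[OF p p BD(1) m(1) BD(2) m(2) BD(3)]) simp
    finally show "(\<integral>\<^sup>+\<omega>. ennreal ((s f)\<^sup>2) * ennreal (\<gamma> \<omega> f f) \<partial>ens_space n) \<le> ennreal ((s f)\<^sup>2) * ennreal (K * K)" .
  qed
  also have "\<dots> = ennreal ((\<Sum>f\<in>F. (s f)\<^sup>2) * (K * K))"
    using K by (simp add: ennreal_mult'[symmetric] sum_distrib_right mult.assoc)
  also have "\<dots> \<le> ennreal (2 powr (- (2 + c) * real k) * (2 ^ n * K)\<^sup>2)"
  proof (rule ennreal_leI)
    have "(\<Sum>f\<in>F. (s f)\<^sup>2) = (\<Sum>(y, z)\<in>B \<times> D. \<Sum>r\<le>n. (hcoef n c r y z)\<^sup>2)"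
    proof -
      have "(\<Sum>f\<in>F. (s f)\<^sup>2) = (\<Sum>r\<le>n. \<Sum>q\<in>B \<times> D. (hcoef n c r (fst q) (snd q))\<^sup>2)"
        unfolding F_def s_def sum.cartesian_product by (intro sum.cong refl) (simp add: case_prod_beta')
      then show ?thesis by (subst (asm) sum.swap) (simp add: case_prod_beta')
    qed
    also have "\<dots> \<le> (\<Sum>(y, z)\<in>B \<times> D. 2 powr (- (2 + c) * real k))"
      by (rule sum_mono) (use sum_hcoef_square_across_block[OF c] in \<open>auto simp: B_def D_def\<close>)
    also have "\<dots> = real (card B) * real (card D) * 2 powr (- (2 + c) * real k)"
      by (simp add: card_cartesian_product)
    also have "\<dots> \<le> 2 ^ n * 2 ^ n * 2 powr (- (2 + c) * real k)"
    proof -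
      have "real (card B) \<le> 2 ^ n" "real (card D) \<le> 2 ^ n"
        by (intro real_card_le BD)+
      then show ?thesis by (intro mult_right_mono mult_mono) auto
    qed
    finally have "(\<Sum>f\<in>F. (s f)\<^sup>2) * (K * K) \<le> 2 ^ n * 2 ^ n * 2 powr (- (2 + c) * real k) * (K * K)"
      by (rule mult_right_mono) simp
    then show "(\<Sum>f\<in>F. (s f)\<^sup>2) * (K * K) \<le> 2 powr (- (2 + c) * real k) * (2 ^ n * K)\<^sup>2"
      by (simp add: power2_eq_square mult_ac)
  qed
  finally show ?thesis .
qed

text \<open>A regularisation of \<open>2 / \<bar>u - E\<bar>\<close> at scale \<open>2^-n\<close>, built from Lorentzians because these are the
  functions the Wegner estimate controls.\<close>

definition tau :: "nat \<Rightarrow> real \<Rightarrow> real \<Rightarrow> real" where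
  "tau n E u = 2 + (\<Sum>j\<le>n. 2 ^ (j + 3) * lorentz (1 / 2 ^ j) E u)"

text \<open>The height \<open>2 ^ (j + 3)\<close> offsets the width \<open>1 / 2 ^ j\<close>, so
  each of the \<open>n + 1\<close> dyadic scales contributes \<open>16 * pi\<close>: the logarithmic
  divergence of the integral of \<open>1 / \<bar>u\<bar>\<close>.\<close>

lemma averaged_tau:
  assumes c: "c > 0"
  shows "averaged n c (tau n E) (2 + 16 * pi * (real n + 1))"
proof -
  have "averaged n c (\<lambda>u. 2 + (\<Sum>j\<le>n. 2 ^ (j + 3) * lorentz (1 / 2 ^ j) E u)) (2 + (\<Sum>j\<le>n. 2 ^ (j + 3) * (2 * pi * (1 / 2 ^ j))))"
    by (intro averaged_add averaged_const averaged_sum averaged_cmult averaged_lorentz c) auto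
  moreover have "(\<Sum>j\<le>n. 2 ^ (j + 3) * (2 * pi * (1 / 2 ^ j))) = 16 * pi * (real n + 1)"
    by (simp add: power_add field_simps)
  ultimately show ?thesis by (simp only: tau_def[abs_def])
qed

lemma tau_ge_2: "2 \<le> tau n E u"
  by (simp add: tau_def sum_nonneg lorentz_nonneg)

lemma tau_ge_dyadic:
  assumes "j \<le> n" "\<bar>u - E\<bar> \<le> 1 / 2 ^ j"
  shows "2 ^ (j + 2) \<le> tau n E u"
proof -
  have "(2::real) ^ (j + 2) \<le> 2 ^ (j + 3) * lorentz (1 / 2 ^ j) E u"
    using lorentz_ge_half[of "1 / 2 ^ j" u E] assms(2) by (simp add: power_add)
  also have "\<dots> \<le> (\<Sum>j\<le>n. 2 ^ (j + 3) * lorentz (1 / 2 ^ j) E u)"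
    by (rule member_le_sum) (use assms in \<open>auto simp: lorentz_nonneg\<close>)
  finally show ?thesis by (simp add: tau_def)
qed

text \<open>With \<open>j\<close> least such that \<open>1 / 2 ^ j \<le> t\<close>, the Lorentzian
  one scale coarser suffices; the constant 2 covers \<open>t \<ge> 1\<close>. The exponent
  \<open>j + 3\<close> in \<open>tau\<close> pays for three factors 2: the numerator, the Lorentzian
  value 1/2 and the rounding to a dyadic scale.\<close>

lemma tau_lower_bound:
  assumes "t > 0" "1 / 2 ^ n \<le> t" "\<bar>u - E\<bar> \<le> t"
  shows "2 / t \<le> tau n E u"
proof (cases "1 \<le> t")
  case True
  then have "2 / t \<le> 2" by (simp add: divide_le_eq)
  then show ?thesis using tau_ge_2[of n E u] by linarith
next
  case False
  define j where "j = (LEAST j. 1 / 2 ^ j \<le> t)"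
  have j: "1 / 2 ^ j \<le> t" unfolding j_def by (rule LeastI[of _ n]) (rule assms(2))
  have jn: "j \<le> n" unfolding j_def by (rule Least_le) (rule assms(2))
  have "j \<noteq> 0" using j False by (intro notI) simp
  then obtain i where i: "j = Suc i" by (metis not0_implies_Suc)
  have "\<not> 1 / 2 ^ i \<le> t" using not_less_Least[of i "\<lambda>j. 1 / 2 ^ j \<le> t"] i unfolding j_def[symmetric] by simp
  then have "\<bar>u - E\<bar> \<le> 1 / 2 ^ i" using assms(3) by linarith
  then have "2 ^ (i + 2) \<le> tau n E u" using i jn by (intro tau_ge_dyadic) auto
  moreover have "2 / t \<le> 2 ^ (i + 2)"
    using j assms(1) unfolding i by (simp add: field_simps)
  ultimately show ?thesis by linarith
qed

section \<open>Localization\<close>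

lemma nn_integral_sum_le:
  assumes "finite I" "\<And>i. i \<in> I \<Longrightarrow> f i \<in> borel_measurable M" "\<And>i \<omega>. i \<in> I \<Longrightarrow> 0 \<le> f i \<omega>"
    and "\<And>i. i \<in> I \<Longrightarrow> (\<integral>\<^sup>+\<omega>. ennreal (f i \<omega>) \<partial>M) \<le> ennreal (K i)" "\<And>i. i \<in> I \<Longrightarrow> 0 \<le> K i"
  shows "(\<integral>\<^sup>+\<omega>. ennreal (\<Sum>i\<in>I. f i \<omega>) \<partial>M) \<le> ennreal (\<Sum>i\<in>I. K i)"
proof -
  have "(\<integral>\<^sup>+\<omega>. ennreal (\<Sum>i\<in>I. f i \<omega>) \<partial>M) = (\<integral>\<^sup>+\<omega>. (\<Sum>i\<in>I. ennreal (f i \<omega>)) \<partial>M)"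
    using assms(3) by (intro nn_integral_cong) simp
  also have "\<dots> = (\<Sum>i\<in>I. \<integral>\<^sup>+\<omega>. ennreal (f i \<omega>) \<partial>M)"
    by (intro nn_integral_sum measurable_compose[OF _ measurable_ennreal] assms(2))
  also have "\<dots> \<le> (\<Sum>i\<in>I. ennreal (K i))"
    by (intro sum_mono assms(4))
  finally show ?thesis using assms(5) by simp
qed

lemma nn_integral_averaged_trace:
  assumes f: "averaged n c f K" and X: "X \<subseteq> Bn n"
  shows "(\<integral>\<^sup>+\<omega>. ennreal (\<Sum>y\<in>X. fcalc X (Hn n c \<omega>) f y y) \<partial>ens_space n) \<le> ennreal (2 ^ n * K)"
proof -
  have K: "0 \<le> K" "continuous_on UNIV f" "\<And>u. 0 \<le> f u" using f by (auto simp: averaged_def)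
  have "(\<integral>\<^sup>+\<omega>. ennreal (\<Sum>y\<in>X. fcalc X (Hn n c \<omega>) f y y) \<partial>ens_space n) \<le> ennreal (\<Sum>y\<in>X. K)"
    by (intro nn_integral_sum_le borel_measurable_fcalc_Hn fcalc_diag_nonneg nn_integral_averaged f X K finite_subset[OF X])
       auto
  also have "\<dots> \<le> ennreal (2 ^ n * K)"
    unfolding sum_constant by (intro ennreal_leI mult_right_mono real_card_le X K)
  finally show ?thesis .
qed

section \<open>Separation of the two block spectra\<close>

text \<open>A smoothed count of coincidences: on a grid of energies of spacing \<open>1 / L\<close>,
  the number of levels of \<open>B\<close> near the grid point times that of
  \<open>D\<close>.\<close>

definition pair_weight :: "nat \<Rightarrow> real \<Rightarrow> real \<Rightarrow> real \<Rightarrow> int \<Rightarrow> nat set \<Rightarrow> nat set \<Rightarrow> (nat \<times> nat \<times> nat \<Rightarrow> real) \<Rightarrow> real" where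
  "pair_weight n c E L J B D \<omega> = (\<Sum>j\<in>{-J..J}.
     (\<Sum>y\<in>B. fcalc B (Hn n c \<omega>) (lorentz (3 / L) (E + of_int j / L)) y y) *
     (\<Sum>z\<in>D. fcalc D (Hn n c \<omega>) (lorentz (3 / L) (E + of_int j / L)) z z))"

lemma borel_measurable_pair_weight:
  assumes "B \<subseteq> Bn n" "D \<subseteq> Bn n" "L > 0"
  shows "pair_weight n c E L J B D \<in> borel_measurable (ens_space n)"
  unfolding pair_weight_def[abs_def]
  by (intro borel_measurable_sum borel_measurable_times borel_measurable_fcalc_Hn continuous_on_lorentz)
     (use assms in auto)

lemma nn_integral_pair_weight:
  assumes c: "c > 0" and L: "L > 0" and BD: "B \<subseteq> Bn n" "D \<subseteq> Bn n" "B \<inter> D = {}"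
  shows "(\<integral>\<^sup>+\<omega>. ennreal (pair_weight n c E L J B D \<omega>) \<partial>ens_space n)
    \<le> ennreal (real (card {-J..J}) * (2 ^ n * (6 * pi / L))\<^sup>2)"
proof -
  let ?f = "\<lambda>j. lorentz (3 / L) (E + of_int j / L)"
  let ?K = "2 * pi * (3 / L)"
  have av: "averaged n c (?f j) ?K" for j :: int
    by (rule averaged_lorentz[OF c]) (use L in simp)
  have fin: "finite B" "finite D" using BD by (auto intro: finite_subset)
  have meas: "(\<lambda>\<omega>. fcalc B (Hn n c \<omega>) (?f j) y y * fcalc D (Hn n c \<omega>) (?f j) z z) \<in> borel_measurable (ens_space n)"
    if "y \<in> B" "z \<in> D" for j :: int and y z
    by (intro borel_measurable_times borel_measurable_fcalc_Hn continuous_on_lorentz BD that) (use L in auto)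
  have nn: "0 \<le> fcalc B (Hn n c \<omega>) (?f j) y y * fcalc D (Hn n c \<omega>) (?f j) z z" for j :: int and y z \<omega>
    by (intro mult_nonneg_nonneg fcalc_diag_nonneg lorentz_nonneg)
  have K0: "0 \<le> ?K" using L by simp
  have "(\<integral>\<^sup>+\<omega>. ennreal (pair_weight n c E L J B D \<omega>) \<partial>ens_space n) \<le> ennreal (\<Sum>j\<in>{-J..J}. \<Sum>y\<in>B. \<Sum>z\<in>D. ?K * ?K)"
    unfolding pair_weight_def sum_product
    by (intro nn_integral_sum_le finite_atLeastAtMost_int fin borel_measurable_sum sum_nonneg nn
        nn_integral_averaged_pair[OF av av BD(1) _ BD(2) _ BD(3)] meas mult_nonneg_nonneg K0)
  also have "\<dots> \<le> ennreal (real (card {-J..J}) * (2 ^ n * (6 * pi / L))\<^sup>2)"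
  proof (rule ennreal_leI)
    have "real (card B) \<le> 2 ^ n" "real (card D) \<le> 2 ^ n"
      by (intro real_card_le BD)+
    then have "real (card B) * (real (card D) * (?K * ?K)) \<le> 2 ^ n * (2 ^ n * (?K * ?K))"
      using L by (intro mult_mono) (auto intro: less_imp_le)
    then have "real (card {-J..J}) * (real (card B) * (real (card D) * (?K * ?K))) \<le> real (card {-J..J}) * (2 ^ n * (2 ^ n * (?K * ?K)))"
      by (intro mult_left_mono) auto
    moreover have "2 ^ n * (2 ^ n * (?K * ?K)) = (2 ^ n * (6 * pi / L))\<^sup>2"
      by (simp add: power2_eq_square)
    ultimately show "(\<Sum>j\<in>{-J..J}. \<Sum>y\<in>B. \<Sum>z\<in>D. ?K * ?K) \<le> real (card {-J..J}) * (2 ^ n * (6 * pi / L))\<^sup>2"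
      by (simp only: sum_constant)
  qed
  finally show ?thesis .
qed

text \<open>The floor picks a grid point within \<open>1 / L\<close> of the level of
  \<open>B\<close>; a level of \<open>D\<close> closer than \<open>2 / L\<close> to it is then
  within \<open>3 / L\<close>, the Lorentzian width. Both traces are at least 1/2 there, hence the
  threshold 1/4.\<close>

lemma eigenvalue_separation:
  fixes r L :: real
  defines "J \<equiv> \<lceil>2 * r * L\<rceil>"
  assumes L: "L > 0" and fin: "finite B" "finite D"
    and small: "pair_weight n c E L J B D \<omega> < 1/4"
    and b: "b \<in> B" "\<bar>snd (eigbas B (Hn n c \<omega>)) b - E\<bar> \<le> 2 * r" and d: "d \<in> D"
  shows "2 / L \<le> \<bar>snd (eigbas B (Hn n c \<omega>)) b - snd (eigbas D (Hn n c \<omega>)) d\<bar>"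
proof (rule ccontr)
  define l where "l = snd (eigbas B (Hn n c \<omega>)) b"
  define l' where "l' = snd (eigbas D (Hn n c \<omega>)) d"
  assume "\<not> 2 / L \<le> \<bar>snd (eigbas B (Hn n c \<omega>)) b - snd (eigbas D (Hn n c \<omega>)) d\<bar>"
  then have close: "\<bar>l - l'\<bar> < 2 / L" by (simp add: l_def l'_def)
  define j where "j = \<lfloor>(l - E) * L\<rfloor>"
  have "\<bar>(l - E) * L\<bar> \<le> 2 * r * L"
    using b(2) L by (simp add: abs_mult l_def)
  then have j: "j \<in> {-J..J}"
    unfolding j_def J_def by (simp add: abs_le_iff) linarith
  let ?E = "E + of_int j / L"
  have "of_int j \<le> (l - E) * L" "(l - E) * L \<le> of_int j + 1"
    unfolding j_def by linarith+
  then have "of_int j / L \<le> l - E" "l - E \<le> of_int j / L + 1 / L"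
    using L by (simp_all add: field_simps)
  then have "\<bar>l - ?E\<bar> \<le> 1 / L" by linarith
  moreover have "1 / L \<ge> 0" using L by simp
  ultimately have near: "\<bar>l - ?E\<bar> \<le> 3 / L" "\<bar>l' - ?E\<bar> \<le> 3 / L"
    using close by (simp_all add: add_divide_distrib[of 1 2 L, simplified]) 
  have half: "1/2 \<le> (\<Sum>y\<in>X. fcalc X (Hn n c \<omega>) (lorentz (3 / L) ?E) y y)"
    if X: "finite X" "k \<in> X" "\<bar>snd (eigbas X (Hn n c \<omega>)) k - ?E\<bar> \<le> 3 / L" for X k
  proof -
    have "1/2 \<le> lorentz (3 / L) ?E (snd (eigbas X (Hn n c \<omega>)) k)"
      by (rule lorentz_ge_half) (use L X in auto)
    also have "\<dots> \<le> (\<Sum>k\<in>X. lorentz (3 / L) ?E (snd (eigbas X (Hn n c \<omega>)) k))"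
      by (rule member_le_sum) (use X lorentz_nonneg in auto)
    finally show ?thesis using fcalc_trace[OF X(1) symm_on_Hn] by simp
  qed
  have nn: "0 \<le> (\<Sum>y\<in>X. fcalc X (Hn n c \<omega>) (lorentz (3 / L) e) y y)" for X e
    by (intro sum_nonneg fcalc_diag_nonneg lorentz_nonneg)
  have "1/4 = (1/2) * (1/2 :: real)" by simp
  also have "\<dots> \<le> (\<Sum>y\<in>B. fcalc B (Hn n c \<omega>) (lorentz (3 / L) ?E) y y) * (\<Sum>z\<in>D. fcalc D (Hn n c \<omega>) (lorentz (3 / L) ?E) z z)"
    by (intro mult_mono half[OF fin(1) b(1)] half[OF fin(2) d] nn) (use near in \<open>auto simp: l_def l'_def\<close>)
  also have "\<dots> \<le> pair_weight n c E L J B D \<omega>"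
    unfolding pair_weight_def
    by (rule member_le_sum[OF j, where f = "\<lambda>j. (\<Sum>y\<in>B. fcalc B (Hn n c \<omega>) (lorentz (3 / L) (E + of_int j / L)) y y) * (\<Sum>z\<in>D. fcalc D (Hn n c \<omega>) (lorentz (3 / L) (E + of_int j / L)) z z)"])
       (auto intro!: mult_nonneg_nonneg nn)
  finally show False using small by simp
qed

lemma is_eigbasis_eigen_on: "is_eigbasis n A psi lam \<longleftrightarrow> eigen_on (Bn n) (Bn n) A psi lam"
  by (simp add: is_eigbasis_def eigen_on_def orthonormal_on_def ip_def mv_def)

section \<open>Choice of scales and the good event\<close>

text \<open>Every loss is a fixed power of \<open>2^(\<theta> n)\<close>, while the gain is
  \<open>2^(c (1 - \<theta>) n)\<close>; \<open>100 * \<theta> \<le> c\<close> makes the gain win.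
  The assumption \<open>1 \<le> \<theta> * real n\<close> gives \<open>2 \<le> p \<theta>\<close>,
  which absorbs numerical constants.\<close>

locale scale_separation =
  fixes c E \<theta> :: real and n k x :: nat
  assumes c: "c > 0" and \<theta>: "0 < \<theta>" "\<theta> \<le> 1/100" "100 * \<theta> \<le> c"
    and n: "1 \<le> \<theta> * real n" and k: "(1 - \<theta>) * real n \<le> real k" and x: "x \<in> Bn n"
begin

definition "B = hball n (int k) x"
definition "D = Bn n - hball n (int k) x"

definition p :: "real \<Rightarrow> real" where "p s = 2 powr (s * real n)"

lemma p_simps: "p s * p t = p (s + t)" "sqrt (p s) = p (s / 2)" "0 < p s" "p 0 = 1" "2 ^ n = p 1" "(p s)\<^sup>2 = p (2 * s)"
    "p s / p t = p (s - t)"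
  by (simp_all add: p_def powr_add[symmetric] powr_half_sqrt[symmetric] powr_powr powr_realpow powr_diff[symmetric] algebra_simps
      power2_eq_square)

lemma p_mono: "s \<le> t \<Longrightarrow> p s \<le> p t"
  by (auto simp: p_def intro!: powr_mono mult_right_mono)

lemma p_\<theta>: "2 \<le> p \<theta>"
  using powr_mono[OF n, of 2] by (simp add: p_def)

definition "r = p (- (1 - \<theta>))"
text \<open>About \<open>r * L = p (4 * \<theta>)\<close> grid points, each with expected
  coincidence of order \<open>(2 ^ n / L)\<^sup>2 = p (- 6 * \<theta>)\<close>, leave probability
  \<open>p (- 2 * \<theta>)\<close>.\<close>

definition "L = p (1 + 3 * \<theta>)"
text \<open>On the near window \<open>tau\<close> is at least
  \<open>1 / r = p (1 - \<theta>)\<close>; the prefactor raises this exactly to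
  \<open>L\<close>.\<close>

definition "\<rho> u = p (4 * \<theta>) * tau n E u"
definition "J = \<lceil>2 * r * L\<rceil>"
definition "K = 2 + 16 * pi * (real n + 1)"

text \<open>The first four thresholds exceed the bounds for the means by
  \<open>p (2 * \<theta>)\<close>, up to powers of \<open>K\<close>; the mean of the last quantity
  is itself of order \<open>p (- 2 * \<theta>)\<close>.\<close>

definition "good = {\<omega> \<in> space (ens_space n).
    (\<Sum>y\<in>B. fcalc B (Hn n c \<omega>) (tau n E) y y) < p (1 + 2 * \<theta>) \<and>
    (\<Sum>z\<in>D. fcalc D (Hn n c \<omega>) (tau n E) z z) < p (1 + 2 * \<theta>) \<and>
    fcalc B (Hn n c \<omega>) (tau n E) x x < p (2 * \<theta>) \<and>
    cross_weight n c (tau n E) B D \<omega> < 2 powr (- (2 + c) * real k) * p (2 + 2 * \<theta>) \<and>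
    pair_weight n c E L J B D \<omega> < 1/4}"

lemma blocks: "B \<subseteq> Bn n" "D \<subseteq> Bn n" "B \<inter> D = {}" "Bn n = B \<union> D" "x \<in> B" "finite B" "finite D"
  using x by (auto simp: B_def D_def hball_def intro: finite_subset)

lemma cross_weight_scaled:
  "(\<Sum>b\<in>B. \<Sum>d\<in>D. \<rho> (snd (eigbas B (Hn n c \<omega>)) b) * \<rho> (snd (eigbas D (Hn n c \<omega>)) d) *
      (\<Sum>y\<in>B. \<Sum>z\<in>D. fst (eigbas B (Hn n c \<omega>)) b y * Hn n c \<omega> y z * fst (eigbas D (Hn n c \<omega>)) d z)\<^sup>2)
    = p (8 * \<theta>) * cross_weight n c (tau n E) B D \<omega>"
proof -
  have "p (8 * \<theta>) = p (4 * \<theta>) * p (4 * \<theta>)" by (simp add: p_simps)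
  then show ?thesis by (simp add: cross_weight_def Let_def \<rho>_def sum_distrib_left mult_ac)
qed

text \<open>The exponent of \<open>\<kappa>\<close> is
  \<open>12 * \<theta> - c * (1 - \<theta>)\<close>: \<open>8 * \<theta>\<close> from the two
  prefactors of \<open>\<rho>\<close>, \<open>2 * \<theta>\<close> from the threshold and
  \<open>2 * \<theta>\<close> from \<open>k\<close> being below \<open>n\<close>. Up to constants
  \<open>T / L\<^sup>2\<close> is \<open>p (- 1)\<close> and cancels the volume factor, so
  \<open>p (- 34 * \<theta>)\<close> remains from \<open>sqrt \<kappa>\<close> and the two
  \<open>p (3 * \<theta>)\<close>.\<close>

lemma good_correlator_bound:
  assumes \<omega>: "\<omega> \<in> good" and eig: "is_eigbasis n (Hn n c \<omega>) psi lam"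
  shows "(\<Sum>y\<in>D. Qcorr n psi lam x y {E - r .. E + r}) \<le> p (- \<theta>)"
proof -
  let ?h = "Hn n c \<omega>"
  let ?\<phi>1 = "fst (eigbas B ?h)" and ?l1 = "snd (eigbas B ?h)"
  let ?\<phi>2 = "fst (eigbas D ?h)" and ?l2 = "snd (eigbas D ?h)"
  have near: "L \<le> \<rho> t" if "\<bar>t - E\<bar> \<le> 2 * r" for t
  proof -
    have "1 / 2 ^ n \<le> 2 * r"
    proof -
      have "1 / 2 ^ n = p (- 1)" using p_simps(7)[of 0 1] by (simp add: p_simps)
      also have "\<dots> \<le> r" unfolding r_def by (rule p_mono) (use \<theta> in simp)
      finally show ?thesis using p_simps(3)[of "- (1 - \<theta>)"] by (simp add: r_def)
    qed
    then have "2 / (2 * r) \<le> tau n E t"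
      using that p_simps(3) by (intro tau_lower_bound) (auto simp: r_def)
    moreover have "2 / (2 * r) = p (1 - \<theta>)"
      using p_simps(7)[of 0 "- (1 - \<theta>)"] by (simp add: r_def p_simps)
    moreover have "L = p (4 * \<theta>) * p (1 - \<theta>)"
      by (simp add: p_simps L_def add.commute)
    ultimately show ?thesis
      using p_simps(3)[of "4 * \<theta>"] by (simp add: \<rho>_def)
  qed
  have far: "2 / \<bar>t - E\<bar> \<le> \<rho> t" if "\<bar>t - E\<bar> > 2 * r" for t
  proof -
    have r0: "r > 0" by (simp add: r_def p_simps)
    have "1 / 2 ^ n = p (- 1)" using p_simps(7)[of 0 1] by (simp add: p_simps)
    also have "\<dots> \<le> r" unfolding r_def by (rule p_mono) (use \<theta> in simp)
    finally have "2 / \<bar>t - E\<bar> \<le> tau n E t"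
      using that r0 by (intro tau_lower_bound) auto
    also have "\<dots> \<le> p (4 * \<theta>) * tau n E t"
      using p_mono[of 0 "4 * \<theta>"] \<theta> tau_ge_2[of n E t] by (simp add: p_simps)
    finally show ?thesis by (simp add: \<rho>_def)
  qed
  have L0: "L > 0" and r0: "r > 0" by (simp_all add: L_def r_def p_simps)
  have \<rho>0: "\<rho> t > 0" for t
    unfolding \<rho>_def using tau_ge_2[of n E t] p_simps(3) by (intro mult_pos_pos) auto
  interpret tb: two_block "Bn n" B D ?h ?\<phi>1 ?\<phi>2 ?l1 ?l2 \<rho> E r L
  proof
    show "2 / L \<le> \<bar>?l1 b - ?l2 d\<bar>"
      if "b \<in> B" "d \<in> D" "\<bar>?l1 b - E\<bar> \<le> 2 * r" "\<bar>?l2 d - E\<bar> \<le> 2 * r" for b d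
      using eigenvalue_separation[OF L0 blocks(6,7) _ that(1,3,2)] \<omega> by (simp add: good_def J_def)
  qed (use blocks eigbas_eigen_on[OF _ symm_on_Hn] symm_on_Hn near far L0 r0 \<rho>0 in auto)
  have \<kappa>: "tb.\<kappa> = p (8 * \<theta>) * cross_weight n c (tau n E) B D \<omega>"
    unfolding tb.\<kappa>_def tb.v_def by (rule cross_weight_scaled)
  have "tb.\<kappa> \<le> p (8 * \<theta>) * (2 powr (- (2 + c) * real k) * p (2 + 2 * \<theta>))"
    unfolding \<kappa> using \<omega> p_simps(3) by (intro mult_left_mono) (auto simp: good_def less_imp_le)
  also have "2 powr (- (2 + c) * real k) \<le> p (- (2 + c) * (1 - \<theta>))"
  proof -
    have "(2 + c) * ((1 - \<theta>) * real n) \<le> (2 + c) * real k"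
      using k c by (intro mult_left_mono) auto
    then show ?thesis unfolding p_def by (intro powr_mono) (auto simp: algebra_simps)
  qed
  also have "p (8 * \<theta>) * (p (- (2 + c) * (1 - \<theta>)) * p (2 + 2 * \<theta>)) = p (12 * \<theta> - c * (1 - \<theta>))"
    by (simp add: p_simps algebra_simps)
  also have "\<dots> \<le> p (- 80 * \<theta>)"
  proof (rule p_mono)
    have "100 * \<theta> * (99/100) \<le> c * (1 - \<theta>)" using \<theta> by (intro mult_mono) auto
    then show "12 * \<theta> - c * (1 - \<theta>) \<le> - 80 * \<theta>" using \<theta> by linarith
  qed
  finally have \<kappa>p: "tb.\<kappa> \<le> p (- 80 * \<theta>)"
    by (simp add: p_simps)
  have pm: "p (- \<theta>) \<le> 1/2"
  proof -
    have "p (- \<theta>) * p \<theta> = 1" by (simp add: p_simps)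
    moreover have "p (- \<theta>) * 2 \<le> p (- \<theta>) * p \<theta>"
      by (intro mult_left_mono p_\<theta> less_imp_le p_simps(3))
    ultimately show ?thesis by simp
  qed
  have \<kappa>h: "tb.\<kappa> \<le> 1/2"
    using \<kappa>p pm p_mono[of "- 80 * \<theta>" "- \<theta>"] \<theta> by linarith
  have T: "(\<Sum>b\<in>B. \<rho> (?l1 b)) + (\<Sum>d\<in>D. \<rho> (?l2 d)) \<le> 2 * p (1 + 6 * \<theta>)"
  proof -
    have "(\<Sum>b\<in>B. \<rho> (?l1 b)) = p (4 * \<theta>) * (\<Sum>y\<in>B. fcalc B ?h (tau n E) y y)"
      using fcalc_trace[OF blocks(6) symm_on_Hn] by (simp add: \<rho>_def sum_distrib_left)
    also have "\<dots> \<le> p (4 * \<theta>) * p (1 + 2 * \<theta>)"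
      using \<omega> p_simps(3) by (intro mult_left_mono) (auto simp: good_def less_imp_le)
    finally have 1: "(\<Sum>b\<in>B. \<rho> (?l1 b)) \<le> p (1 + 6 * \<theta>)" by (simp add: p_simps algebra_simps)
    have "(\<Sum>d\<in>D. \<rho> (?l2 d)) = p (4 * \<theta>) * (\<Sum>y\<in>D. fcalc D ?h (tau n E) y y)"
      using fcalc_trace[OF blocks(7) symm_on_Hn] by (simp add: \<rho>_def sum_distrib_left)
    also have "\<dots> \<le> p (4 * \<theta>) * p (1 + 2 * \<theta>)"
      using \<omega> p_simps(3) by (intro mult_left_mono) (auto simp: good_def less_imp_le)
    finally have 2: "(\<Sum>d\<in>D. \<rho> (?l2 d)) \<le> p (1 + 6 * \<theta>)" by (simp add: p_simps algebra_simps)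
    from 1 2 show ?thesis by simp
  qed
  have Tx: "(\<Sum>b\<in>B. \<rho> (?l1 b) * (?\<phi>1 b x)\<^sup>2) \<le> p (6 * \<theta>)"
  proof -
    have "(\<Sum>b\<in>B. \<rho> (?l1 b) * (?\<phi>1 b x)\<^sup>2) = p (4 * \<theta>) * fcalc B ?h (tau n E) x x"
      by (simp add: \<rho>_def fcalc_def sum_distrib_left power2_eq_square mult_ac)
    also have "\<dots> \<le> p (4 * \<theta>) * p (2 * \<theta>)"
      using \<omega> p_simps(3) by (intro mult_left_mono) (auto simp: good_def less_imp_le)
    finally show ?thesis by (simp add: p_simps)
  qed
  have cardD: "real (card D) \<le> p 1"
    using real_card_le[OF blocks(2)] by (simp only: p_simps(5))
  have "(\<Sum>y\<in>D. Qcorr n psi lam x y {E - r .. E + r})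
      \<le> 2 * sqrt tb.\<kappa> * (2 * p (1 + 6 * \<theta>) / L\<^sup>2) * sqrt (p (6 * \<theta>)) * sqrt (real (card D) * (2 * p (1 + 6 * \<theta>)))"
    unfolding Qcorr_def
    by (rule tb.correlator_offblock_bound[OF finite_Bn _ \<kappa>h blocks(5) T Tx]) (use eig in \<open>simp add: is_eigbasis_eigen_on\<close>)
  also have "\<dots> \<le> 2 * p (- 40 * \<theta>) * (2 * p (1 + 6 * \<theta>) / L\<^sup>2) * p (3 * \<theta>) * (2 * p (1 + 3 * \<theta>))"
  proof (intro mult_mono order_refl)
    show "sqrt tb.\<kappa> \<le> p (- 40 * \<theta>)"
      using real_sqrt_le_mono[OF \<kappa>p] by (simp add: p_simps)
    show "sqrt (p (6 * \<theta>)) \<le> p (3 * \<theta>)"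
      by (simp add: p_simps)
    have "real (card D) * (2 * p (1 + 6 * \<theta>)) \<le> p 1 * (4 * p (1 + 6 * \<theta>))"
      using cardD p_simps(3) by (intro mult_mono) (auto simp: less_imp_le)
    also have "\<dots> = (2 * p (1 + 3 * \<theta>))\<^sup>2"
      by (simp add: p_simps power_mult_distrib algebra_simps)
    finally show "sqrt (real (card D) * (2 * p (1 + 6 * \<theta>))) \<le> 2 * p (1 + 3 * \<theta>)"
      using p_simps(3)[of "1 + 3 * \<theta>"] by (intro real_le_lsqrt) auto
  qed (use p_simps(3) L0 tb.\<kappa>_nonneg in \<open>auto intro!: mult_nonneg_nonneg divide_nonneg_pos intro: less_imp_le\<close>)
  also have "\<dots> = 8 * (p (- 40 * \<theta>) * (p (1 + 6 * \<theta>) / L\<^sup>2) * p (3 * \<theta>) * p (1 + 3 * \<theta>))"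
    by simp
  also have "\<dots> = 8 * p (- 34 * \<theta>)"
    by (simp add: p_simps L_def algebra_simps)
  also have "\<dots> \<le> p \<theta> * p \<theta> * p \<theta> * p (- 34 * \<theta>)"
  proof (rule mult_right_mono)
    have "2 * 2 * 2 \<le> p \<theta> * p \<theta> * p \<theta>"
      using p_\<theta> by (intro mult_mono) auto
    then show "8 \<le> p \<theta> * p \<theta> * p \<theta>" by simp
  qed (use p_simps(3) in \<open>simp add: less_imp_le\<close>)
  also have "\<dots> = p (- 31 * \<theta>)" by (simp add: p_simps)
  also have "\<dots> \<le> p (- \<theta>)" by (rule p_mono) (use \<theta> in simp)
  finally show ?thesis .
qed

lemma good_sets: "good \<in> sets (ens_space n)"
proof -
  have tau: "continuous_on UNIV (tau n E)" using averaged_tau[OF c] by (auto simp: averaged_def)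
  have L0: "L > 0" by (simp add: L_def p_simps)
  note [measurable] = borel_measurable_pair_weight[OF blocks(1,2) L0] borel_measurable_cross_weight[OF blocks(1,2) tau]
  have m: "(\<lambda>\<omega>. \<Sum>y\<in>X. fcalc X (Hn n c \<omega>) (tau n E) y y) \<in> borel_measurable (ens_space n)" if "X \<subseteq> Bn n" for X
    by (intro borel_measurable_sum borel_measurable_fcalc_Hn tau that)
  note [measurable] = m[OF blocks(1)] m[OF blocks(2)] borel_measurable_fcalc_Hn[OF blocks(1) tau blocks(5) blocks(5)]
  show ?thesis unfolding good_def by measurable
qed

lemma measure_not_good:
  "measure (ens_space n) (space (ens_space n) - good) \<le> (3 * K + K\<^sup>2 + 1008 * pi\<^sup>2) * p (- 2 * \<theta>)"
proof -
  interpret prob_space "ens_space n" by (rule prob_space_ens_space)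
  have av: "averaged n c (tau n E) K" unfolding K_def by (rule averaged_tau[OF c])
  then have tau: "continuous_on UNIV (tau n E)" and K0: "0 \<le> K" by (auto simp: averaged_def)
  have L0: "L > 0" by (simp add: L_def p_simps)
  define A1 where "A1 = {\<omega> \<in> space (ens_space n). p (1 + 2 * \<theta>) \<le> (\<Sum>y\<in>B. fcalc B (Hn n c \<omega>) (tau n E) y y)}"
  define A2 where "A2 = {\<omega> \<in> space (ens_space n). p (1 + 2 * \<theta>) \<le> (\<Sum>z\<in>D. fcalc D (Hn n c \<omega>) (tau n E) z z)}"
  define A3 where "A3 = {\<omega> \<in> space (ens_space n). p (2 * \<theta>) \<le> fcalc B (Hn n c \<omega>) (tau n E) x x}"
  define A4 where "A4 = {\<omega> \<in> space (ens_space n). 2 powr (- (2 + c) * real k) * p (2 + 2 * \<theta>) \<le> cross_weight n c (tau n E) B D \<omega>}"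
  define A5 where "A5 = {\<omega> \<in> space (ens_space n). 1/4 \<le> pair_weight n c E L J B D \<omega>}"
  have m: "(\<lambda>\<omega>. \<Sum>y\<in>X. fcalc X (Hn n c \<omega>) (tau n E) y y) \<in> borel_measurable (ens_space n)" if "X \<subseteq> Bn n" for X
    by (intro borel_measurable_sum borel_measurable_fcalc_Hn tau that)
  note mx = borel_measurable_fcalc_Hn[OF blocks(1) tau blocks(5) blocks(5), of c]
  note mc = borel_measurable_cross_weight[OF blocks(1,2) tau, of c]
  note mp = borel_measurable_pair_weight[OF blocks(1,2) L0, of c E J]
  have tr: "prob {\<omega> \<in> space (ens_space n). p (1 + 2 * \<theta>) \<le> (\<Sum>y\<in>X. fcalc X (Hn n c \<omega>) (tau n E) y y)} \<le> K * p (- 2 * \<theta>)"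
    if "X \<subseteq> Bn n" for X
  proof -
    have "prob {\<omega> \<in> space (ens_space n). p (1 + 2 * \<theta>) \<le> (\<Sum>y\<in>X. fcalc X (Hn n c \<omega>) (tau n E) y y)} \<le> 2 ^ n * K / p (1 + 2 * \<theta>)"
      by (rule markov_bound[OF m[OF that] nn_integral_averaged_trace[OF av that]]) (use K0 p_simps(3) in auto)
    also have "\<dots> = K * (p 1 / p (1 + 2 * \<theta>))" by (simp add: p_simps(5))
    finally show ?thesis by (simp add: p_simps)
  qed
  have 1: "prob A1 \<le> K * p (- 2 * \<theta>)" and 2: "prob A2 \<le> K * p (- 2 * \<theta>)"
    unfolding A1_def A2_def by (intro tr blocks)+
  have "prob A3 \<le> K / p (2 * \<theta>)"
    unfolding A3_def
    by (rule markov_bound[OF mx nn_integral_averaged[OF av blocks(1,5)]]) (use K0 p_simps(3) in auto)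
  also have "\<dots> = K * (p 0 / p (2 * \<theta>))" by (simp add: p_simps(4))
  finally have 3: "prob A3 \<le> K * p (- 2 * \<theta>)" by (simp add: p_simps(7))
  have "prob A4 \<le> 2 powr (- (2 + c) * real k) * (2 ^ n * K)\<^sup>2 / (2 powr (- (2 + c) * real k) * p (2 + 2 * \<theta>))"
    unfolding A4_def
    by (rule markov_bound[OF mc nn_integral_cross_weight[OF c av, of k x, folded B_def D_def]])
       (use p_simps(3) in auto)
  also have "\<dots> = K\<^sup>2 * ((p 1)\<^sup>2 / p (2 + 2 * \<theta>))"
    by (simp add: p_simps(5) power_mult_distrib)
  finally have 4: "prob A4 \<le> K\<^sup>2 * p (- 2 * \<theta>)"
    by (simp add: p_simps(6,7))
  have "prob A5 \<le> real (card {-J..J}) * (2 ^ n * (6 * pi / L))\<^sup>2 / (1/4)"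
    unfolding A5_def
    by (rule markov_bound[OF mp nn_integral_pair_weight[OF c L0 blocks(1,2,3)]]) auto
  \<comment> \<open>The grid has \<open>2 * J + 1\<close> points, at most
    \<open>4 * p (4 * \<theta>) + 3\<close>. The final constant is 1008 = 7 * 36 * 4.\<close>
  also have "\<dots> \<le> 7 * p (4 * \<theta>) * (2 ^ n * (6 * pi / L))\<^sup>2 / (1/4)"
  proof (intro divide_right_mono mult_right_mono)
    have rL: "2 * r * L = 2 * p (4 * \<theta>)" by (simp add: r_def L_def p_simps)
    have "p (4 * \<theta>) \<ge> 1" using p_mono[of 0 "4 * \<theta>"] \<theta> by (simp add: p_simps)
    moreover have "of_int J \<le> 2 * p (4 * \<theta>) + 1" "0 \<le> 2 * p (4 * \<theta>)"
      using p_simps(3)[of "4 * \<theta>"] unfolding J_def rL by linarith+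
    moreover have "0 \<le> J" using p_simps(3)[of "4 * \<theta>"] unfolding J_def rL by simp
    then have "real (card {-J..J}) = 2 * of_int J + 1" by simp
    ultimately show "real (card {-J..J}) \<le> 7 * p (4 * \<theta>)" by linarith
  qed auto
  also have "\<dots> = 1008 * pi\<^sup>2 * (p (4 * \<theta>) * (p 1)\<^sup>2 / L\<^sup>2)"
    by (simp add: p_simps(5) power_mult_distrib power_divide)
  finally have 5: "prob A5 \<le> 1008 * pi\<^sup>2 * p (- 2 * \<theta>)"
    by (simp add: p_simps L_def)
  have ev: "A1 \<in> events" "A2 \<in> events" "A3 \<in> events" "A4 \<in> events" "A5 \<in> events"
    unfolding A1_def A2_def A3_def A4_def A5_def using m[OF blocks(1)] m[OF blocks(2)] mx mc mp by measurable
  have sub: "space (ens_space n) - good \<subseteq> A1 \<union> (A2 \<union> (A3 \<union> (A4 \<union> A5)))"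
    by (auto simp: good_def A1_def A2_def A3_def A4_def A5_def)
  have "prob (space (ens_space n) - good) \<le> prob (A1 \<union> (A2 \<union> (A3 \<union> (A4 \<union> A5))))"
    by (rule finite_measure_mono[OF sub]) (use ev in auto)
  also have "\<dots> \<le> prob A1 + (prob A2 + (prob A3 + (prob A4 + prob A5)))"
    by (intro order_trans[OF measure_Un_le] add_left_mono order_refl sets.Un ev)
  also have "\<dots> \<le> K * p (- 2 * \<theta>) + (K * p (- 2 * \<theta>) + (K * p (- 2 * \<theta>) + (K\<^sup>2 * p (- 2 * \<theta>) + 1008 * pi\<^sup>2 * p (- 2 * \<theta>))))"
    by (intro add_mono 1 2 3 4 5)
  finally show ?thesis by (simp add: algebra_simps)
qed

text \<open>The exceptional set quantifies over all eigenbases; as the bound on \<open>good\<close>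
  holds for each of them, the set is enclosed in the measurable complement of
  \<open>good\<close>.\<close>

lemma correlator_exceptional_event:
  "\<exists>A\<in>sets (ens_space n).
     {\<omega>\<in>space (ens_space n). \<exists>psi lam. is_eigbasis n (Hn n c \<omega>) psi lam \<and>
        (\<Sum>y\<in>Bn n - hball n (int k) x. Qcorr n psi lam x y
            {E - 2 powr (- (1 - \<theta>) * real n) .. E + 2 powr (- (1 - \<theta>) * real n)}) > 2 powr (- \<theta> * real n)} \<subseteq> A \<and>
     measure (ens_space n) A \<le>
       (3 * (2 + 16 * pi * (real n + 1)) + (2 + 16 * pi * (real n + 1))\<^sup>2 + 1008 * pi\<^sup>2) * 2 powr (- 2 * \<theta> * real n)"
proof (intro bexI conjI)
  show "space (ens_space n) - good \<in> sets (ens_space n)" using good_sets by auto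
  show "measure (ens_space n) (space (ens_space n) - good) \<le>
      (3 * (2 + 16 * pi * (real n + 1)) + (2 + 16 * pi * (real n + 1))\<^sup>2 + 1008 * pi\<^sup>2) * 2 powr (- 2 * \<theta> * real n)"
    using measure_not_good by (simp add: K_def p_def)
  show "{\<omega>\<in>space (ens_space n). \<exists>psi lam. is_eigbasis n (Hn n c \<omega>) psi lam \<and>
        (\<Sum>y\<in>Bn n - hball n (int k) x. Qcorr n psi lam x y
            {E - 2 powr (- (1 - \<theta>) * real n) .. E + 2 powr (- (1 - \<theta>) * real n)}) > 2 powr (- \<theta> * real n)}
      \<subseteq> space (ens_space n) - good"
    using good_correlator_bound unfolding D_def r_def p_def by (auto simp: not_less[symmetric])
qed

end

text \<open>The polynomial factor from the logarithmic traces is absorbed by giving up half of the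
  decay \<open>2^(-2 \<theta> n)\<close>.\<close>

lemma quadratic_le_exponential:
  assumes "\<theta> > 0"
  shows "\<exists>C. \<forall>n::nat. 3 * (2 + 16 * pi * (real n + 1)) + (2 + 16 * pi * (real n + 1))\<^sup>2 + 1008 * pi\<^sup>2 \<le> C * 2 powr (\<theta> * real n)"
proof -
  let ?f = "\<lambda>n::nat. (3 * (2 + 16 * pi * (real n + 1)) + (2 + 16 * pi * (real n + 1))\<^sup>2 + 1008 * pi\<^sup>2) * 2 powr (- \<theta> * real n)"
  have "?f \<longlonglongrightarrow> 0" using assms by real_asymp
  then have "Bseq ?f" by (intro convergent_imp_Bseq) (auto simp: convergent_def)
  then obtain C where C: "\<And>n. norm (?f n) \<le> C" by (auto simp: Bseq_def)
  have "3 * (2 + 16 * pi * (real n + 1)) + (2 + 16 * pi * (real n + 1))\<^sup>2 + 1008 * pi\<^sup>2 \<le> C * 2 powr (\<theta> * real n)" for n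
  proof -
    have "?f n \<le> C" using C[of n] by (simp add: abs_le_iff)
    then have "?f n * 2 powr (\<theta> * real n) \<le> C * 2 powr (\<theta> * real n)" by (rule mult_right_mono) simp
    then show ?thesis by (simp add: mult.assoc powr_add[symmetric])
  qed
  then show ?thesis by blast
qed

theorem theorem1p2:
  fixes c E :: real
  assumes "c > 0"
  shows "\<exists>w \<mu> \<kappa> C :: real. \<exists>m :: nat \<Rightarrow> int.
           w > 0 \<and> \<mu> > 0 \<and> \<kappa> > 0 \<and>
           filterlim (\<lambda>n. int n - m n) at_top sequentially \<and>
           (\<forall>n. \<forall>x\<in>Bn n. \<exists>A\<in>sets (ens_space n).
              {\<omega>\<in>space (ens_space n). \<exists>psi lam. is_eigbasis n (Hn n c \<omega>) psi lam \<and>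
                  (\<Sum>y\<in>Bn n - hball n (m n) x.
                     Qcorr n psi lam x y {E - 2 powr (- (1 - w) * real n) .. E + 2 powr (- (1 - w) * real n)})
                  > 2 powr (- \<mu> * real n)} \<subseteq> A \<and>
              measure (ens_space n) A \<le> C * 2 powr (- \<kappa> * real n))"
proof -
  define \<theta> where "\<theta> = min c 1 / 100"
  have \<theta>: "0 < \<theta>" "\<theta> \<le> 1/100" "100 * \<theta> \<le> c" using assms by (auto simp: \<theta>_def)
  obtain C where C: "\<And>n::nat. 3 * (2 + 16 * pi * (real n + 1)) + (2 + 16 * pi * (real n + 1))\<^sup>2 + 1008 * pi\<^sup>2 \<le> C * 2 powr (\<theta> * real n)"
    using quadratic_le_exponential[OF \<theta>(1)] by blast
  \<comment> \<open>By \<open>fl\<close> this natural subtraction does not truncate.\<close>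
  define k where "k n = n - nat \<lfloor>\<theta> * real n\<rfloor>" for n
  have fl: "nat \<lfloor>\<theta> * real n\<rfloor> \<le> n" "real (nat \<lfloor>\<theta> * real n\<rfloor>) \<le> \<theta> * real n" for n
  proof -
    have "0 \<le> \<theta> * real n" "\<theta> * real n \<le> 1 * real n" using \<theta> by (intro mult_nonneg_nonneg mult_right_mono; simp)+
    then show "nat \<lfloor>\<theta> * real n\<rfloor> \<le> n" "real (nat \<lfloor>\<theta> * real n\<rfloor>) \<le> \<theta> * real n" by linarith+
  qed
  have k: "(1 - \<theta>) * real n \<le> real (k n)" for n
    using fl[of n] by (simp add: k_def of_nat_diff algebra_simps)
  have lim: "filterlim (\<lambda>n. int n - int (k n)) at_top sequentially"
    unfolding filterlim_at_top
  proof
    fix Z :: int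
    have "Z \<le> int n - int (k n)" if "n \<ge> nat \<lceil>of_int Z / \<theta>\<rceil>" for n
    proof -
      have "of_int Z / \<theta> \<le> real n" using that by linarith
      then have "of_int Z \<le> \<theta> * real n" using \<theta> by (simp add: field_simps)
      then have "Z \<le> \<lfloor>\<theta> * real n\<rfloor>" by (simp add: le_floor_iff)
      also have "\<dots> \<le> int n - int (k n)" using fl(1)[of n] by (simp add: k_def of_nat_diff)
      finally show ?thesis .
    qed
    then show "\<forall>\<^sub>F n in sequentially. Z \<le> int n - int (k n)"
      unfolding eventually_sequentially by blast
  qed
  have main: "\<exists>A\<in>sets (ens_space n).
      {\<omega>\<in>space (ens_space n). \<exists>psi lam. is_eigbasis n (Hn n c \<omega>) psi lam \<and>
          (\<Sum>y\<in>Bn n - hball n (int (k n)) x.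
             Qcorr n psi lam x y {E - 2 powr (- (1 - \<theta>) * real n) .. E + 2 powr (- (1 - \<theta>) * real n)})
          > 2 powr (- \<theta> * real n)} \<subseteq> A \<and>
      measure (ens_space n) A \<le> (max C 2) * 2 powr (- \<theta> * real n)" if x: "x \<in> Bn n" for n x
  proof (cases "1 \<le> \<theta> * real n")
    case True
    have "(3 * (2 + 16 * pi * (real n + 1)) + (2 + 16 * pi * (real n + 1))\<^sup>2 + 1008 * pi\<^sup>2) * 2 powr (- 2 * \<theta> * real n)
        \<le> C * 2 powr (\<theta> * real n) * 2 powr (- 2 * \<theta> * real n)"
      by (rule mult_right_mono[OF C]) simp
    also have "\<dots> = C * 2 powr (- \<theta> * real n)"
      by (simp add: mult.assoc powr_add[symmetric])
    also have "\<dots> \<le> max C 2 * 2 powr (- \<theta> * real n)"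
      by (rule mult_right_mono) auto
    finally show ?thesis
      using scale_separation.correlator_exceptional_event[OF scale_separation.intro[OF assms \<theta> True k x], of E]
      by (meson order_trans)
  next
    \<comment> \<open>For these finitely many \<open>n\<close> the whole space is taken as
      exceptional event: \<open>2 powr (- \<theta> * real n)\<close> is at least 1/2, so the
      constant 2 suffices.\<close>
    case False
    interpret prob_space "ens_space n" by (rule prob_space_ens_space)
    have "2 powr (- 1) \<le> (2::real) powr (- \<theta> * real n)"
      using False by (intro powr_mono) auto
    then have "1 \<le> 2 * (2::real) powr (- \<theta> * real n)"
      by (simp add: powr_minus)
    also have "\<dots> \<le> max C 2 * 2 powr (- \<theta> * real n)"
      by (rule mult_right_mono) auto
    finally show ?thesis
      by (intro bexI[of _ "space (ens_space n)"]) (auto simp: prob_space)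
  qed
  show ?thesis
    by (intro exI[of _ \<theta>] exI[of _ "max C 2"] exI[of _ "\<lambda>n. int (k n)"] conjI \<theta>(1) lim allI ballI main)
qed

end
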